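(* Let $\mathcal{A}$ be a cluster algebra. Then the following are equivalent. (1) (Locally acyclic) $\mathcal{X}_{\mathcal{A}}$ has a finite cover by acyclic cluster charts. (2) (Locally tree-type) $\mathcal{X}_{\mathcal{A}}$ has a finite cover by tree-type cluster charts. (3) (Locally finite-type) $\mathcal{X}_{\mathcal{A}}$ has a finite cover by finite-type cluster charts. (4) (Locally $A$-type) $\mathcal{X}_{\mathcal{A}}$ has a finite cover by $A$-type cluster charts. (5) (Locally isolated) $\mathcal{X}_{\mathcal{A}}$ has a finite cover by isolated cluster charts.
   Context: **Ice quivers and seeds.** An ice quiver $\mathsf{Q}$ is a finite quiver without loops or directed 2-cycles, together with a distinguished subset of vertices called frozen; the other vertices are called mutable. $\mathsf{Q}_{mut}$ is the induced subquiver on the mutable vertices. For vertices $i,j$ put $\mathsf{Q}_{ij}:=\#(\text{arrows from } i \text{ to } j)-\#(\text{arrows from } j\text{ to } i)$; this skew-symmetric integer matrix determines $\mathsf{Q}$. A seed $(\mathsf{Q},\mathbf{a})$ of rank $n$ is an ice quiver on vertices $1,\dots,n$ together with a cluster $\mathbf{a}=\{a_1,\dots,a_n\}$, an $n$-tuple of algebraically independent elements generating the field $\mathbb{Q}(x_1,\dots,x_n)$. The element $a_i$ is called mutable (resp. frozen) if vertex $i$ is. **Mutation.** For a mutable vertex $k$, the mutation of $(\mathsf{Q},\mathbf{a})$ at $k$ is the seed $(\mu_k(\mathsf{Q}),\mu_k(\mathbf{a}))$ with the same frozen vertices, with $\mu_k(\mathsf{Q})_{ij}=-\mathsf{Q}_{ij}$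 if $k\in\{i,j\}$ and $\mu_k(\mathsf{Q})_{ij}=\mathsf{Q}_{ij}+\frac{|\mathsf{Q}_{ik}|\mathsf{Q}_{kj}+\mathsf{Q}_{ik}|\mathsf{Q}_{kj}|}{2}$ otherwise, and with $\mu_k(a_i)=a_i$ for $i\neq k$ and $\mu_k(a_k)=\left(\prod_{\mathsf{Q}_{kj}>0}a_j^{\mathsf{Q}_{kj}}+\prod_{\mathsf{Q}_{kj}<0}a_j^{-\mathsf{Q}_{kj}}\right)a_k^{-1}$. Seeds related by finite sequences of mutations are mutation equivalent. **Cluster algebras.** The cluster algebra $\mathcal{A}(\mathsf{Q},\mathbf{a})$ is the subring of $\mathbb{Q}(x_1,\dots,x_n)$ generated by all cluster variables (the elements of the clusters of all seeds mutation equivalent to $(\mathsf{Q},\mathbf{a})$) and the inverses of the frozen variables. Those seeds are the seeds of $\mathcal{A}$. Put $\mathcal{X}_{\mathcal{A}}:=\mathrm{Spec}(\mathcal{A})$. **Types.** An ice quiver $\mathsf{Q}$ (and any seed with that ice quiver) is: acyclic if $\mathsf{Q}_{mut}$ has no directed cycles; tree-type if $\mathsf{Q}_{mut}$ is an orientation of a (disjoint) union of trees; finite-type if $\mathsf{Q}_{mut}$ is an orientation of a union of (simply-laced) Dynkin diagrams; $A$-type if $\mathsf{Q}_{mut}$ is an orientation of a union of type $A$ Dynkin diagrams; isolated if $\mathsf{Q}_{mut}$ has no arrows at all. A cluster algebra is acyclic, tree-type, finite-type, $A$-type or isolated if it has a seed of that type. **Cluster charts.** Given a seed $(\mathsf{Q},\mathbf{a})$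 of $\mathcal{A}$ and a set $\{a_1,\dots,a_i\}$ of mutable variables in $\mathbf{a}$, the freezing of $\mathcal{A}$ at this set is the cluster algebra $\mathcal{A}'$ of the seed obtained from $(\mathsf{Q},\mathbf{a})$ by declaring the corresponding vertices frozen as well. The freezing $\mathcal{A}'$ is a cluster localization of $\mathcal{A}$ if $\mathcal{A}'=\mathcal{A}[a_1^{-1},\dots,a_i^{-1}]$ as subrings of $\mathbb{Q}(x_1,\dots,x_n)$; the corresponding open subscheme $\mathcal{X}_{\mathcal{A}'}\subseteq\mathcal{X}_{\mathcal{A}}$ is a cluster chart, called acyclic, tree-type, etc. if $\mathcal{A}'$ is. *)

theory Defs
  imports
    "HOL-Library.Poly_Mapping"
    "HOL-Library.Disjoint_Sets"
    "HOL-Computational_Algebra.Fraction_Field"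
    "HOL-Algebra.Generated_Fields"
    "HOL-Algebra.Algebraic_Closure_Type"
begin

section \<open>The field of rational functions\<close>

text \<open>
  A monomial is its finitely supported exponent vector. The type \<open>ratfun\<close> is the field of rational
  functions over the rationals in countably many variables; rational functions in
  \<open>x\<^sub>1, \<dots>, x\<^sub>n\<close> form the subfield \<open>ratfun_field n\<close>.
\<close>

type_synonym mpoly = "(nat \<Rightarrow>\<^sub>0 nat) \<Rightarrow>\<^sub>0 rat"
type_synonym ratfun = "mpoly fract"

definition rconst :: "rat \<Rightarrow> ratfun" where
  "rconst c = Fraction_Field.Fract (Poly_Mapping.single 0 c) 1"

definition rvar :: "nat \<Rightarrow> ratfun" where
  "rvar i = Fraction_Field.Fract (Poly_Mapping.single (Poly_Mapping.single i 1) 1) 1"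

abbreviation ratfun_ring :: "ratfun ring" where
  "ratfun_ring \<equiv> ring_of_type_algebra"

definition ratfun_field :: "nat \<Rightarrow> ratfun set" where
  "ratfun_field n = generate_field ratfun_ring (rvar ` {1..n})"

definition mpoly_eval :: "(nat \<Rightarrow> ratfun) \<Rightarrow> mpoly \<Rightarrow> ratfun" where
  "mpoly_eval a p =
     (\<Sum>m\<in>Poly_Mapping.keys p. rconst (Poly_Mapping.lookup p m) *
        (\<Prod>i\<in>Poly_Mapping.keys m. a i ^ Poly_Mapping.lookup m i))"

definition algebraically_independent :: "nat \<Rightarrow> (nat \<Rightarrow> ratfun) \<Rightarrow> bool" where
  "algebraically_independent n a \<longleftrightarrow>
     (\<forall>p. (\<forall>m\<in>Poly_Mapping.keys p. Poly_Mapping.keys m \<subseteq> {1..n}) \<and> mpoly_eval a p = 0 \<longrightarrow> p = 0)"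


section \<open>Ice quivers, seeds and mutation\<close>

text \<open>
  The vertices are \<open>1, \<dots>, nverts\<close>, and \<open>arrows q i j\<close> is the number of arrows from \<open>i\<close> to \<open>j\<close> minus
  the number of arrows from \<open>j\<close> to \<open>i\<close>. As there are no loops and no directed 2-cycles, there are
  exactly \<open>max 0 (arrows q i j)\<close> arrows from \<open>i\<close> to \<open>j\<close>.
\<close>

record ice_quiver =
  nverts :: nat
  frozen :: "nat set"
  arrows :: "nat \<Rightarrow> nat \<Rightarrow> int"

definition verts :: "ice_quiver \<Rightarrow> nat set" where
  "verts q = {1..nverts q}"

definition mutables :: "ice_quiver \<Rightarrow> nat set" where
  "mutables q = verts q - frozen q"

definition is_ice_quiver :: "ice_quiver \<Rightarrow> bool" where
  "is_ice_quiver q \<longleftrightarrow>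
     frozen q \<subseteq> verts q \<and>
     (\<forall>i j. arrows q i j = - arrows q j i) \<and>
     (\<forall>i j. arrows q i j \<noteq> 0 \<longrightarrow> i \<in> verts q \<and> j \<in> verts q)"

text \<open>Only the values of \<open>cluster s\<close> on the vertices of \<open>quiver s\<close> are meaningful.\<close>

record seed =
  quiver :: ice_quiver
  cluster :: "nat \<Rightarrow> ratfun"

definition is_seed :: "seed \<Rightarrow> bool" where
  "is_seed s \<longleftrightarrow>
     is_ice_quiver (quiver s) \<and>
     algebraically_independent (nverts (quiver s)) (cluster s) \<and>
     generate_field ratfun_ring (cluster s ` verts (quiver s)) = ratfun_field (nverts (quiver s))"

text \<open>The division by 2 in the exchange of arrows is exact.\<close>

definition mutate_quiver :: "nat \<Rightarrow> ice_quiver \<Rightarrow> ice_quiver" where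
  "mutate_quiver k q = q\<lparr>arrows := (\<lambda>i j.
     if k \<in> {i, j} then - arrows q i j
     else arrows q i j +
       (\<bar>arrows q i k\<bar> * arrows q k j + arrows q i k * \<bar>arrows q k j\<bar>) div 2)\<rparr>"

definition mutate_cluster :: "nat \<Rightarrow> ice_quiver \<Rightarrow> (nat \<Rightarrow> ratfun) \<Rightarrow> nat \<Rightarrow> ratfun" where
  "mutate_cluster k q a = a(k :=
     ((\<Prod>j\<in>{j \<in> verts q. arrows q k j > 0}. a j ^ nat (arrows q k j)) +
      (\<Prod>j\<in>{j \<in> verts q. arrows q k j < 0}. a j ^ nat (- arrows q k j))) * inverse (a k))"

definition mutate :: "nat \<Rightarrow> seed \<Rightarrow> seed" where
  "mutate k s = \<lparr>quiver = mutate_quiver k (quiver s),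
                 cluster = mutate_cluster k (quiver s) (cluster s)\<rparr>"

definition mutation_step :: "seed \<Rightarrow> seed \<Rightarrow> bool" where
  "mutation_step s t \<longleftrightarrow> (\<exists>k\<in>mutables (quiver s). t = mutate k s)"

definition mutation_equivalent :: "seed \<Rightarrow> seed \<Rightarrow> bool" where
  "mutation_equivalent = mutation_step\<^sup>*\<^sup>*"


section \<open>Cluster algebras\<close>

text \<open>
  A cluster algebra is presented by one of its seeds \<open>s\<close>: its underlying ring is
  \<open>cluster_algebra s\<close>, and its seeds are the seeds mutation equivalent to \<open>s\<close>.
\<close>

definition cluster_algebra :: "seed \<Rightarrow> ratfun set" where
  "cluster_algebra s = generate_ring ratfun_ring
     ({cluster t i | t i. mutation_equivalent s t \<and> i \<in> verts (quiver t)} \<union>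
      {inverse (cluster s i) | i. i \<in> frozen (quiver s)})"

definition freeze :: "nat set \<Rightarrow> seed \<Rightarrow> seed" where
  "freeze S s = s\<lparr>quiver := (quiver s)\<lparr>frozen := frozen (quiver s) \<union> S\<rparr>\<rparr>"

text \<open>
  The set of points of the affine scheme. A family of open subschemes is a cover iff their sets
  of points cover, so this is all that is needed below.
\<close>

definition Spec :: "ratfun set \<Rightarrow> ratfun set set" where
  "Spec A = {P. primeideal P (ratfun_ring\<lparr>carrier := A\<rparr>)}"

text \<open>
  The image of the map \<open>Spec B \<rightarrow> Spec A\<close> induced by an inclusion of rings \<open>A \<subseteq> B\<close>; for \<open>B\<close> a
  localization of \<open>A\<close> at finitely many elements it is the corresponding open subscheme.
\<close>

definition Spec_image :: "ratfun set \<Rightarrow> ratfun set \<Rightarrow> ratfun set set" where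
  "Spec_image A B = (\<lambda>P. P \<inter> A) ` Spec B"

text \<open>
  \<open>cluster_chart s t S\<close>: the seed \<open>t\<close> is a seed of the cluster algebra \<open>\<A>\<close> of \<open>s\<close>, and the freezing of
  \<open>\<A>\<close> at the mutable variables of \<open>t\<close> indexed by \<open>S\<close> is a cluster localization of \<open>\<A>\<close>. The case
  \<open>S = {}\<close>, where the chart is all of the spectrum of \<open>\<A>\<close>, is included.
\<close>

definition cluster_chart :: "seed \<Rightarrow> seed \<Rightarrow> nat set \<Rightarrow> bool" where
  "cluster_chart s t S \<longleftrightarrow>
     mutation_equivalent s t \<and> S \<subseteq> mutables (quiver t) \<and>
     cluster_algebra (freeze S t) =
       generate_ring ratfun_ring (cluster_algebra s \<union> (\<lambda>i. inverse (cluster t i)) ` S)"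


section \<open>Types of quivers\<close>

text \<open>A graph is a pair of a set of vertices and a set of edges, an edge being a two-element set.\<close>

type_synonym graph = "nat set \<times> nat set set"

definition is_graph :: "graph \<Rightarrow> bool" where
  "is_graph = (\<lambda>(V, E). finite V \<and> (\<forall>e\<in>E. e \<subseteq> V \<and> card e = 2))"

definition graph_connected :: "graph \<Rightarrow> bool" where
  "graph_connected = (\<lambda>(V, E). V \<noteq> {} \<and> (\<forall>u\<in>V. \<forall>v\<in>V. (u, v) \<in> {(x, y). {x, y} \<in> E}\<^sup>*))"

definition graph_cycle :: "graph \<Rightarrow> nat list \<Rightarrow> bool" where
  "graph_cycle = (\<lambda>(V, E) vs. length vs \<ge> 3 \<and> distinct vs \<and>
     (\<forall>i. Suc i < length vs \<longrightarrow> {vs ! i, vs ! Suc i} \<in> E) \<and> {last vs, hd vs} \<in> E)"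

definition is_tree :: "graph \<Rightarrow> bool" where
  "is_tree G \<longleftrightarrow> is_graph G \<and> graph_connected G \<and> (\<nexists>vs. graph_cycle G vs)"

definition graph_isomorphic :: "graph \<Rightarrow> graph \<Rightarrow> bool" where
  "graph_isomorphic G H \<longleftrightarrow> (\<exists>f. bij_betw f (fst G) (fst H) \<and> (\<lambda>e. f ` e) ` snd G = snd H)"

text \<open>
  \<open>path_edges n\<close> are the edges of the path with vertices \<open>1, \<dots>, n\<close>. In types \<open>D\<close> and \<open>E\<close> the last
  vertex \<open>n\<close> is attached to the path with vertices \<open>1, \<dots>, n - 1\<close>.
\<close>

definition path_edges :: "nat \<Rightarrow> nat set set" where
  "path_edges n = {{i, Suc i} | i. 1 \<le> i \<and> Suc i \<le> n}"

definition dynkin_A :: "nat \<Rightarrow> graph" where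
  "dynkin_A n = ({1..n}, path_edges n)"

definition dynkin_D :: "nat \<Rightarrow> graph" where
  "dynkin_D n = ({1..n}, insert {n - 2, n} (path_edges (n - 1)))"

definition dynkin_E :: "nat \<Rightarrow> graph" where
  "dynkin_E n = ({1..n}, insert {3, n} (path_edges (n - 1)))"

definition is_A_diagram :: "graph \<Rightarrow> bool" where
  "is_A_diagram G \<longleftrightarrow> is_graph G \<and> (\<exists>n\<ge>1. graph_isomorphic G (dynkin_A n))"

definition is_dynkin_diagram :: "graph \<Rightarrow> bool" where
  "is_dynkin_diagram G \<longleftrightarrow> is_graph G \<and>
     ((\<exists>n\<ge>1. graph_isomorphic G (dynkin_A n)) \<or>
      (\<exists>n\<ge>4. graph_isomorphic G (dynkin_D n)) \<or>
      (\<exists>n\<in>{6, 7, 8}. graph_isomorphic G (dynkin_E n)))"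

definition disjoint_union_of :: "(graph \<Rightarrow> bool) \<Rightarrow> graph \<Rightarrow> bool" where
  "disjoint_union_of P G \<longleftrightarrow>
     (\<exists>\<G>. (\<forall>H\<in>\<G>. P H) \<and> disjoint_family_on fst \<G> \<and> G = (\<Union>(fst ` \<G>), \<Union>(snd ` \<G>)))"

text \<open>\<open>mutable_orientation q G\<close>: the mutable part of \<open>q\<close> is an orientation of the graph \<open>G\<close>.\<close>

definition mutable_orientation :: "ice_quiver \<Rightarrow> graph \<Rightarrow> bool" where
  "mutable_orientation q G \<longleftrightarrow>
     fst G = mutables q \<and>
     (\<forall>i\<in>mutables q. \<forall>j\<in>mutables q. \<bar>arrows q i j\<bar> = (if {i, j} \<in> snd G then 1 else 0))"

definition acyclic_quiver :: "ice_quiver \<Rightarrow> bool" where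
  "acyclic_quiver q \<longleftrightarrow> acyclic {(i, j). i \<in> mutables q \<and> j \<in> mutables q \<and> arrows q i j > 0}"

definition tree_type_quiver :: "ice_quiver \<Rightarrow> bool" where
  "tree_type_quiver q \<longleftrightarrow> (\<exists>G. disjoint_union_of is_tree G \<and> mutable_orientation q G)"

definition finite_type_quiver :: "ice_quiver \<Rightarrow> bool" where
  "finite_type_quiver q \<longleftrightarrow> (\<exists>G. disjoint_union_of is_dynkin_diagram G \<and> mutable_orientation q G)"

definition A_type_quiver :: "ice_quiver \<Rightarrow> bool" where
  "A_type_quiver q \<longleftrightarrow> (\<exists>G. disjoint_union_of is_A_diagram G \<and> mutable_orientation q G)"

definition isolated_quiver :: "ice_quiver \<Rightarrow> bool" where
  "isolated_quiver q \<longleftrightarrow> (\<forall>i\<in>mutables q. \<forall>j\<in>mutables q. arrows q i j = 0)"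

definition cluster_algebra_of_type :: "(ice_quiver \<Rightarrow> bool) \<Rightarrow> seed \<Rightarrow> bool" where
  "cluster_algebra_of_type T s \<longleftrightarrow> (\<exists>t. mutation_equivalent s t \<and> T (quiver t))"

definition locally_of_type :: "(ice_quiver \<Rightarrow> bool) \<Rightarrow> seed \<Rightarrow> bool" where
  "locally_of_type T s \<longleftrightarrow>
     (\<exists>C. finite C \<and>
        (\<forall>(t, S)\<in>C. cluster_chart s t S \<and> cluster_algebra_of_type T (freeze S t)) \<and>
        (\<Union>(t, S)\<in>C. Spec_image (cluster_algebra s) (cluster_algebra (freeze S t))) =
          Spec (cluster_algebra s))"

end

theory Submission
  imports Defs
begin

text \<open>
  Isolated quivers are of type \<open>A\<close>, these are of finite type, and finite-type as well as tree-type
  quivers are acyclic. So the theorem says that a locally acyclic cluster algebra is locally isolated.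
  Freezing a chart further gives a chart, hence it is enough to cover the spectrum of an acyclic
  cluster algebra by isolated charts.

  The cover comes from one relation. If the mutable part of a quiver is acyclic but has an arrow, it has
  a source \<open>i\<close> with an arrow to a mutable vertex \<open>j\<close>, and exchange at \<open>i\<close> reads
  \<open>a\<^sub>i a\<^sub>i' = a\<^sub>j y + u\<close> with \<open>u\<close> a monomial in the frozen variables, that is, a unit. So no prime ideal
  contains both \<open>a\<^sub>i\<close> and \<open>a\<^sub>j\<close>. Consequently, if all mutable variables outside a prime \<open>P\<close> are
  frozen, the remaining quiver is isolated (\<open>acyclic_covered_by_isolated\<close>).

  It remains to see that every freezing of an acyclic seed is a cluster localization. This is clear for
  the lower bound, the ring generated by the cluster, the inverses of its frozen variables and the
  variables obtained by one mutation. So one proves that an acyclic cluster algebra is its own lower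
  bound (\<open>cluster_algebra_acyclic\<close>). By the relation above, the lower bound of an acyclic seed is the
  intersection of the lower bounds of its isolated freezings (\<open>lower_ring_eq_Inter_isolated\<close>). And if
  the mutable part is isolated, the lower bound consists of the elements that are Laurent polynomials
  in every cluster reached by mutating at a subset of the mutable vertices
  (\<open>laurent_at_all_vertices_imp_lower_bound\<close>), which cluster variables are by the Laurent phenomenon.

  The Laurent phenomenon is proved along the lines of Fomin and Zelevinsky, by induction on the length of
  a mutation path. Their argument needs coprime exchange polynomials. Where this may fail, a
  frozen variable \<open>y\<close> is added, and \<open>y = 1\<close> is substituted at the end. To make this
  substitution harmless, cluster variables are viewed as functions of the initial cluster on the points
  whose coordinates lie in a common positive cone, a subset of the field closed under addition,
  multiplication and inversion that does not contain zero. Exchange relations are subtraction-free, so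
  no denominator vanishes at such a point, and an algebraically independent cluster is such a point.
\<close>

section \<open>Laurent functions on positive points\<close>

definition positive_cone :: "'k::field set \<Rightarrow> bool" where
  "positive_cone C \<longleftrightarrow> 1 \<in> C \<and> 0 \<notin> C \<and>
     (\<forall>x\<in>C. \<forall>y\<in>C. x + y \<in> C \<and> x * y \<in> C) \<and> (\<forall>x\<in>C. inverse x \<in> C)"

lemma positive_coneD:
  assumes "positive_cone C"
  shows "1 \<in> C" "0 \<notin> C" "x \<in> C \<Longrightarrow> y \<in> C \<Longrightarrow> x + y \<in> C"
    "x \<in> C \<Longrightarrow> y \<in> C \<Longrightarrow> x * y \<in> C" "x \<in> C \<Longrightarrow> inverse x \<in> C" "x \<in> C \<Longrightarrow> x \<noteq> 0"
  using assms by (auto simp: positive_cone_def)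

lemma positive_cone_power: "positive_cone C \<Longrightarrow> x \<in> C \<Longrightarrow> x ^ n \<in> C"
  by (induction n) (auto intro: positive_coneD)

lemma positive_cone_prod: "positive_cone C \<Longrightarrow> (\<And>i. i \<in> I \<Longrightarrow> f i \<in> C) \<Longrightarrow> prod f I \<in> C"
  by (induction I rule: infinite_finite_induct) (auto intro: positive_coneD)

lemma positive_cone_of_nat:
  assumes "positive_cone C"
  shows "of_nat (Suc n) \<in> C"
proof (induction n)
  case 0
  show ?case using positive_coneD(1)[OF assms] by simp
next
  case (Suc n)
  show ?case
    using positive_coneD(3)[OF assms positive_coneD(1)[OF assms] Suc] unfolding of_nat_Suc[of "Suc n"] .
qed

text \<open>Since \<open>0 \<notin> C\<close>, the field has characteristic zero.\<close>

lemma infinite_positive_cone: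
  assumes "positive_cone (C :: 'k::field set)"
  shows "infinite C"
proof -
  have ne: "of_nat m \<noteq> (of_nat n :: 'k)" if mn: "m < n" for m n
  proof
    assume eq: "of_nat m = (of_nat n :: 'k)"
    obtain d where d: "n = m + Suc d"
      using less_imp_add_positive[OF mn] by (metis gr0_implies_Suc)
    have "(of_nat (Suc d) :: 'k) = 0"
      using eq unfolding d of_nat_add by simp
    then show False
      using positive_cone_of_nat[OF assms, of d] positive_coneD(2)[OF assms] by simp
  qed
  then have "inj (\<lambda>n. of_nat (Suc n) :: 'k)"
    by (intro linorder_injI) (metis Suc_less_eq)
  then have "infinite (range (\<lambda>n. of_nat (Suc n) :: 'k))"
    using finite_imageD infinite_UNIV_nat by blast
  moreover have "range (\<lambda>n. of_nat (Suc n) :: 'k) \<subseteq> C"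
    using positive_cone_of_nat[OF assms] by (intro image_subsetI)
  ultimately show ?thesis
    using finite_subset by blast
qed

text \<open>
  The points at which identities between cluster variables are tested. All coordinates are
  required to lie in one cone, so that a coordinate may be changed to any element of that cone.
\<close>

definition positive :: "(nat \<Rightarrow> 'k::field) \<Rightarrow> bool" where
  "positive a \<longleftrightarrow> (\<exists>C. positive_cone C \<and> range a \<subseteq> C)"

lemma positive_nonzero: "positive a \<Longrightarrow> a i \<noteq> 0"
  by (metis positive_coneD(2) positive_def rangeI subsetD)

text \<open>
  Laurent polynomials with integer coefficients in the variables indexed by \<open>W\<close>, as functions.
  Only the values at positive points matter (rule \<open>cong\<close>): a substitution of variables is then
  just composition of functions, and the rational function that defines a cluster variable can be
  compared with a Laurent polynomial although they differ where a denominator vanishes.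
\<close>

inductive laurent :: "nat set \<Rightarrow> ((nat \<Rightarrow> 'k::field) \<Rightarrow> 'k) \<Rightarrow> bool" for W where
  one: "laurent W (\<lambda>a. 1)"
| var: "i \<in> W \<Longrightarrow> laurent W (\<lambda>a. a i)"
| inv: "i \<in> W \<Longrightarrow> laurent W (\<lambda>a. inverse (a i))"
| neg: "laurent W f \<Longrightarrow> laurent W (\<lambda>a. - f a)"
| add: "laurent W f \<Longrightarrow> laurent W g \<Longrightarrow> laurent W (\<lambda>a. f a + g a)"
| mult: "laurent W f \<Longrightarrow> laurent W g \<Longrightarrow> laurent W (\<lambda>a. f a * g a)"
| cong: "laurent W f \<Longrightarrow> (\<And>a. positive a \<Longrightarrow> f a = g a) \<Longrightarrow> laurent W g"

lemma laurent_zero: "laurent W (\<lambda>a. 0)"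
  by (rule laurent.cong[OF laurent.add[OF laurent.one laurent.neg[OF laurent.one]]]) simp

lemma laurent_diff: "laurent W f \<Longrightarrow> laurent W g \<Longrightarrow> laurent W (\<lambda>a. f a - g a)"
  by (rule laurent.cong[OF laurent.add[OF _ laurent.neg]]) auto

lemma laurent_power: "laurent W f \<Longrightarrow> laurent W (\<lambda>a. f a ^ n)"
  by (induction n) (auto intro: laurent.one laurent.mult)

lemma laurent_sum: "(\<And>i. i \<in> I \<Longrightarrow> laurent W (f i)) \<Longrightarrow> laurent W (\<lambda>a. \<Sum>i\<in>I. f i a)"
  by (induction I rule: infinite_finite_induct) (auto intro: laurent_zero laurent.add)

lemma laurent_prod: "(\<And>i. i \<in> I \<Longrightarrow> laurent W (f i)) \<Longrightarrow> laurent W (\<lambda>a. \<Prod>i\<in>I. f i a)"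
  by (induction I rule: infinite_finite_induct) (auto intro: laurent.one laurent.mult)

lemma laurent_powi: "i \<in> W \<Longrightarrow> laurent W (\<lambda>a. a i powi e)"
  by (cases "0 \<le> e") (auto simp: power_int_def intro!: laurent_power laurent.var laurent.inv)

lemmas laurent_intros = laurent.one laurent.var laurent.inv laurent.neg laurent.add laurent.mult
  laurent_zero laurent_diff laurent_power laurent_sum laurent_prod laurent_powi

lemma laurent_mono: "laurent W f \<Longrightarrow> W \<subseteq> Y \<Longrightarrow> laurent Y f"
proof (induction rule: laurent.induct)
  case (cong f g)
  then show ?case using laurent.cong by blast
qed (auto intro: laurent_intros)

lemma laurent_agree:
  assumes "laurent W f" "positive a" "positive b" "\<And>i. i \<in> W \<Longrightarrow> a i = b i"
  shows "f a = f b"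
  using assms(1)
proof (induction rule: laurent.induct)
  case (cong f g)
  then show ?case
    using assms(2,3) by metis
qed (auto simp: assms(4))

text \<open>
  The only denominators of \<open>f (\<phi> a)\<close> are the \<open>\<phi> a i\<close> that occur inverted in \<open>f\<close>; \<open>D\<close> is a common
  multiple of them.
\<close>

lemma laurent_substitute:
  fixes \<phi> :: "(nat \<Rightarrow> 'k::field) \<Rightarrow> nat \<Rightarrow> 'k"
  assumes "laurent Y f"
    and pos: "\<And>a. positive a \<Longrightarrow> positive (\<phi> a)"
    and \<phi>: "\<And>i. i \<in> Y \<Longrightarrow> laurent W (\<lambda>a. \<phi> a i)"
    and D: "laurent W D"
    and \<phi>inv: "\<And>i. i \<in> Y \<Longrightarrow> laurent W (\<lambda>a. D a / \<phi> a i)"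
  shows "\<exists>N. laurent W (\<lambda>a. f (\<phi> a) * D a ^ N)"
  using assms(1)
proof (induction rule: laurent.induct)
  case one
  show ?case by (rule exI[of _ 0]) (simp add: laurent_intros)
next
  case (var i)
  then show ?case by (intro exI[of _ 0]) (simp add: \<phi>)
next
  case (inv i)
  then show ?case
    using \<phi>inv[of i] by (intro exI[of _ 1]) (simp add: divide_inverse mult.commute)
next
  case (neg f)
  then show ?case
    using laurent.neg by fastforce
next
  case (add f g)
  then obtain M N where *: "laurent W (\<lambda>a. f (\<phi> a) * D a ^ M)" "laurent W (\<lambda>a. g (\<phi> a) * D a ^ N)"
    by blast
  have "laurent W (\<lambda>a. (f (\<phi> a) * D a ^ M) * D a ^ N + (g (\<phi> a) * D a ^ N) * D a ^ M)"
    by (intro laurent_intros * D)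
  then show ?case
    by (intro exI[of _ "M + N"], elim laurent.cong) (simp add: algebra_simps power_add)
next
  case (mult f g)
  then obtain M N where *: "laurent W (\<lambda>a. f (\<phi> a) * D a ^ M)" "laurent W (\<lambda>a. g (\<phi> a) * D a ^ N)"
    by blast
  have "laurent W (\<lambda>a. (f (\<phi> a) * D a ^ M) * (g (\<phi> a) * D a ^ N))"
    by (intro laurent_intros * D)
  then show ?case
    by (intro exI[of _ "M + N"], elim laurent.cong) (simp add: algebra_simps power_add)
next
  case (cong f g)
  then obtain N where "laurent W (\<lambda>a. f (\<phi> a) * D a ^ N)"
    by blast
  then show ?case
    by (intro exI[of _ N], elim laurent.cong) (simp add: cong pos)
qed

lemma laurent_coeff_const: "laurent W f \<Longrightarrow> laurent W (\<lambda>a. poly.coeff [:f a:] d)"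
  by (cases d) (auto intro: laurent_zero)

text \<open>
  A Laurent polynomial is viewed as a polynomial in one of its variables over the Laurent ring in
  the other variables, after a power of the distinguished variable has been cleared.
\<close>

lemma laurent_expand:
  fixes f :: "(nat \<Rightarrow> 'k::field) \<Rightarrow> 'k"
  assumes "laurent W f"
  shows "\<exists>N D p. (\<forall>d. laurent (W - {i}) (\<lambda>a. poly.coeff (p a) d)) \<and> (\<forall>a. Polynomial.degree (p a) \<le> D)
    \<and> (\<forall>a. positive a \<longrightarrow> f a * a i ^ N = poly (p a) (a i))"
  using assms
proof (induction rule: laurent.induct)
  case one
  show ?case
    by (rule exI[of _ 0], rule exI[of _ 0], rule exI[of _ "\<lambda>a. 1"])
      (auto simp: coeff_pCons laurent_intros one_pCons split: nat.splits)
next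
  case (var j)
  show ?case
  proof (cases "j = i")
    case True
    show ?thesis
      by (rule exI[of _ 0], rule exI[of _ 1], rule exI[of _ "\<lambda>a. [:0, 1:]"])
        (auto simp: coeff_pCons laurent_intros True split: nat.splits)
  next
    case False
    with var show ?thesis
      by (intro exI[of _ 0] exI[of _ 0] exI[of _ "\<lambda>a. [:a j:]"])
        (auto intro!: laurent_coeff_const laurent_intros)
  qed
next
  case (inv j)
  show ?case
  proof (cases "j = i")
    case True
    show ?thesis
      by (rule exI[of _ 1], rule exI[of _ 0], rule exI[of _ "\<lambda>a. [:1:]"])
        (auto simp: coeff_pCons laurent_intros positive_nonzero True split: nat.splits)
  next
    case False
    with inv show ?thesis
      by (intro exI[of _ 0] exI[of _ 0] exI[of _ "\<lambda>a. [:inverse (a j):]"])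
        (auto intro!: laurent_coeff_const laurent_intros)
  qed
next
  case (neg f)
  then obtain N D p where *: "\<And>d. laurent (W - {i}) (\<lambda>a. poly.coeff (p a) d)"
    "\<And>a. Polynomial.degree (p a) \<le> D" "\<And>a. positive a \<Longrightarrow> f a * a i ^ N = poly (p a) (a i)"
    by metis
  then show ?case
    by (intro exI[of _ N] exI[of _ D] exI[of _ "\<lambda>a. - p a"]) (auto intro: laurent_intros)
next
  case (add f g)
  then obtain N D p N' D' p' where *: "\<And>d. laurent (W - {i}) (\<lambda>a. poly.coeff (p a) d)"
    "\<And>a. Polynomial.degree (p a) \<le> D" "\<And>a. positive a \<Longrightarrow> f a * a i ^ N = poly (p a) (a i)"
    "\<And>d. laurent (W - {i}) (\<lambda>a. poly.coeff (p' a) d)"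
    "\<And>a. Polynomial.degree (p' a) \<le> D'" "\<And>a. positive a \<Longrightarrow> g a * a i ^ N' = poly (p' a) (a i)"
    by metis
  let ?p = "\<lambda>a. Polynomial.monom 1 N' * p a + Polynomial.monom 1 N * p' a"
  have "laurent (W - {i}) (\<lambda>a. poly.coeff (?p a) d)" for d
    using *(1)[of "d - N'"] *(4)[of "d - N"]
    by (cases "d < N"; cases "d < N'") (auto simp: coeff_monom_mult intro: laurent_intros)
  moreover have "Polynomial.degree (?p a) \<le> max (N' + D) (N + D')" for a
    using *(2,5)[of a] degree_mult_le[of "Polynomial.monom 1 N'" "p a"]
      degree_mult_le[of "Polynomial.monom 1 N" "p' a"]
      degree_monom_le[of "1::'k" N] degree_monom_le[of "1::'k" N']
    by (intro degree_add_le) linarith+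
  moreover have "(f a + g a) * a i ^ (N + N') = poly (?p a) (a i)" if "positive a" for a
    by (simp add: poly_monom *(3,6)[OF that, symmetric] algebra_simps power_add)
  ultimately show ?case
    by (intro exI[of _ "N + N'"] exI[of _ "max (N' + D) (N + D')"] exI[of _ ?p]) blast
next
  case (mult f g)
  then obtain N D p N' D' p' where *: "\<And>d. laurent (W - {i}) (\<lambda>a. poly.coeff (p a) d)"
    "\<And>a. Polynomial.degree (p a) \<le> D" "\<And>a. positive a \<Longrightarrow> f a * a i ^ N = poly (p a) (a i)"
    "\<And>d. laurent (W - {i}) (\<lambda>a. poly.coeff (p' a) d)"
    "\<And>a. Polynomial.degree (p' a) \<le> D'" "\<And>a. positive a \<Longrightarrow> g a * a i ^ N' = poly (p' a) (a i)"
    by metis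
  have "laurent (W - {i}) (\<lambda>a. poly.coeff (p a * p' a) d)" for d
    unfolding coeff_mult by (intro laurent_intros *)
  moreover have "Polynomial.degree (p a * p' a) \<le> D + D'" for a
    using *(2,5)[of a] degree_mult_le[of "p a" "p' a"] by linarith
  moreover have "(f a * g a) * a i ^ (N + N') = poly (p a * p' a) (a i)" if "positive a" for a
    by (simp add: *(3,6)[OF that, symmetric] algebra_simps power_add)
  ultimately show ?case
    by (intro exI[of _ "N + N'"] exI[of _ "D + D'"] exI[of _ "\<lambda>a. p a * p' a"]) blast
next
  case (cong f g)
  then show ?case by metis
qed

lemma positive_update:
  assumes "positive_cone C" "range a \<subseteq> C" "y \<in> C"
  shows "positive (a(i := y))"
  unfolding positive_def using assms by (intro exI[of _ C]) auto

text \<open>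
  This is how identities at positive points become identities of coefficients: a positive cone is
  infinite, so it contains enough values for the distinguished variable.
\<close>

lemma poly_eqI_on_cone:
  fixes p q :: "'k::field poly"
  assumes C: "positive_cone C" and eq: "\<And>y. y \<in> C \<Longrightarrow> poly p y = poly q y"
  shows "p = q"
proof (rule ccontr)
  assume "p \<noteq> q"
  then have "finite {y. poly (p - q) y = 0}"
    by (intro poly_roots_finite) auto
  moreover have "C \<subseteq> {y. poly (p - q) y = 0}"
    using eq by auto
  ultimately show False
    using infinite_positive_cone[OF C] finite_subset by blast
qed

lemma laurent_synthetic_division:
  fixes p :: "(nat \<Rightarrow> 'k::field) \<Rightarrow> 'k poly"
  assumes "\<And>d. laurent W (\<lambda>a. poly.coeff (p a) d)" "\<And>a. Polynomial.degree (p a) \<le> D"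
    and r: "laurent W r"
  shows "\<exists>q s. (\<forall>d. laurent W (\<lambda>a. poly.coeff (q a) d)) \<and> (\<forall>a. Polynomial.degree (q a) \<le> D)
    \<and> laurent W s \<and> (\<forall>a. p a = [:- r a, 1:] * q a + [:s a:])"
  using assms(1,2)
proof (induction D arbitrary: p)
  case 0
  have "p a = [:poly.coeff (p a) 0:]" for a
    using 0(2)[of a] by (auto elim: degree_eq_zeroE)
  then show ?case
    using 0(1)[of 0] by (intro exI[of _ "\<lambda>a. 0"] exI[of _ "\<lambda>a. poly.coeff (p a) 0"]) (auto intro: laurent_zero)
next
  case (Suc D)
  define p' where "p' a = (THE p'. \<exists>c. p a = pCons c p')" for a
  have p': "p a = pCons (poly.coeff (p a) 0) (p' a)" for a
  proof -
    obtain c u where "p a = pCons c u" using pCons_cases by blast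
    then show ?thesis unfolding p'_def by auto
  qed
  have c: "poly.coeff (p' a) d = poly.coeff (p a) (Suc d)" for a d
    using p'[of a] by (metis coeff_pCons_Suc)
  have dp: "Polynomial.degree (p' a) \<le> D" for a
    using Suc.prems(2)[of a] p'[of a] by (metis Suc_le_mono degree_pCons_eq degree_0 le0)
  have "laurent W (\<lambda>a. poly.coeff (p' a) d)" for d
    unfolding c by (rule Suc.prems(1))
  from Suc.IH[OF this dp] obtain q s where q: "\<And>d. laurent W (\<lambda>a. poly.coeff (q a) d)"
    "\<And>a. Polynomial.degree (q a) \<le> D" "laurent W s" "\<And>a. p' a = [:- r a, 1:] * q a + [:s a:]"
    by metis
  show ?case
  proof (intro exI conjI allI)
    show "laurent W (\<lambda>a. poly.coeff (pCons (s a) (q a)) d)" for d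
      by (cases d) (auto intro: q)
    show "Polynomial.degree (pCons (s a) (q a)) \<le> Suc D" for a
      using q(2)[of a] degree_pCons_le[of "s a" "q a"] by linarith
    show "laurent W (\<lambda>a. poly.coeff (p a) 0 + r a * s a)"
      by (intro laurent_intros Suc.prems q r)
    show "p a = [:- r a, 1:] * pCons (s a) (q a) + [:poly.coeff (p a) 0 + r a * s a:]" for a
      by (subst p', subst q(4)) (simp add: algebra_simps)
  qed
qed

lemma laurent_poly:
  assumes "\<And>d. laurent W (\<lambda>a. poly.coeff (p a) d)" "\<And>a. Polynomial.degree (p a) \<le> D" "laurent W g"
  shows "laurent W (\<lambda>a. poly (p a) (g a))"
proof -
  have "poly (p a) (g a) = (\<Sum>i\<le>D. poly.coeff (p a) i * g a ^ i)" for a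
    unfolding poly_altdef using assms(2)[of a]
    by (intro sum.mono_neutral_left) (auto simp: coeff_eq_0)
  then show ?thesis
    by (simp only:) (intro laurent_intros assms)
qed

text \<open>
  The polynomial \<open>u a\<^sub>i + v\<close> in the variable \<open>a\<^sub>i\<close> is coprime to every factor \<open>n\<close> that does not
  involve \<open>a\<^sub>i\<close>. As \<open>u\<close> is a unit, \<open>f\<close> can be divided by it with a remainder that is free of
  \<open>a\<^sub>i\<close>, namely the value of \<open>f\<close> at the root \<open>r = - v / u\<close>, up to a power of \<open>r\<close>. Its product with
  \<open>n\<close> vanishes, and \<open>n\<close> does not.
\<close>

lemma laurent_cancel_linear:
  fixes f g n u v :: "(nat \<Rightarrow> 'k::field) \<Rightarrow> 'k"
  assumes i: "i \<in> W" and f: "laurent W f" and g: "laurent W g"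
    and n: "laurent (W - {i}) n" "\<And>a. positive a \<Longrightarrow> n a \<noteq> 0"
    and u: "laurent (W - {i}) u" "laurent (W - {i}) (\<lambda>a. inverse (u a))" "\<And>a. positive a \<Longrightarrow> u a \<noteq> 0"
    and v: "laurent (W - {i}) v" "\<And>a. positive a \<Longrightarrow> v a \<noteq> 0"
    and eq: "\<And>a. positive a \<Longrightarrow> f a * n a = g a * (u a * a i + v a)"
  shows "\<exists>h. laurent W h \<and> (\<forall>a. positive a \<longrightarrow> f a = h a * (u a * a i + v a))"
proof -
  let ?W = "W - {i}"
  from laurent_expand[OF f, of i] obtain N D p where
    p: "\<And>d. laurent ?W (\<lambda>a. poly.coeff (p a) d)" "\<And>a. Polynomial.degree (p a) \<le> D"
      "\<And>a. positive a \<Longrightarrow> f a * a i ^ N = poly (p a) (a i)" by metis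
  from laurent_expand[OF g, of i] obtain M E w where
    w: "\<And>d. laurent ?W (\<lambda>a. poly.coeff (w a) d)" "\<And>a. Polynomial.degree (w a) \<le> E"
      "\<And>a. positive a \<Longrightarrow> g a * a i ^ M = poly (w a) (a i)" by metis
  define r where "r a = - v a * inverse (u a)" for a
  have r: "laurent ?W r"
    unfolding r_def by (intro laurent_intros u v)
  obtain q s where q: "\<And>d. laurent ?W (\<lambda>a. poly.coeff (q a) d)" "\<And>a. Polynomial.degree (q a) \<le> D"
      "laurent ?W s" "\<And>a. p a = [:- r a, 1:] * q a + [:s a:]"
    using laurent_synthetic_division[OF p(1,2) r] by metis
  \<comment> \<open>The root \<open>r\<close> is not in the cone; the identity reaches it because it is one of polynomials.\<close>
  have s0: "s a = 0" if "positive a" for a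
  proof -
    from that obtain C where C: "positive_cone C" "range a \<subseteq> C"
      by (auto simp: positive_def)
    have "Polynomial.monom (n a) M * p a = Polynomial.monom 1 N * w a * [:v a, u a:]"
    proof (rule poly_eqI_on_cone[OF C(1)])
      fix y assume y: "y \<in> C"
      let ?b = "a(i := y)"
      have b: "positive ?b"
        by (rule positive_update[OF C y])
      have inv: "z ?b = z a" if "laurent ?W z" for z :: "(nat \<Rightarrow> 'k) \<Rightarrow> 'k"
        by (rule laurent_agree[OF that b \<open>positive a\<close>]) auto
      have pw: "p ?b = p a" "w ?b = w a"
        by (auto intro!: poly_eqI inv p w)
      have "f ?b * n a = g ?b * (u a * y + v a)"
        using eq[OF b] inv[OF n(1)] inv[OF u(1)] inv[OF v(1)] by simp
      then have "(f ?b * n a) * (y ^ N * y ^ M) = (g ?b * (u a * y + v a)) * (y ^ N * y ^ M)"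
        by simp
      then have "(f ?b * y ^ N) * n a * y ^ M = (g ?b * y ^ M) * y ^ N * (u a * y + v a)"
        by (simp only: ac_simps)
      moreover have "f ?b * y ^ N = poly (p a) y" "g ?b * y ^ M = poly (w a) y"
        using p(3)[OF b] w(3)[OF b] by (simp_all add: pw)
      ultimately have "poly (p a) y * n a * y ^ M = poly (w a) y * y ^ N * (u a * y + v a)"
        by (simp only:)
      then show "poly (Polynomial.monom (n a) M * p a) y = poly (Polynomial.monom 1 N * w a * [:v a, u a:]) y"
        by (simp add: poly_monom algebra_simps)
    qed
    then have "poly (Polynomial.monom (n a) M * p a) (r a) = poly (Polynomial.monom 1 N * w a * [:v a, u a:]) (r a)"
      by simp
    moreover have "v a + r a * u a = 0"
      unfolding r_def using u(3)[OF that] by simp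
    then have "poly [:v a, u a:] (r a) = 0"
      by simp
    ultimately have "n a * r a ^ M * poly (p a) (r a) = 0"
      by (simp only: poly_mult poly_monom mult_zero_right)
    moreover have "r a \<noteq> 0"
      unfolding r_def using u(3) v(2) that by simp
    ultimately have "poly (p a) (r a) = 0"
      using n(2)[OF that] by simp
    then show ?thesis
      by (simp add: q(4))
  qed
  have W: "laurent ?W z \<Longrightarrow> laurent W z" for z
    by (erule laurent_mono) auto
  define h where "h a = inverse (u a) * inverse (a i) ^ N * poly (q a) (a i)" for a
  have "laurent W h"
    unfolding h_def by (intro laurent_intros i W[OF u(2)] laurent_poly[OF W[OF q(1)] q(2)])
  moreover have "f a = h a * (u a * a i + v a)" if "positive a" for a
  proof -
    have "f a * a i ^ N = (a i - r a) * poly (q a) (a i)"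
      using p(3)[OF that] s0[OF that] by (simp add: q(4) algebra_simps)
    moreover have "u a * a i + v a = u a * (a i - r a)"
      unfolding r_def using u(3)[OF that] by (simp add: field_simps)
    ultimately have "h a * (u a * a i + v a) * a i ^ N = f a * a i ^ N"
      unfolding h_def using u(3)[OF that] positive_nonzero[OF that, of i]
      by (simp add: divide_simps ac_simps)
    then show ?thesis
      using positive_nonzero[OF that, of i] by simp
  qed
  ultimately show ?thesis by blast
qed

lemma laurent_cancel_linear_power:
  fixes f g n u v :: "(nat \<Rightarrow> 'k::field) \<Rightarrow> 'k"
  assumes i: "i \<in> W" and f: "laurent W f" and g: "laurent W g"
    and n: "laurent (W - {i}) n" "\<And>a. positive a \<Longrightarrow> n a \<noteq> 0"
    and u: "laurent (W - {i}) u" "laurent (W - {i}) (\<lambda>a. inverse (u a))" "\<And>a. positive a \<Longrightarrow> u a \<noteq> 0"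
    and v: "laurent (W - {i}) v" "\<And>a. positive a \<Longrightarrow> v a \<noteq> 0"
    and uv: "\<And>a. positive a \<Longrightarrow> u a * a i + v a \<noteq> 0"
    and eq: "\<And>a. positive a \<Longrightarrow> f a * n a = g a * (u a * a i + v a) ^ p"
  shows "\<exists>h. laurent W h \<and> (\<forall>a. positive a \<longrightarrow> f a = h a * (u a * a i + v a) ^ p)"
  using f eq
proof (induction p arbitrary: f)
  case 0
  then show ?case by (intro exI[of _ f]) auto
next
  case (Suc p)
  have z: "laurent W (\<lambda>a. u a * a i + v a)"
    by (intro laurent_intros i laurent_mono[OF u(1)] laurent_mono[OF v(1)]) auto
  have "laurent W (\<lambda>a. g a * (u a * a i + v a) ^ p)"
    by (intro laurent_intros z g)
  from laurent_cancel_linear[OF i Suc.prems(1) this n u v] Suc.prems(2)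
  obtain h where h: "laurent W h" "\<And>a. positive a \<Longrightarrow> f a = h a * (u a * a i + v a)"
    by (auto simp: algebra_simps)
  have "h a * n a = g a * (u a * a i + v a) ^ p" if "positive a" for a
  proof -
    have "(h a * n a) * (u a * a i + v a) = (g a * (u a * a i + v a) ^ p) * (u a * a i + v a)"
      using Suc.prems(2)[OF that] h(2)[OF that] by (simp add: ac_simps)
    then show ?thesis
      using uv[OF that] mult_right_cancel by blast
  qed
  from Suc.IH[OF h(1) this] obtain k where "laurent W k"
    "\<And>a. positive a \<Longrightarrow> h a = k a * (u a * a i + v a) ^ p" by blast
  then show ?case
    by (intro exI[of _ k]) (simp add: h(2))
qed

text \<open>
  If \<open>w\<close> is a unit modulo \<open>z\<close>, then powers of \<open>z\<close> and of \<open>w\<close> generate the unit ideal, and an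
  element with both kinds of denominators has none.
\<close>

lemma laurent_cancel_unit_mod:
  fixes x z w :: "(nat \<Rightarrow> 'k::field) \<Rightarrow> 'k"
  assumes z: "laurent W z" and w: "laurent W w"
    and comax: "laurent W w'" "laurent W t" "\<And>a. positive a \<Longrightarrow> w a * w' a = 1 + z a * t a"
    and xz: "laurent W (\<lambda>a. x a * z a ^ p)" and xw: "laurent W (\<lambda>a. x a * w a ^ q)"
  shows "laurent W x"
proof -
  have step: "laurent W y" if "laurent W (\<lambda>a. y a * z a)" "laurent W (\<lambda>a. y a * w a)" for y
  proof -
    have "laurent W (\<lambda>a. (y a * w a) * w' a - (y a * z a) * t a)"
      by (intro laurent_intros that comax)
    then show ?thesis
    proof (rule laurent.cong)
      fix a :: "nat \<Rightarrow> 'k"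
      assume "positive a"
      have "(y a * w a) * w' a - (y a * z a) * t a = y a * (w a * w' a - z a * t a)"
        by (simp add: algebra_simps)
      then show "(y a * w a) * w' a - (y a * z a) * t a = y a"
        by (simp add: comax(3)[OF \<open>positive a\<close>])
    qed
  qed
  have step2: "laurent W y" if "laurent W (\<lambda>a. y a * z a)" "laurent W (\<lambda>a. y a * w a ^ q)" for y q
    using that
  proof (induction q)
    case 0
    then show ?case by simp
  next
    case (Suc q)
    have "laurent W (\<lambda>a. (y a * w a ^ q) * z a)"
      by (rule laurent.cong[OF laurent.mult[OF Suc.prems(1) laurent_power[OF w, of q]]]) simp
    then have "laurent W (\<lambda>a. y a * w a ^ q)"
      by (rule step) (use Suc.prems(2) in \<open>simp add: algebra_simps\<close>)
    then show ?case
      using Suc by blast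
  qed
  show ?thesis
    using xz
  proof (induction p)
    case 0
    then show ?case by simp
  next
    case (Suc p)
    have "laurent W (\<lambda>a. (x a * z a ^ p) * w a ^ q)"
      by (rule laurent.cong[OF laurent.mult[OF xw laurent_power[OF z, of p]]]) simp
    then have "laurent W (\<lambda>a. x a * z a ^ p)"
      by (rule step2[rotated]) (use Suc.prems in \<open>simp add: algebra_simps\<close>)
    then show ?case
      using Suc by blast
  qed
qed

section \<open>Mutation of exchange matrices\<close>

definition exchange_matrix :: "nat set \<Rightarrow> (nat \<Rightarrow> nat \<Rightarrow> int) \<Rightarrow> bool" where
  "exchange_matrix V b \<longleftrightarrow> (\<forall>i j. b i j = - b j i) \<and> (\<forall>i j. b i j \<noteq> 0 \<longrightarrow> i \<in> V \<and> j \<in> V)"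

definition mutate_matrix :: "nat \<Rightarrow> (nat \<Rightarrow> nat \<Rightarrow> int) \<Rightarrow> nat \<Rightarrow> nat \<Rightarrow> int" where
  "mutate_matrix k b = (\<lambda>i j. if k \<in> {i, j} then - b i j
     else b i j + (\<bar>b i k\<bar> * b k j + b i k * \<bar>b k j\<bar>) div 2)"

definition exchange :: "nat set \<Rightarrow> (nat \<Rightarrow> nat \<Rightarrow> int) \<Rightarrow> nat \<Rightarrow> (nat \<Rightarrow> 'k::field) \<Rightarrow> 'k" where
  "exchange V b k a =
     ((\<Prod>j\<in>V. a j ^ nat (b k j)) + (\<Prod>j\<in>V. a j ^ nat (- b k j))) * inverse (a k)"

primrec mutate_path :: "nat set \<Rightarrow> nat list \<Rightarrow> (nat \<Rightarrow> nat \<Rightarrow> int) \<Rightarrow> (nat \<Rightarrow> 'k::field) \<Rightarrow> nat \<Rightarrow> 'k" where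
  "mutate_path V [] b a = a"
| "mutate_path V (k # ks) b a = mutate_path V ks (mutate_matrix k b) (a(k := exchange V b k a))"

text \<open>
  Vertices \<open>i\<close> and \<open>j\<close> gain arrows only from paths \<open>i \<rightarrow> k \<rightarrow> j\<close> or \<open>j \<rightarrow> k \<rightarrow> i\<close>. In this form the
  division by two is gone and the identities for mutated matrices are case distinctions on signs.
\<close>

lemma exchange_term:
  "(\<bar>x\<bar> * y + x * \<bar>y\<bar>) div 2 =
    (if 0 < x \<and> 0 < y then x * y else if x < 0 \<and> y < 0 then - (x * y) else 0)" for x y :: int
  by (cases x "0::int" rule: linorder_cases; cases y "0::int" rule: linorder_cases) auto

lemma mutate_matrix_eq:
  "mutate_matrix k b i j = (if k = i \<or> k = j then - b i j else b i j +
    (if 0 < b i k \<and> 0 < b k j then b i k * b k j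
     else if b i k < 0 \<and> b k j < 0 then - (b i k * b k j) else 0))"
  unfolding mutate_matrix_def exchange_term by auto

lemma exchange_matrixD:
  assumes "exchange_matrix V b"
  shows "b i j = - b j i" "b i i = 0" "i \<notin> V \<Longrightarrow> b i j = 0" "j \<notin> V \<Longrightarrow> b i j = 0"
proof -
  show "b i j = - b j i" using assms unfolding exchange_matrix_def by blast
  have "b i i = - b i i" using assms unfolding exchange_matrix_def by blast
  then show "b i i = 0" by simp
  have "b i j \<noteq> 0 \<longrightarrow> i \<in> V \<and> j \<in> V" using assms unfolding exchange_matrix_def by blast
  then show "i \<notin> V \<Longrightarrow> b i j = 0" "j \<notin> V \<Longrightarrow> b i j = 0" by blast+
qed

lemma exchange_matrix_mutate:
  assumes "exchange_matrix V b"
  shows "exchange_matrix V (mutate_matrix k b)"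
  unfolding exchange_matrix_def
proof (intro conjI allI impI)
  fix i j
  have "b j i = - b i j" "b j k = - b k j" "b k i = - b i k"
    by (rule exchange_matrixD(1)[OF assms])+
  then show "mutate_matrix k b i j = - mutate_matrix k b j i"
    unfolding mutate_matrix_eq by simp
next
  fix i j
  assume nz: "mutate_matrix k b i j \<noteq> 0"
  have "mutate_matrix k b i j = 0" if "i \<notin> V"
    using exchange_matrixD(3)[OF assms that] by (simp add: mutate_matrix_eq)
  with nz show "i \<in> V" by blast
  have "mutate_matrix k b i j = 0" if "j \<notin> V"
    using exchange_matrixD(4)[OF assms that] by (simp add: mutate_matrix_eq)
  with nz show "j \<in> V" by blast
qed

lemma mutate_matrix_involution:
  "mutate_matrix k (mutate_matrix k b) = b"
proof (intro ext)
  fix i j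
  show "mutate_matrix k (mutate_matrix k b) i j = b i j"
  proof (cases "k = i \<or> k = j")
    case False
    have "mutate_matrix k b i k = - b i k" "mutate_matrix k b k j = - b k j"
      by (simp_all add: mutate_matrix_eq)
    with False show ?thesis
      unfolding mutate_matrix_eq[of k "mutate_matrix k b" i j] mutate_matrix_eq[of k b i j]
      by simp
  qed (simp add: mutate_matrix_eq[of k _ i j])
qed

lemma mutate_matrix_commute:
  assumes "exchange_matrix V b" "b j k = 0"
  shows "mutate_matrix k (mutate_matrix j b) = mutate_matrix j (mutate_matrix k b)"
proof (intro ext)
  fix i l
  have b: "b k j = 0"
    using assms(2) exchange_matrixD(1)[OF assms(1), of k j] by simp
  have 1: "mutate_matrix j b i k = (if i = j \<or> j = k then - b i k else b i k)"
    "mutate_matrix j b k l = (if l = j \<or> j = k then - b k l else b k l)"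
    "mutate_matrix k b i j = (if i = k \<or> j = k then - b i j else b i j)"
    "mutate_matrix k b j l = (if l = k \<or> j = k then - b j l else b j l)"
    using assms(2) b by (auto simp: mutate_matrix_eq)
  show "mutate_matrix k (mutate_matrix j b) i l = mutate_matrix j (mutate_matrix k b) i l"
    unfolding mutate_matrix_eq[of k "mutate_matrix j b" i l] mutate_matrix_eq[of j "mutate_matrix k b" i l]
      1 mutate_matrix_eq[of k b i l] mutate_matrix_eq[of j b i l]
    using assms(2) b
    by (cases "j = k"; cases "i = j"; cases "l = j"; cases "i = k"; cases "l = k")
      (simp_all add: ac_simps cong: if_cong split del: if_split)
qed

lemma mutate_matrix_opposite:
  "mutate_matrix k (\<lambda>i j. - b i j) = (\<lambda>i j. - mutate_matrix k b i j)"
proof (intro ext)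
  fix i j
  show "mutate_matrix k (\<lambda>i j. - b i j) i j = - mutate_matrix k b i j"
    unfolding mutate_matrix_eq by simp
qed

lemma exchange_opposite: "exchange V (\<lambda>i j. - b i j) k a = exchange V b k a"
  by (simp add: exchange_def add.commute)

lemma mutate_path_opposite: "mutate_path V ks (\<lambda>i j. - b i j) a = mutate_path V ks b a"
  by (induction ks arbitrary: b a) (auto simp: mutate_matrix_opposite exchange_opposite)

lemma exchange_cong:
  assumes "\<And>l. l \<in> V \<Longrightarrow> b k l = b' k l" "a k = a' k"
    "\<And>l. l \<in> V \<Longrightarrow> b k l \<noteq> 0 \<Longrightarrow> a l = a' l"
  shows "exchange V b k a = exchange V b' k a'"
proof -
  have "a l ^ nat (b k l) = a' l ^ nat (b' k l)" "a l ^ nat (- b k l) = a' l ^ nat (- b' k l)"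
    if "l \<in> V" for l
    using assms(1,3)[OF that] by (cases "b k l = 0"; simp)+
  then show ?thesis
    unfolding exchange_def by (simp add: assms(2))
qed

lemma exchange_in_cone:
  assumes "positive_cone C" "\<And>l. l \<in> V \<Longrightarrow> a l \<in> C" "a k \<in> C"
  shows "exchange V b k a \<in> C"
  unfolding exchange_def
  by (intro positive_coneD(3,4,5)[OF assms(1)] positive_cone_prod[OF assms(1)]
      positive_cone_power[OF assms(1)] assms)

lemma positive_exchange:
  assumes "positive a"
  shows "positive (a(k := exchange V b k a))"
proof -
  from assms obtain C where C: "positive_cone C" "range a \<subseteq> C"
    by (auto simp: positive_def)
  then have "exchange V b k a \<in> C"
    by (intro exchange_in_cone) auto
  with C show ?thesis
    by (intro positive_update)
qed

lemma exchange_nonzero: "positive a \<Longrightarrow> exchange V b k a \<noteq> 0"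
  using positive_nonzero[OF positive_exchange, of a k V b k] by simp

lemma exchange_involution:
  assumes "exchange_matrix V b" "exchange V b k a \<noteq> 0"
  shows "exchange V (mutate_matrix k b) k (a(k := exchange V b k a)) = a k"
proof -
  let ?a = "a(k := exchange V b k a)"
  have p: "(\<Prod>j\<in>V. ?a j ^ nat (b k j)) = (\<Prod>j\<in>V. a j ^ nat (b k j))"
    "(\<Prod>j\<in>V. ?a j ^ nat (- b k j)) = (\<Prod>j\<in>V. a j ^ nat (- b k j))"
    by (intro prod.cong refl; simp add: exchange_matrixD(2)[OF assms(1)])+
  show ?thesis
    unfolding exchange_def[of V "mutate_matrix k b"]
    using p assms(2) by (simp add: mutate_matrix_eq exchange_def field_simps)
qed

lemma mutate_path_twice:
  assumes "exchange_matrix V b" "positive a"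
  shows "mutate_path V (k # k # ks) b a = mutate_path V ks b a"
  using exchange_involution[OF assms(1) exchange_nonzero[OF assms(2)], of k]
  by (simp add: mutate_matrix_involution)

lemma mutate_path_commute:
  assumes "exchange_matrix V b" "b j k = 0" "j \<noteq> k"
  shows "mutate_path V (j # k # ks) b a = mutate_path V (k # j # ks) b a"
proof -
  have b: "b k j = 0" using assms(2) exchange_matrixD(1)[OF assms(1), of k j] by simp
  have "exchange V (mutate_matrix j b) k (a(j := z)) = exchange V b k a" for z
    by (rule exchange_cong) (use assms b in \<open>auto simp: mutate_matrix_eq\<close>)
  moreover have "exchange V (mutate_matrix k b) j (a(k := z)) = exchange V b j a" for z
    by (rule exchange_cong) (use assms b in \<open>auto simp: mutate_matrix_eq\<close>)
  ultimately show ?thesis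
    using assms by (simp add: mutate_matrix_commute[OF assms(1,2)] fun_upd_twist)
qed

lemma mutate_path_cong:
  assumes "V \<subseteq> U" "set ks \<subseteq> U" "\<And>i. i \<in> U \<Longrightarrow> a i = a' i" "i \<in> U"
  shows "mutate_path V ks b a i = mutate_path V ks b a' i"
  using assms(2,3)
proof (induction ks arbitrary: b a a')
  case Nil
  then show ?case using assms(4) by simp
next
  case (Cons k ks)
  have "exchange V b k a = exchange V b k a'"
    by (rule exchange_cong) (use Cons.prems assms(1) in auto)
  then show ?case
    using Cons.prems by (auto intro!: Cons.IH)
qed

text \<open>
  A vertex that is never mutated and has the value one is invisible, whatever its arrows are.
\<close>

lemma mutate_path_extend:
  assumes "y \<notin> V" "y \<notin> set ks" "\<And>i l. i \<noteq> y \<Longrightarrow> l \<noteq> y \<Longrightarrow> b' i l = b i l" "a y = 1" "finite V"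
  shows "mutate_path (insert y V) ks b' a = mutate_path V ks b a"
  using assms(2-4)
proof (induction ks arbitrary: b b' a)
  case Nil
  then show ?case by simp
next
  case (Cons k ks)
  have "exchange (insert y V) b' k a = exchange V b k a"
  proof -
    have "b' k x = b k x" if "x \<in> V" for x
    proof (rule Cons.prems(2))
      show "k \<noteq> y" "x \<noteq> y" using that assms(1) Cons.prems(1) by auto
    qed
    then have "(\<Prod>x\<in>V. a x ^ nat (b' k x)) = (\<Prod>x\<in>V. a x ^ nat (b k x))"
      "(\<Prod>x\<in>V. a x ^ nat (- b' k x)) = (\<Prod>x\<in>V. a x ^ nat (- b k x))"
      by simp_all
    then show ?thesis
      unfolding exchange_def using assms(1,5) Cons.prems(3) by simp
  qed
  moreover have "mutate_path (insert y V) ks (mutate_matrix k b') (a(k := e)) =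
      mutate_path V ks (mutate_matrix k b) (a(k := e))" for e
  proof (rule Cons.IH)
    show "mutate_matrix k b' i l = mutate_matrix k b i l" if "i \<noteq> y" "l \<noteq> y" for i l
      using that Cons.prems(1) Cons.prems(2)[of i l] Cons.prems(2)[of i k] Cons.prems(2)[of k l]
      by (simp add: mutate_matrix_eq)
  qed (use Cons.prems in auto)
  ultimately show ?case by simp
qed


section \<open>The Laurent phenomenon\<close>

definition monomial :: "nat set \<Rightarrow> (nat \<Rightarrow> int) \<Rightarrow> (nat \<Rightarrow> 'k::field) \<Rightarrow> 'k" where
  "monomial V e a = (\<Prod>l\<in>V. a l powi e l)"

lemma laurent_monomial: "V \<subseteq> W \<Longrightarrow> laurent W (monomial V e)"
  unfolding monomial_def[abs_def] by (intro laurent_prod laurent_powi) auto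

lemma laurent_inverse_monomial: "V \<subseteq> W \<Longrightarrow> laurent W (\<lambda>a :: nat \<Rightarrow> 'a::field. inverse (monomial V e a))"
proof -
  have "inverse (monomial V e a) = monomial V (\<lambda>l. - e l) a" for a :: "nat \<Rightarrow> 'a"
    unfolding monomial_def power_int_minus prod_inversef[unfolded o_def] ..
  then show "V \<subseteq> W \<Longrightarrow> laurent W (\<lambda>a :: nat \<Rightarrow> 'a. inverse (monomial V e a))"
    using laurent_monomial[of V W "\<lambda>l. - e l"] by simp
qed

lemma monomial_nonzero: "positive a \<Longrightarrow> monomial V e a \<noteq> 0"
  unfolding monomial_def by (cases "finite V") (auto simp: positive_nonzero power_int_eq_0_iff)

lemma monomial_mult:
  "positive a \<Longrightarrow> monomial V e a * monomial V f a = monomial V (\<lambda>l. e l + f l) a"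
  unfolding monomial_def by (simp add: prod.distrib[symmetric] power_int_add positive_nonzero)

lemma monomial_power: "monomial V e a ^ n = monomial V (\<lambda>l. int n * e l) a"
  unfolding monomial_def prod_power_distrib power_int_power' by (simp only: mult.commute)

lemma prod_eq_monomial: "(\<Prod>l\<in>V. a l ^ nat (e l)) = monomial V (\<lambda>l. max 0 (e l)) a"
  unfolding monomial_def by (intro prod.cong refl) (auto simp: power_int_def max_def)

lemma monomial_insert:
  "finite V \<Longrightarrow> j \<in> V \<Longrightarrow> monomial V e a = a j powi e j * monomial (V - {j}) e a"
  unfolding monomial_def by (rule prod.remove)

lemma laurent_exchange:
  assumes "\<And>l. l \<in> V \<Longrightarrow> b k l \<noteq> 0 \<Longrightarrow> l \<in> W" "k \<in> W"
  shows "laurent W (exchange V b k)"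
proof -
  have "laurent W (\<lambda>a. a l ^ nat (b k l))" "laurent W (\<lambda>a. a l ^ nat (- b k l))" if "l \<in> V" for l
    using assms(1)[OF that] by (cases "b k l = 0"; auto intro!: laurent_power laurent.var laurent.one)+
  then show ?thesis
    unfolding exchange_def[abs_def]
    by (intro laurent.mult laurent.add laurent_prod laurent.inv assms(2)) blast+
qed

lemma laurent_substitute_one:
  assumes "laurent UNIV f" "laurent UNIV z" "\<And>a. positive a \<Longrightarrow> positive (a(j := z a))"
  shows "\<exists>N. laurent UNIV (\<lambda>a. f (a(j := z a)) * z a ^ N)"
proof (rule laurent_substitute[OF assms(1) assms(3) _ assms(2)])
  fix i
  show "laurent UNIV (\<lambda>a. (a(j := z a)) i)"
    using assms(2) by (cases "i = j") (auto intro: laurent_intros)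
  have "z a / z a = 1" if "positive a" for a
    using positive_nonzero[OF assms(3)[OF that], of j] by simp
  then have "laurent UNIV (\<lambda>a. z a / z a)"
    by (intro laurent.cong[OF laurent.one]) auto
  moreover have "laurent UNIV (\<lambda>a. z a * inverse (a i))"
    by (intro laurent_intros assms(2) UNIV_I)
  ultimately show "laurent UNIV (\<lambda>a. z a / (a(j := z a)) i)"
    by (cases "i = j") (simp_all add: divide_inverse)
qed

text \<open>
  The vertices \<open>j\<close> and \<open>k\<close> are not joined, so the mutations commute and the variable is Laurent in
  the clusters reached by \<open>j\<close> and by \<open>k\<close>. This bounds its denominators by powers of \<open>z\<close> and of
  \<open>w\<close>, the variables that replace \<open>a\<^sub>j\<close> and \<open>a\<^sub>k\<close>. The vertex \<open>y\<close>, joined to \<open>j\<close> by a single arrow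
  and not to \<open>k\<close>, makes \<open>z\<close> linear in \<open>a\<^sub>y\<close>, whereas \<open>w\<close> does not involve \<open>a\<^sub>y\<close>.
\<close>

lemma laurent_commuting_step:
  fixes V :: "nat set" and b :: "nat \<Rightarrow> nat \<Rightarrow> int"
  assumes V: "finite V" "exchange_matrix V b"
    and jk: "j \<noteq> k" "b j k = 0" and y: "y \<in> V" "y \<noteq> k" "b j y = 1" "b k y = 0"
    and fj: "laurent UNIV (\<lambda>a :: nat \<Rightarrow> 'k::field. mutate_path V (k # ks) (mutate_matrix j b) a i)"
    and fk: "laurent UNIV (\<lambda>a :: nat \<Rightarrow> 'k::field. mutate_path V (j # ks) (mutate_matrix k b) a i)"
  shows "laurent UNIV (\<lambda>a :: nat \<Rightarrow> 'k. mutate_path V (j # k # ks) b a i)"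
proof -
  define x :: "(nat \<Rightarrow> 'k) \<Rightarrow> 'k" where "x a = mutate_path V (j # k # ks) b a i" for a
  define z :: "(nat \<Rightarrow> 'k) \<Rightarrow> 'k" where "z a = exchange V b j a" for a
  define w :: "(nat \<Rightarrow> 'k) \<Rightarrow> 'k" where "w a = exchange V b k a" for a
  have jy: "j \<noteq> y" using y(3) exchange_matrixD(2)[OF V(2)] by auto
  have "\<exists>N. laurent UNIV (\<lambda>a. x a * z a ^ N)"
    using laurent_substitute_one[OF fj, of z j] unfolding x_def z_def
    by (simp add: laurent_exchange positive_exchange)
  then obtain p where p: "laurent UNIV (\<lambda>a. x a * z a ^ p)" ..
  have "\<exists>N. laurent UNIV (\<lambda>a. x a * w a ^ N)"
    using laurent_substitute_one[OF fk, of w k] unfolding x_def w_def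
      mutate_path_commute[OF V(2) jk(2,1)]
    by (simp add: laurent_exchange positive_exchange)
  then obtain q where q: "laurent UNIV (\<lambda>a. x a * w a ^ q)" ..
  define u where "u a = monomial (V - {y}) (\<lambda>l. max 0 (b j l)) a * inverse (a j)" for a :: "nat \<Rightarrow> 'k"
  define v where "v a = monomial (V - {y}) (\<lambda>l. max 0 (- b j l)) a * inverse (a j)" for a :: "nat \<Rightarrow> 'k"
  have z: "z a = u a * a y + v a" for a
    unfolding z_def exchange_def u_def v_def prod_eq_monomial monomial_insert[OF V(1) y(1)]
    by (simp add: y(3) algebra_simps)
  have "\<exists>h. laurent UNIV h \<and> (\<forall>a. positive a \<longrightarrow> x a * z a ^ p = h a * (u a * a y + v a) ^ p)"
  proof (rule laurent_cancel_linear_power[where n = "\<lambda>a. w a ^ q" and g = "\<lambda>a. x a * w a ^ q"])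
    show "laurent (UNIV - {y}) (\<lambda>a. w a ^ q)"
      unfolding w_def by (intro laurent_power laurent_exchange) (use y in auto)
    show "laurent (UNIV - {y}) u" "laurent (UNIV - {y}) v"
      unfolding u_def v_def by (intro laurent_intros laurent_monomial; use jy in auto)+
    have "inverse (u a) = inverse (monomial (V - {y}) (\<lambda>l. max 0 (b j l)) a) * a j" for a
      by (simp add: u_def)
    then show "laurent (UNIV - {y}) (\<lambda>a. inverse (u a))"
      by (simp only:) (intro laurent_intros laurent_inverse_monomial; use jy in auto)
    fix a :: "nat \<Rightarrow> 'k" assume a: "positive a"
    show "w a ^ q \<noteq> 0" "u a \<noteq> 0" "v a \<noteq> 0" "u a * a y + v a \<noteq> 0"
      unfolding z[symmetric] unfolding z_def w_def u_def v_def
      using exchange_nonzero[OF a] positive_nonzero[OF a] monomial_nonzero[OF a] by auto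
    show "x a * z a ^ p * w a ^ q = x a * w a ^ q * (u a * a y + v a) ^ p"
      unfolding z by simp
  qed (use p q in auto)
  then obtain h where h: "laurent UNIV h" "\<And>a. positive a \<Longrightarrow> x a * z a ^ p = h a * z a ^ p"
    unfolding z by blast
  have "h a = x a" if "positive a" for a
    using h(2)[OF that] exchange_nonzero[OF that, of V b j] by (simp add: z_def)
  then have "laurent UNIV x"
    by (rule laurent.cong[OF h(1)])
  then show ?thesis
    unfolding x_def .
qed

text \<open>
  The mutations at \<open>j\<close>, \<open>k\<close>, \<open>j\<close> replace \<open>a\<^sub>j\<close> by \<open>z\<close>, then \<open>a\<^sub>k\<close> by \<open>w\<close>, then \<open>z\<close> by \<open>v\<close>. The
  target is assumed to be Laurent in the clusters after the first and after the third of them, so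
  its denominators are powers of \<open>z\<close> as well as of \<open>v w\<close>. With \<open>c = b\<^sub>j\<^sub>k\<close> the exchange relations
  are \<open>z a\<^sub>j = a\<^sub>k\<^sup>c A + B\<close>, \<open>w a\<^sub>k = z\<^sup>c E + F\<close> and \<open>v z = w\<^sup>c G + H\<close> for monomials \<open>A, \<dots>, H\<close> in
  the other variables.

  Modulo \<open>z\<close> the variable \<open>w\<close> is the unit \<open>F / a\<^sub>k\<close>. The mutation rule gives \<open>F\<^sup>c G A = H B\<close>, from
  which \<open>v\<close> is computed: its part \<open>H a\<^sub>j / (a\<^sub>k\<^sup>c A)\<close> is a unit and the rest is divisible by
  \<open>z\<^sup>c\<^sup>-\<^sup>1\<close>. So \<open>v\<close> is a unit modulo \<open>z\<close> if \<open>c \<ge> 2\<close>, and it is linear in \<open>a\<^sub>j\<close> with unit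
  coefficients if \<open>c = 1\<close>, hence coprime to \<open>z a\<^sub>j\<close>, which does not involve \<open>a\<^sub>j\<close>.
\<close>

lemma laurent_noncommuting_step:
  fixes V :: "nat set" and b :: "nat \<Rightarrow> nat \<Rightarrow> int"
  assumes V: "finite V" "exchange_matrix V b" "j \<in> V" "k \<in> V" and pos: "0 < b j k"
    and f1: "laurent UNIV (\<lambda>a :: nat \<Rightarrow> 'k::field. mutate_path V (k # ks) (mutate_matrix j b) a i)"
    and f3: "laurent UNIV (\<lambda>a :: nat \<Rightarrow> 'k::field.
      mutate_path V (j # ks) (mutate_matrix j (mutate_matrix k (mutate_matrix j b))) a i)"
  shows "laurent UNIV (\<lambda>a :: nat \<Rightarrow> 'k. mutate_path V (j # k # ks) b a i)"
proof -
  define b1 where "b1 = mutate_matrix j b"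
  define b2 where "b2 = mutate_matrix k b1"
  have b12: "exchange_matrix V b1" "exchange_matrix V b2"
    unfolding b1_def b2_def by (intro exchange_matrix_mutate V)+
  define x :: "(nat \<Rightarrow> 'k) \<Rightarrow> 'k" where "x a = mutate_path V (j # k # ks) b a i" for a
  define z :: "(nat \<Rightarrow> 'k) \<Rightarrow> 'k" where "z a = exchange V b j a" for a
  define w :: "(nat \<Rightarrow> 'k) \<Rightarrow> 'k" where "w a = exchange V b1 k (a(j := z a))" for a
  define v :: "(nat \<Rightarrow> 'k) \<Rightarrow> 'k" where "v a = exchange V b2 j (a(j := z a, k := w a))" for a
  define m where "m = nat (b j k) - 1"
  have m: "b j k = int (Suc m)"
    using pos unfolding m_def by simp
  have jk: "j \<noteq> k" using pos exchange_matrixD(2)[OF V(2)] by auto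
  define U where "U = V - {j} - {k}"
  have split: "monomial V e a = a j powi e j * (a k powi e k * monomial U e a)"
    for e and a :: "nat \<Rightarrow> 'k"
    using monomial_insert[OF V(1,3), of e a] monomial_insert[of "V - {j}" k e a] V(1,4) jk
    unfolding U_def by simp
  have U_upd: "monomial U e (a(l := r)) = monomial U e a" if "l \<in> {j, k}"
    for e l r and a :: "nat \<Rightarrow> 'k"
    unfolding monomial_def using that by (intro prod.cong refl) (auto simp: U_def)
  let ?A = "monomial U (\<lambda>l. max 0 (b j l))"
  let ?B = "monomial U (\<lambda>l. max 0 (- b j l))"
  let ?E = "monomial U (\<lambda>l. max 0 (b1 k l))"
  let ?F = "monomial U (\<lambda>l. max 0 (- b1 k l))"
  let ?G = "monomial U (\<lambda>l. max 0 (b2 j l))"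
  let ?H = "monomial U (\<lambda>l. max 0 (- b2 j l))"
  have kj: "b k j = - int (Suc m)"
    using exchange_matrixD(1)[OF V(2), of k j] m by simp
  have b1kj: "b1 k j = int (Suc m)" "b1 j k = - int (Suc m)" "b2 j k = int (Suc m)"
    using kj m by (simp_all add: b1_def b2_def mutate_matrix_eq)
  have b2j: "b2 j l = - b j l - int (Suc m) * max 0 (- b1 k l)" if "l \<in> U" for l
    using that b1kj(2) jk unfolding U_def
    by (auto simp: b2_def[unfolded fun_eq_iff] mutate_matrix_eq b1_def algebra_simps)
  have za: "z a * a j = a k ^ Suc m * ?A a + ?B a" if "positive a" for a
    using exchange_matrixD(2)[OF V(2), of j] positive_nonzero[OF that, of j]
    unfolding z_def exchange_def prod_eq_monomial split
    by (simp add: m flip: power_int_of_nat)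
  have wa: "w a * a k = z a ^ Suc m * ?E a + ?F a" if "positive a" for a
    using exchange_matrixD(2)[OF b12(1), of k] positive_nonzero[OF that, of k] jk
    unfolding w_def exchange_def prod_eq_monomial split
    by (simp add: b1kj U_upd flip: power_int_of_nat)
  have pz: "positive (a(j := z a))" if "positive a" for a
    unfolding z_def by (rule positive_exchange[OF that])
  have pw: "positive (a(j := z a, k := w a))" if "positive a" for a
    unfolding w_def by (rule positive_exchange[OF pz[OF that]])
  have pv: "positive (a(j := v a, k := w a))" if "positive a" for a
    using positive_exchange[OF pw[OF that], of j V b2] jk unfolding v_def
    by (simp add: fun_upd_twist)
  have z0: "z a \<noteq> 0" if "positive a" for a
    using positive_nonzero[OF pz[OF that], of j] by simp
  have w0: "w a \<noteq> 0" if "positive a" for a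
    using positive_nonzero[OF pw[OF that], of k] by simp
  have v0: "v a \<noteq> 0" if "positive a" for a
    using positive_nonzero[OF pv[OF that], of j] jk by simp
  have va: "v a * z a = w a ^ Suc m * ?G a + ?H a" if "positive a" for a
    using exchange_matrixD(2)[OF b12(2), of j] z0[OF that] jk
    unfolding v_def exchange_def prod_eq_monomial split
    by (simp add: b1kj U_upd flip: power_int_of_nat)
  have FGHB: "?F a ^ Suc m * ?G a * ?A a = ?H a * ?B a" if "positive a" for a
  proof -
    have "int (Suc m) * max 0 (- b1 k l) + max 0 (b2 j l) + max 0 (b j l) =
        max 0 (- b2 j l) + max 0 (- b j l)" if "l \<in> U" for l
    proof -
      have "max 0 t - max 0 (- t) = t" for t :: int
        by (simp add: max_def)
      from this[of "b2 j l"] this[of "b j l"] b2j[OF that] show ?thesis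
        by linarith
    qed
    then show ?thesis
      unfolding monomial_power monomial_mult[OF that] unfolding monomial_def
      by (intro prod.cong) auto
  qed
  \<comment> \<open>The quotient of \<open>(z\<^sup>c E + F)\<^sup>c - F\<^sup>c\<close> by \<open>z\<^sup>c E\<close>, where \<open>c = Suc m\<close>.\<close>
  define S where "S a = (\<Sum>p<Suc m. (z a ^ Suc m * ?E a + ?F a) ^ p * ?F a ^ (m - p))" for a :: "nat \<Rightarrow> 'k"
  have Va: "v a = z a ^ m * (inverse (a k) ^ Suc m * ?E a * S a * ?G a) +
      ?H a * inverse (a k) ^ Suc m * inverse (?A a) * a j" if "positive a" for a
  proof -
    note nz = z0[OF that] positive_nonzero[OF that, of k] monomial_nonzero[OF that, of U]
    have 1: "w a ^ Suc m * a k ^ Suc m = z a ^ Suc m * ?E a * S a + ?F a ^ Suc m"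
      unfolding power_mult_distrib[symmetric] wa[OF that] S_def
      using diff_power_eq_sum[of "z a ^ Suc m * ?E a + ?F a" m "?F a"] by (simp add: algebra_simps)
    have "v a * z a * a k ^ Suc m * ?A a =
        (w a ^ Suc m * a k ^ Suc m) * ?G a * ?A a + ?H a * (a k ^ Suc m * ?A a)"
      unfolding va[OF that] by (simp only: algebra_simps)
    also have "\<dots> = z a ^ Suc m * ?E a * S a * ?G a * ?A a +
        (?F a ^ Suc m * ?G a * ?A a + ?H a * (a k ^ Suc m * ?A a))"
      unfolding 1 by (simp only: algebra_simps)
    also have "\<dots> = z a ^ Suc m * ?E a * S a * ?G a * ?A a + ?H a * (z a * a j)"
      unfolding FGHB[OF that] za[OF that] by (simp only: algebra_simps)
    also have "\<dots> = (z a ^ m * (inverse (a k) ^ Suc m * ?E a * S a * ?G a) +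
      ?H a * inverse (a k) ^ Suc m * inverse (?A a) * a j) * z a * a k ^ Suc m * ?A a"
      using nz by (simp add: field_simps)
    finally show ?thesis
      using nz by simp
  qed
  have UW: "U \<subseteq> UNIV - {j}" unfolding U_def by auto
  have lz: "laurent UNIV z"
    unfolding z_def by (rule laurent_exchange) auto
  have "laurent UNIV (\<lambda>a. (z a ^ Suc m * ?E a + ?F a) * inverse (a k))"
    by (intro laurent_intros lz laurent_monomial) auto
  then have lw: "laurent UNIV w"
  proof (rule laurent.cong)
    fix a :: "nat \<Rightarrow> 'k" assume "positive a"
    from positive_nonzero[OF this, of k] show "(z a ^ Suc m * ?E a + ?F a) * inverse (a k) = w a"
      unfolding wa[OF \<open>positive a\<close>, symmetric] by simp
  qed
  have lS: "laurent UNIV S"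
    unfolding S_def by (intro laurent_intros lz laurent_monomial) auto
  have "laurent UNIV (\<lambda>a. z a ^ m * (inverse (a k) ^ Suc m * ?E a * S a * ?G a) +
      ?H a * inverse (a k) ^ Suc m * inverse (?A a) * a j)"
    by (intro laurent_intros lz lS laurent_monomial laurent_inverse_monomial) auto
  then have lv: "laurent UNIV v"
    by (rule laurent.cong) (simp add: Va)
  have "\<exists>N. laurent UNIV (\<lambda>a. x a * z a ^ N)"
    using laurent_substitute_one[OF f1 lz pz] unfolding x_def z_def by simp
  then obtain p where p: "laurent UNIV (\<lambda>a. x a * z a ^ p)" ..
  \<comment> \<open>Going back from the third cluster to the second takes one more mutation at \<open>j\<close>.\<close>
  have x3: "mutate_path V (j # ks) (mutate_matrix j b2) (a(j := v a, k := w a)) i = x a"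
    if "positive a" for a
  proof -
    have "x a = mutate_path V ks b2 (a(j := z a, k := w a)) i"
      unfolding x_def by (simp add: b1_def b2_def z_def w_def)
    also have "\<dots> = mutate_path V (j # j # ks) b2 (a(j := z a, k := w a)) i"
      by (simp only: mutate_path_twice[OF b12(2) pw[OF that]])
    also have "\<dots> = mutate_path V (j # ks) (mutate_matrix j b2) (a(j := v a, k := w a)) i"
      unfolding mutate_path.simps(2)[of V j "j # ks"]
      using jk by (simp add: v_def[symmetric] fun_upd_twist)
    finally show ?thesis ..
  qed
  have "\<exists>N. laurent UNIV (\<lambda>a. mutate_path V (j # ks) (mutate_matrix j b2) (a(j := v a, k := w a)) i
      * (v a * w a) ^ N)"
  proof (rule laurent_substitute[OF _ pv])
    show "laurent UNIV (\<lambda>a :: nat \<Rightarrow> 'k. mutate_path V (j # ks) (mutate_matrix j b2) a i)"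
      using f3 unfolding b2_def b1_def .
    show "laurent UNIV (\<lambda>a. v a * w a)"
      by (intro laurent_intros lv lw)
    fix l
    show "laurent UNIV (\<lambda>a. (a(j := v a, k := w a)) l)"
      using lv lw by (cases "l = k"; cases "l = j") (auto intro: laurent_intros)
    show "laurent UNIV (\<lambda>a. v a * w a / (a(j := v a, k := w a)) l)"
    proof -
      consider "l = k" | "l = j" "l \<noteq> k" | "l \<noteq> j" "l \<noteq> k" by blast
      then show ?thesis
      proof cases
        case 1
        show ?thesis
          by (rule laurent.cong[OF lv]) (simp add: 1 w0)
      next
        case 2
        show ?thesis
          by (rule laurent.cong[OF lw]) (use 2 v0 in simp)
      next
        case 3
        then show ?thesis
          by (simp add: divide_inverse) (intro laurent_intros lv lw UNIV_I)
      qed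
    qed
  qed
  then obtain q where "laurent UNIV (\<lambda>a. mutate_path V (j # ks) (mutate_matrix j b2) (a(j := v a, k := w a)) i
      * (v a * w a) ^ q)" ..
  then have q: "laurent UNIV (\<lambda>a. x a * (v a * w a) ^ q)"
    by (rule laurent.cong) (simp only: x3)
  have xv: "laurent UNIV (\<lambda>a. x a * v a ^ q)"
  proof (rule laurent_cancel_unit_mod[OF lz lw])
    show "laurent UNIV (\<lambda>a. a k * inverse (?F a))"
      "laurent UNIV (\<lambda>a. z a ^ m * ?E a * inverse (?F a))"
      by (intro laurent_intros lz laurent_monomial laurent_inverse_monomial; simp)+
    show "w a * (a k * inverse (?F a)) = 1 + z a * (z a ^ m * ?E a * inverse (?F a))"
      if "positive a" for a
      unfolding mult.assoc[symmetric] wa[OF that] using monomial_nonzero[OF that, of U]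
      by (simp add: field_simps)
    show "laurent UNIV (\<lambda>a. x a * v a ^ q * z a ^ p)"
      by (rule laurent.cong[OF laurent.mult[OF p laurent_power[OF lv, of q]]]) simp
    show "laurent UNIV (\<lambda>a. x a * v a ^ q * w a ^ q)"
      using q by (simp add: power_mult_distrib mult.assoc)
  qed
  have "laurent UNIV x"
  proof (cases m)
    case (Suc m')
    show ?thesis
    proof (rule laurent_cancel_unit_mod[OF lz lv _ _ _ p xv])
      show "laurent UNIV (\<lambda>a. inverse (?H a) * a k ^ Suc m * ?A a * inverse (a j))"
        "laurent UNIV (\<lambda>a. z a ^ m' * ?E a * S a * ?G a * inverse (?H a) * ?A a * inverse (a j))"
        by (intro laurent_intros lz lS laurent_monomial laurent_inverse_monomial; simp)+
      show "v a * (inverse (?H a) * a k ^ Suc m * ?A a * inverse (a j)) =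
        1 + z a * (z a ^ m' * ?E a * S a * ?G a * inverse (?H a) * ?A a * inverse (a j))"
        if "positive a" for a
      proof -
        have nz: "a k ^ Suc m \<noteq> 0" "a j \<noteq> 0" "?H a \<noteq> 0" "?A a \<noteq> 0" "z a ^ m = z a * z a ^ m'"
          using positive_nonzero[OF that] monomial_nonzero[OF that, of U] Suc by auto
        show ?thesis
          unfolding Va[OF that] power_inverse nz(5)
          using nz(1-4) by (simp add: field_simps del: power_Suc)
      qed
    qed
  next
    case 0
    define \<alpha> where "\<alpha> a = ?H a * inverse (a k) * inverse (?A a)" for a :: "nat \<Rightarrow> 'k"
    define \<beta> where "\<beta> a = inverse (a k) * ?E a * ?G a" for a :: "nat \<Rightarrow> 'k"
    have v: "v a = \<alpha> a * a j + \<beta> a" if "positive a" for a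
      using Va[OF that] by (simp add: 0 \<alpha>_def \<beta>_def S_def)
    have "\<exists>h. laurent UNIV h \<and> (\<forall>a. positive a \<longrightarrow> x a * v a ^ q = h a * (\<alpha> a * a j + \<beta> a) ^ q)"
    proof (rule laurent_cancel_linear_power[where n = "\<lambda>a. (a k * ?A a + ?B a) ^ p"
          and g = "\<lambda>a. x a * z a ^ p * a j ^ p"])
      show "laurent UNIV (\<lambda>a. x a * z a ^ p * a j ^ p)"
        by (intro laurent.mult p laurent_intros UNIV_I)
      show "laurent (UNIV - {j}) (\<lambda>a. (a k * ?A a + ?B a) ^ p)"
        using jk by (intro laurent_intros laurent_monomial UW) auto
      show "laurent (UNIV - {j}) \<alpha>" "laurent (UNIV - {j}) \<beta>"
        unfolding \<alpha>_def \<beta>_def using jk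
        by (intro laurent_intros laurent_monomial laurent_inverse_monomial UW; auto)+
      have "inverse (\<alpha> a) = inverse (?H a) * a k * ?A a" for a
        by (simp add: \<alpha>_def)
      then show "laurent (UNIV - {j}) (\<lambda>a. inverse (\<alpha> a))"
        using jk by (simp only:) (intro laurent_intros laurent_monomial laurent_inverse_monomial UW; auto)
      fix a :: "nat \<Rightarrow> 'k" assume a: "positive a"
      note za' = za[OF a, unfolded 0, simplified]
      show "(a k * ?A a + ?B a) ^ p \<noteq> 0"
        using z0[OF a] positive_nonzero[OF a, of j] by (simp flip: za')
      show "\<alpha> a \<noteq> 0" "\<beta> a \<noteq> 0"
        unfolding \<alpha>_def \<beta>_def using positive_nonzero[OF a] monomial_nonzero[OF a, of U] by auto
      show "\<alpha> a * a j + \<beta> a \<noteq> 0"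
        using v0[OF a] v[OF a] by simp
      show "x a * v a ^ q * (a k * ?A a + ?B a) ^ p = x a * z a ^ p * a j ^ p * (\<alpha> a * a j + \<beta> a) ^ q"
        by (simp add: v[OF a, symmetric] za'[symmetric] power_mult_distrib)
    qed (use xv in auto)
    then obtain h where h: "laurent UNIV h"
      "\<And>a. positive a \<Longrightarrow> x a * v a ^ q = h a * (\<alpha> a * a j + \<beta> a) ^ q" by blast
    have "h a = x a" if "positive a" for a
      using h(2)[OF that] v0[OF that] unfolding v[OF that, symmetric] by simp
    then show ?thesis
      by (rule laurent.cong[OF h(1)])
  qed
  then show ?thesis unfolding x_def .
qed

text \<open>
  The matrix is arbitrary in the induction on the length of the path, so the hypothesis applies to
  the matrix with the additional vertex \<open>y\<close> and to paths that start at other seeds. If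
  \<open>b\<^sub>j\<^sub>k < 0\<close>, the opposite matrix, which has the same cluster variables, reduces to \<open>b\<^sub>j\<^sub>k > 0\<close>.
\<close>

theorem laurent_phenomenon:
  assumes "finite V" "exchange_matrix V b" "set ks \<subseteq> V"
  shows "laurent UNIV (\<lambda>a :: nat \<Rightarrow> 'k::field. mutate_path V ks b a i)"
  using assms
proof (induction "length ks" arbitrary: ks V b i rule: less_induct)
  case less
  consider "ks = []" | k where "ks = [k]" | j k ls where "ks = j # k # ls"
    by (cases ks; cases "tl ks") auto
  then show ?case
  proof cases
    case 1
    then show ?thesis by (simp add: laurent_intros)
  next
    case (2 k)
    have "laurent UNIV (exchange V b k)"
      by (rule laurent_exchange) auto
    with 2 show ?thesis
      by (cases "i = k") (auto intro: laurent_intros)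
  next
    case (3 j k ls)
    note V = less.prems(1,2)
    have jkl: "j \<in> V" "k \<in> V" "set ls \<subseteq> V"
      using less.prems(3) 3 by auto
    have IH: "laurent UNIV (\<lambda>a :: nat \<Rightarrow> 'k. mutate_path V' (l # ls) b' a i)"
      if "finite V'" "exchange_matrix V' b'" "l \<in> V'" "V \<subseteq> V'" for l V' b'
      using that jkl 3 by (intro less.hyps) auto
    consider "j = k" | "j \<noteq> k" "b j k = 0" | "b j k > 0" | "b j k < 0"
      by linarith
    then show ?thesis
    proof cases
      case 1
      have "laurent UNIV (\<lambda>a :: nat \<Rightarrow> 'k. mutate_path V ls b a i)"
        using V jkl 3 by (intro less.hyps) auto
      then show ?thesis
        unfolding 3 1 by (rule laurent.cong) (simp only: mutate_path_twice[OF V(2)])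
    next
      case 2
      have "\<exists>y. y \<notin> insert i V"
        using ex_new_if_finite[OF infinite_UNIV_nat] V(1) by blast
      then obtain y where y: "y \<notin> V" "y \<noteq> i" by blast
      then have yjk: "y \<noteq> j" "y \<noteq> k" "y \<notin> set ks" using jkl 3 by auto
      let ?V = "insert y V"
      define b' where "b' = (\<lambda>i l. if i = j \<and> l = y then 1 else if i = y \<and> l = j then - 1 else b i l)"
      have skew: "b' i l = - b' l i" for i l
        using yjk(1) exchange_matrixD(1)[OF V(2), of i l] unfolding b'_def by auto
      moreover have "i \<in> ?V \<and> l \<in> ?V" if "b' i l \<noteq> 0" for i l
        using that jkl(1) exchange_matrixD(3,4)[OF V(2), of i l] exchange_matrixD(4)[OF V(2), of l i]
        unfolding b'_def by (auto split: if_splits)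
      ultimately have V': "finite ?V" "exchange_matrix ?V b'"
        using V(1) unfolding exchange_matrix_def by blast+
      have "laurent UNIV (\<lambda>a :: nat \<Rightarrow> 'k. mutate_path ?V (j # k # ls) b' a i)"
      proof (rule laurent_commuting_step[OF V' 2(1), of y])
        show "b' k y = 0"
          using y(1) 2 yjk exchange_matrixD(4)[OF V(2)] by (simp add: b'_def)
        show "laurent UNIV (\<lambda>a :: nat \<Rightarrow> 'k. mutate_path ?V (k # ls) (mutate_matrix j b') a i)"
          "laurent UNIV (\<lambda>a :: nat \<Rightarrow> 'k. mutate_path ?V (j # ls) (mutate_matrix k b') a i)"
          using jkl by (intro IH V' exchange_matrix_mutate; blast)+
      qed (use yjk 2 in \<open>auto simp: b'_def\<close>)
      then have L: "laurent UNIV (\<lambda>a :: nat \<Rightarrow> 'k. mutate_path ?V ks b' a i)"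
        unfolding 3 .
      have "\<exists>N. laurent UNIV (\<lambda>a :: nat \<Rightarrow> 'k. mutate_path ?V ks b' (a(y := 1)) i * 1 ^ N)"
      proof (rule laurent_substitute_one[OF L])
        fix a :: "nat \<Rightarrow> 'k" assume "positive a"
        then show "positive (a(y := 1))"
          by (metis positive_def positive_update positive_coneD(1))
      qed (rule laurent_intros)
      then have "laurent UNIV (\<lambda>a :: nat \<Rightarrow> 'k. mutate_path ?V ks b' (a(y := 1)) i)"
        by simp
      moreover have "mutate_path ?V ks b' (a(y := 1)) i = mutate_path V ks b a i" for a :: "nat \<Rightarrow> 'k"
      proof -
        have "mutate_path ?V ks b' (a(y := 1)) = mutate_path V ks b (a(y := 1))"
          using y yjk V by (intro mutate_path_extend) (auto simp: b'_def)
        moreover have "mutate_path V ks b (a(y := 1)) i = mutate_path V ks b a i"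
          using y yjk less.prems(3) by (intro mutate_path_cong[of _ "- {y}"]) auto
        ultimately show ?thesis by simp
      qed
      ultimately show ?thesis by simp
    next
      case 3
      show ?thesis
        unfolding \<open>ks = _\<close>
        by (rule laurent_noncommuting_step[OF V jkl(1,2) 3])
          (intro IH V jkl exchange_matrix_mutate order_refl)+
    next
      case 4
      let ?b = "\<lambda>i l. - b i l"
      have V': "exchange_matrix V ?b"
        using V(2) unfolding exchange_matrix_def neg_equal_iff_equal neg_equal_0_iff_equal .
      have "laurent UNIV (\<lambda>a :: nat \<Rightarrow> 'k. mutate_path V ks ?b a i)"
        unfolding \<open>ks = _\<close>
        by (rule laurent_noncommuting_step[OF V(1) V' jkl(1,2)])
          (use 4 in simp, (intro IH V V' jkl exchange_matrix_mutate order_refl)+)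
      then show ?thesis
        unfolding mutate_path_opposite .
    qed
  qed
qed

section \<open>Lower bounds at seeds with isolated mutable part\<close>

definition exchange_binomial :: "nat set \<Rightarrow> (nat \<Rightarrow> nat \<Rightarrow> int) \<Rightarrow> nat \<Rightarrow> (nat \<Rightarrow> 'k::field) \<Rightarrow> 'k" where
  "exchange_binomial V b k a = (\<Prod>j\<in>V. a j ^ nat (b k j)) + (\<Prod>j\<in>V. a j ^ nat (- b k j))"

lemma exchange_eq_binomial: "exchange V b k a = exchange_binomial V b k a * inverse (a k)"
  by (simp add: exchange_def exchange_binomial_def)

text \<open>
  With \<open>M\<close> the set of mutable vertices and \<open>P k\<close> the right-hand side of the exchange relation at
  \<open>k\<close>, these are the polynomials with integer coefficients in the variables, the inverses of the
  frozen ones and the adjacent variables \<open>P k / a\<^sub>k\<close>.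
\<close>

inductive lower_bound :: "(nat \<Rightarrow> (nat \<Rightarrow> 'k::field) \<Rightarrow> 'k) \<Rightarrow> nat set \<Rightarrow> ((nat \<Rightarrow> 'k) \<Rightarrow> 'k) \<Rightarrow> bool"
  for P M where
  one: "lower_bound P M (\<lambda>a. 1)"
| var: "lower_bound P M (\<lambda>a. a i)"
| inv: "i \<notin> M \<Longrightarrow> lower_bound P M (\<lambda>a. inverse (a i))"
| adjacent: "k \<in> M \<Longrightarrow> lower_bound P M (\<lambda>a. P k a * inverse (a k))"
| neg: "lower_bound P M f \<Longrightarrow> lower_bound P M (\<lambda>a. - f a)"
| add: "lower_bound P M f \<Longrightarrow> lower_bound P M g \<Longrightarrow> lower_bound P M (\<lambda>a. f a + g a)"
| mult: "lower_bound P M f \<Longrightarrow> lower_bound P M g \<Longrightarrow> lower_bound P M (\<lambda>a. f a * g a)"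
| cong: "lower_bound P M f \<Longrightarrow> (\<And>a. positive a \<Longrightarrow> f a = g a) \<Longrightarrow> lower_bound P M g"

lemma lower_bound_zero: "lower_bound P M (\<lambda>a. 0)"
  by (rule lower_bound.cong[OF lower_bound.add[OF lower_bound.one lower_bound.neg[OF lower_bound.one]]]) simp

lemma lower_bound_power: "lower_bound P M f \<Longrightarrow> lower_bound P M (\<lambda>a. f a ^ n)"
  by (induction n) (auto intro: lower_bound.one lower_bound.mult)

lemma lower_bound_sum:
  "(\<And>i. i \<in> I \<Longrightarrow> lower_bound P M (f i)) \<Longrightarrow> lower_bound P M (\<lambda>a. \<Sum>i\<in>I. f i a)"
  by (induction I rule: infinite_finite_induct) (auto intro: lower_bound_zero lower_bound.add)

lemma laurent_imp_lower_bound: "laurent W f \<Longrightarrow> lower_bound P {} f"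
proof (induction rule: laurent.induct)
  case (cong f g)
  then show ?case using lower_bound.cong by blast
qed (auto intro: lower_bound.one lower_bound.var lower_bound.inv lower_bound.neg
    lower_bound.add lower_bound.mult)

lemma positive_update_one: "positive a \<Longrightarrow> positive (a(m := 1))"
  by (metis positive_def positive_update positive_coneD(1))

text \<open>
  A function that does not involve \<open>a\<^sub>m\<close> can be written without \<open>1 / a\<^sub>m\<close>: put \<open>a\<^sub>m = 1\<close> in any
  expression for it.
\<close>

lemma lower_bound_specialise:
  assumes "lower_bound P M f" "m \<notin> M" "\<And>k. k \<in> M \<Longrightarrow> laurent (- {m}) (P k)"
  shows "lower_bound P (insert m M) (\<lambda>a. f (a(m := 1)))"
  using assms(1)
proof (induction rule: lower_bound.induct)
  case (var i)
  then show ?case by (cases "i = m") (auto intro: lower_bound.one lower_bound.var)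
next
  case (inv i)
  then show ?case by (cases "i = m") (auto intro: lower_bound.one lower_bound.inv)
next
  case (adjacent k)
  have "P k a * inverse (a k) = P k (a(m := 1)) * inverse ((a(m := 1)) k)" if "positive a" for a
    using laurent_agree[OF assms(3)[OF adjacent] that positive_update_one[OF that]] adjacent assms(2)
    by auto
  then show ?case
    by (rule lower_bound.cong[OF lower_bound.adjacent, rotated]) (use adjacent in auto)
next
  case (cong f g)
  show ?case
    by (rule lower_bound.cong[OF cong.IH]) (rule cong.hyps(2)[OF positive_update_one])
qed (auto intro: lower_bound.one lower_bound.neg lower_bound.add lower_bound.mult)

lemma laurent_expand_int:
  fixes f :: "(nat \<Rightarrow> 'k::field) \<Rightarrow> 'k"
  assumes "laurent W f"
  shows "\<exists>(N :: int) c. (\<forall>d. laurent (W - {i}) (c d)) \<and> (\<forall>d a. N < \<bar>d\<bar> \<longrightarrow> c d a = 0)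
    \<and> (\<forall>a. positive a \<longrightarrow> f a = (\<Sum>d = - N..N. c d a * a i powi d))"
proof -
  from laurent_expand[OF assms, of i] obtain N D p where
    p: "\<And>d. laurent (W - {i}) (\<lambda>a. poly.coeff (p a) d)" "\<And>a. Polynomial.degree (p a) \<le> D"
      "\<And>a. positive a \<Longrightarrow> f a * a i ^ N = poly (p a) (a i)" by metis
  define c where "c d a = (if - int N \<le> d then poly.coeff (p a) (nat (d + int N)) else 0)" for d a
  define L where "L = int (N + D)"
  have c0: "c d a = 0" if "L < \<bar>d\<bar>" for d a
  proof (cases "- int N \<le> d")
    case True
    with that have "D < nat (d + int N)" unfolding L_def by linarith
    then have "Polynomial.degree (p a) < nat (d + int N)" using p(2)[of a] by linarith
    then show ?thesis by (simp add: c_def coeff_eq_0)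
  qed (simp add: c_def)
  have "laurent (W - {i}) (c d)" for d
    unfolding c_def using p(1) by (cases "- int N \<le> d") (auto intro: laurent_zero)
  moreover have "f a = (\<Sum>d = - L..L. c d a * a i powi d)" if "positive a" for a
  proof -
    have nz: "a i \<noteq> 0" by (rule positive_nonzero[OF that])
    have "f a * a i ^ N = (\<Sum>k\<le>Polynomial.degree (p a). poly.coeff (p a) k * a i ^ k)"
      by (simp add: p(3)[OF that] poly_altdef)
    also have "\<dots> = (\<Sum>k\<le>N + (N + D). poly.coeff (p a) k * a i ^ k)"
      using p(2)[of a] by (intro sum.mono_neutral_left) (auto simp: coeff_eq_0)
    also have "\<dots> = (\<Sum>d = - int N..L. c d a * a i ^ nat (d + int N))"
      by (rule sum.reindex_bij_witness[of _ "\<lambda>d. nat (d + int N)" "\<lambda>k. int k - int N"])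
        (auto simp: c_def L_def)
    also have "\<dots> = (\<Sum>d = - int N..L. c d a * a i powi d * a i ^ N)"
    proof (intro sum.cong refl)
      fix d assume "d \<in> {- int N..L}"
      then have "a i ^ nat (d + int N) = a i powi (d + int N)" by (simp add: power_int_def)
      then show "c d a * a i ^ nat (d + int N) = c d a * a i powi d * a i ^ N"
        using nz by (simp add: power_int_add)
    qed
    also have "\<dots> = (\<Sum>d = - int N..L. c d a * a i powi d) * a i ^ N"
      by (simp add: sum_distrib_right)
    also have "(\<Sum>d = - int N..L. c d a * a i powi d) = (\<Sum>d = - L..L. c d a * a i powi d)"
      by (intro sum.mono_neutral_left) (auto simp: L_def c_def)
    finally show ?thesis using nz by simp
  qed
  ultimately show ?thesis using c0 by blast
qed

lemma laurent_coefficients_unique: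
  fixes u v :: "int \<Rightarrow> 'k::field"
  assumes C: "positive_cone C"
    and 0: "\<And>d. N < \<bar>d\<bar> \<Longrightarrow> u d = 0" "\<And>d. M < \<bar>d\<bar> \<Longrightarrow> v d = 0"
    and eq: "\<And>y. y \<in> C \<Longrightarrow> (\<Sum>d = - N..N. u d * y powi d) = (\<Sum>d = - M..M. v d * y powi d)"
  shows "u d = v d"
proof -
  define L where "L = max \<bar>N\<bar> (max \<bar>M\<bar> \<bar>d\<bar>)"
  define p where "p w = (\<Sum>d = - L..L. Polynomial.monom (w d) (nat (d + L)))" for w :: "int \<Rightarrow> 'k"
  have p: "poly (p w) y = (\<Sum>d = - K..K. w d * y powi d) * y powi L"
    if "y \<in> C" "\<And>d. K < \<bar>d\<bar> \<Longrightarrow> w d = 0" "K \<le> L" for w y K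
  proof -
    have "y \<noteq> 0" using positive_coneD(6)[OF C that(1)] .
    have "poly (p w) y = (\<Sum>d = - L..L. w d * y powi d * y powi L)"
      unfolding p_def poly_sum
    proof (intro sum.cong refl)
      fix d assume "d \<in> {- L..L}"
      then have "y ^ nat (d + L) = y powi (d + L)" by (simp add: power_int_def)
      then show "poly (Polynomial.monom (w d) (nat (d + L))) y = w d * y powi d * y powi L"
        using \<open>y \<noteq> 0\<close> by (simp add: poly_monom power_int_add)
    qed
    also have "\<dots> = (\<Sum>d = - L..L. w d * y powi d) * y powi L"
      by (simp add: sum_distrib_right)
    also have "(\<Sum>d = - L..L. w d * y powi d) = (\<Sum>d = - K..K. w d * y powi d)"
      using that by (intro sum.mono_neutral_right) auto
    finally show ?thesis .
  qed
  have "p u = p v"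
    by (rule poly_eqI_on_cone[OF C])
      (subst p[where K = N], use 0 eq in \<open>auto simp: L_def p[where K = M]\<close>)
  moreover have "poly.coeff (p w) (nat (d + L)) = w d" for w
  proof -
    have d: "- L \<le> d" "d \<le> L" unfolding L_def by linarith+
    have "poly.coeff (p w) (nat (d + L)) = (\<Sum>e = - L..L. if e = d then w e else 0)"
      unfolding p_def coeff_sum using d by (intro sum.cong refl) auto
    also have "\<dots> = w d"
      using d by simp
    finally show ?thesis .
  qed
  ultimately show ?thesis by metis
qed

text \<open>
  Here every \<open>P k\<close> involves frozen variables only, and the cluster reached by mutating at \<open>K\<close> has
  \<open>P k / a\<^sub>k\<close> in place of \<open>a\<^sub>k\<close> for \<open>k \<in> K\<close>. It is not enough to consider sets \<open>K\<close> with one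
  element: if two of the \<open>P k\<close> coincide, \<open>P\<^sub>1 / (a\<^sub>1 a\<^sub>2)\<close> passes that test but does not lie in
  the lower bound. In the induction step, the coefficients of the expansion in \<open>a\<^sub>m\<close> satisfy the
  hypothesis for the remaining vertices by uniqueness of expansions; mutation at \<open>m\<close> turns
  \<open>a\<^sub>m\<^sup>-\<^sup>d\<close> into \<open>P m\<^sup>-\<^sup>d\<close> times a power of the new variable, so the coefficient of \<open>a\<^sub>m\<^sup>-\<^sup>d\<close> is
  divisible by \<open>P m\<^sup>d\<close>.
\<close>

lemma laurent_at_all_vertices_imp_lower_bound:
  fixes P :: "nat \<Rightarrow> (nat \<Rightarrow> 'k::field) \<Rightarrow> 'k"
  assumes "finite M"
    and "\<And>k. k \<in> M \<Longrightarrow> laurent (- M) (P k)"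
    and cone: "\<And>k a C. k \<in> M \<Longrightarrow> positive_cone C \<Longrightarrow> range a \<subseteq> C \<Longrightarrow> P k a \<in> C"
    and "\<And>K. K \<subseteq> M \<Longrightarrow> \<exists>g. laurent UNIV g \<and> (\<forall>a. positive a \<longrightarrow>
      x a = g (\<lambda>i. if i \<in> K then P i a * inverse (a i) else a i))"
  shows "lower_bound P M x"
  using assms
proof (induction M arbitrary: x)
  case empty
  from empty.prems(3)[of "{}"] obtain g where g: "laurent UNIV g" "\<And>a. positive a \<Longrightarrow> x a = g a"
    by auto
  show ?case
    by (rule lower_bound.cong[OF laurent_imp_lower_bound[OF g(1)]]) (simp add: g(2))
next
  case (insert m M)
  note P = insert.prems(1) and P_cone = insert.prems(2) and x = insert.prems(3)
  define \<phi> where "\<phi> K a = (\<lambda>i. if i \<in> K then P i a * inverse (a i) else a i)" for K a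
  have \<phi>_pos: "positive (\<phi> K a)" if "K \<subseteq> insert m M" "positive a" for K a
  proof -
    from that(2) obtain C where C: "positive_cone C" "range a \<subseteq> C"
      by (auto simp: positive_def)
    have "\<phi> K a i \<in> C" for i
    proof (cases "i \<in> K")
      case True
      have "P i a \<in> C" by (rule P_cone[OF _ C]) (use True that(1) in auto)
      moreover have "a i \<in> C" using C(2) by auto
      ultimately show ?thesis
        using True positive_coneD(4,5)[OF C(1)] by (simp add: \<phi>_def)
    qed (use C(2) in \<open>auto simp: \<phi>_def\<close>)
    with C(1) show ?thesis by (auto simp: positive_def)
  qed
  have P_agree: "P k a = P k b" if "k \<in> insert m M" "positive a" "positive b" "\<And>i. i \<noteq> m \<Longrightarrow> a i = b i" for k a b
    by (rule laurent_agree[OF P[OF that(1)] that(2,3)]) (use that(4) in auto)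
  have \<phi>_agree: "g (\<phi> K a) = g (\<phi> K' b)"
    if "laurent (UNIV - {m}) g" "K \<subseteq> insert m M" "K' \<subseteq> insert m M" "K - {m} = K' - {m}"
      "positive a" "positive b" "\<And>i. i \<noteq> m \<Longrightarrow> a i = b i" for g K K' a b
  proof (rule laurent_agree[OF that(1) \<phi>_pos[OF that(2,5)] \<phi>_pos[OF that(3,6)]])
    fix i assume "i \<in> UNIV - {m}"
    then have "i \<noteq> m" "i \<in> K \<longleftrightarrow> i \<in> K'" using that(4) by auto
    then show "\<phi> K a i = \<phi> K' b i"
      using P_agree[of i a b] that by (auto simp: \<phi>_def)
  qed
  have x\<phi>: "\<exists>g. laurent UNIV g \<and> (\<forall>a. positive a \<longrightarrow> x a = g (\<phi> K a))" if "K \<subseteq> insert m M" for K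
    using x[OF that] unfolding \<phi>_def .
  have expansion: "\<exists>(N :: int) c. (\<forall>d. laurent (UNIV - {m}) (c d)) \<and> (\<forall>d a. N < \<bar>d\<bar> \<longrightarrow> c d a = 0)
      \<and> (\<forall>a. positive a \<longrightarrow> x a = (\<Sum>d = - N..N. c d (\<phi> K a) * \<phi> K a m powi d))"
    if K: "K \<subseteq> insert m M" for K
  proof -
    from x\<phi>[OF K] obtain g where g: "laurent UNIV g" "\<And>a. positive a \<Longrightarrow> x a = g (\<phi> K a)" by blast
    from laurent_expand_int[OF g(1), of m] obtain N c where "\<And>d. laurent (UNIV - {m}) (c d)"
      "\<And>d a. N < \<bar>d\<bar> \<Longrightarrow> c d a = 0" "\<And>a. positive a \<Longrightarrow> g a = (\<Sum>d = - N..N. c d a * a m powi d)"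
      by metis
    then show ?thesis
      using g(2) \<phi>_pos[OF K] by (intro exI[of _ N] exI[of _ c]) simp
  qed
  have unique: "u d a = v d a"
    if bound: "\<And>d a. N < \<bar>d\<bar> \<Longrightarrow> u d a = 0" "\<And>d a. L < \<bar>d\<bar> \<Longrightarrow> v d a = 0"
      and indep: "\<And>d a b. positive a \<Longrightarrow> positive b \<Longrightarrow> (\<And>i. i \<noteq> m \<Longrightarrow> a i = b i) \<Longrightarrow> u d a = u d b"
        "\<And>d a b. positive a \<Longrightarrow> positive b \<Longrightarrow> (\<And>i. i \<noteq> m \<Longrightarrow> a i = b i) \<Longrightarrow> v d a = v d b"
      and eq: "\<And>a. positive a \<Longrightarrow> x a = (\<Sum>d = - N..N. u d a * a m powi d)"
        "\<And>a. positive a \<Longrightarrow> x a = (\<Sum>d = - L..L. v d a * a m powi d)"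
      and a: "positive a"
    for u v :: "int \<Rightarrow> (nat \<Rightarrow> 'k) \<Rightarrow> 'k" and N L d a
  proof -
    from a obtain C where C: "positive_cone C" "range a \<subseteq> C"
      by (auto simp: positive_def)
    show ?thesis
    proof (rule laurent_coefficients_unique[OF C(1), of N "\<lambda>d. u d a" L "\<lambda>d. v d a"])
      fix y assume "y \<in> C"
      then have b: "positive (a(m := y))" by (rule positive_update[OF C])
      have "u d (a(m := y)) = u d a" "v d (a(m := y)) = v d a" for d
        by (intro indep b a; simp)+
      then show "(\<Sum>d = - N..N. u d a * y powi d) = (\<Sum>d = - L..L. v d a * y powi d)"
        using eq[OF b] by simp
    qed (rule bound, assumption)+
  qed
  have \<phi>_empty: "\<phi> {} a = a" for a
    by (simp add: \<phi>_def)
  from expansion[of "{}", unfolded \<phi>_empty, OF empty_subsetI]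
  obtain N c where c: "\<And>d. laurent (UNIV - {m}) (c d)"
    "\<And>d a. N < \<bar>d\<bar> \<Longrightarrow> c d a = 0" "\<And>a. positive a \<Longrightarrow> x a = (\<Sum>d = - N..N. c d a * a m powi d)"
    by metis
  have c_indep: "c d a = c d b" if "positive a" "positive b" "\<And>i. i \<noteq> m \<Longrightarrow> a i = b i" for d a b
    by (rule laurent_agree[OF c(1) that(1,2)]) (use that(3) in auto)
  have P_nz: "P m a \<noteq> 0" if "positive a" for a
    using \<phi>_pos[OF _ that, of "{m}"] positive_nonzero[of "\<phi> {m} a" m] by (auto simp: \<phi>_def)
  have P_M: "laurent (- M) (P k)" if "k \<in> M" for k
    using that by (intro laurent_mono[OF P]) auto
  \<comment> \<open>For \<open>d < 0\<close> this is the quotient of the coefficient by \<open>P m\<^sup>-\<^sup>d\<close>.\<close>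
  define e where "e d a = c d a * P m a powi d" for d a
  have c_lower: "lower_bound P M (c d)" for d
  proof (rule insert.IH)
    fix K assume K: "K \<subseteq> M"
    then have K': "K \<subseteq> insert m M" "m \<notin> K" using insert.hyps by auto
    from expansion[OF K'(1)] obtain L u where u: "\<And>d. laurent (UNIV - {m}) (u d)"
      "\<And>d a. L < \<bar>d\<bar> \<Longrightarrow> u d a = 0"
      "\<And>a. positive a \<Longrightarrow> x a = (\<Sum>d = - L..L. u d (\<phi> K a) * \<phi> K a m powi d)" by blast
    have "c d a = u d (\<phi> K a)" if "positive a" for a
    proof (rule unique[where u = c and v = "\<lambda>d a. u d (\<phi> K a)", OF c(2) _ c_indep _ c(3) _ that])
      show "u d (\<phi> K a) = u d (\<phi> K b)" if "positive a" "positive b" "\<And>i. i \<noteq> m \<Longrightarrow> a i = b i" for d a b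
        by (rule \<phi>_agree[OF u(1) K'(1) K'(1) refl that])
      show "x a = (\<Sum>d = - L..L. u d (\<phi> K a) * a m powi d)" if "positive a" for a
        using u(3)[OF that] K'(2) by (simp add: \<phi>_def)
    qed (auto simp: u(2))
    moreover have "laurent UNIV (u d)" by (rule laurent_mono[OF u(1)]) auto
    ultimately show "\<exists>g. laurent UNIV g \<and> (\<forall>a. positive a \<longrightarrow>
        c d a = g (\<lambda>i. if i \<in> K then P i a * inverse (a i) else a i))"
      unfolding \<phi>_def by (intro exI[of _ "u d"]) blast
  qed (use P_M P_cone in auto)
  have e_lower: "lower_bound P M (e d)" for d
  proof (rule insert.IH)
    fix K assume K: "K \<subseteq> M"
    then have K': "insert m K \<subseteq> insert m M" "K \<subseteq> insert m M" "m \<notin> K" using insert.hyps by auto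
    from expansion[OF K'(1)] obtain L u where u: "\<And>d. laurent (UNIV - {m}) (u d)"
      "\<And>d a. L < \<bar>d\<bar> \<Longrightarrow> u d a = 0"
      "\<And>a. positive a \<Longrightarrow> x a = (\<Sum>d = - L..L. u d (\<phi> (insert m K) a) * \<phi> (insert m K) a m powi d)"
      by blast
    define v where "v d a = u (- d) (\<phi> K a) * P m a powi (- d)" for d a
    have \<phi>_eq: "u d (\<phi> (insert m K) a) = u d (\<phi> K a)" if "positive a" for d a
      by (rule \<phi>_agree[OF u(1) K'(1,2) _ that that]) auto
    have "c d a = v d a" if "positive a" for a
    proof (rule unique[where u = c and v = v, OF c(2) _ c_indep _ c(3) _ that])
      show "v d a = v d b" if "positive a" "positive b" "\<And>i. i \<noteq> m \<Longrightarrow> a i = b i" for d a b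
        using \<phi>_agree[OF u(1) K'(2) K'(2) refl that] P_agree[OF _ that, of m] by (simp add: v_def)
      show "x a = (\<Sum>d = - L..L. v d a * a m powi d)" if "positive a" for a
      proof -
        have "x a = (\<Sum>d = - L..L. u d (\<phi> K a) * (P m a * inverse (a m)) powi d)"
          using u(3)[OF that] \<phi>_eq[OF that] by (simp add: \<phi>_def[of "insert m K"])
        also have "\<dots> = (\<Sum>d = - L..L. v d a * a m powi d)"
          by (rule sum.reindex_bij_witness[of _ uminus uminus])
            (auto simp: v_def power_int_mult_distrib power_int_inverse power_int_minus)
        finally show ?thesis .
      qed
    qed (auto simp: v_def u(2))
    then have "e d a = u (- d) (\<phi> K a)" if "positive a" for a
      using that P_nz[OF that] by (simp add: e_def v_def power_int_minus)
    moreover have "laurent UNIV (u (- d))" by (rule laurent_mono[OF u(1)]) auto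
    ultimately show "\<exists>g. laurent UNIV g \<and> (\<forall>a. positive a \<longrightarrow>
        e d a = g (\<lambda>i. if i \<in> K then P i a * inverse (a i) else a i))"
      unfolding \<phi>_def by (intro exI[of _ "u (- d)"]) blast
  qed (use P_M P_cone in auto)
  have lift: "lower_bound P (insert m M) f"
    if "lower_bound P M f" "\<And>a. positive a \<Longrightarrow> f (a(m := 1)) = f a" for f
  proof (rule lower_bound.cong[OF lower_bound_specialise[OF that(1) insert.hyps(2)] that(2)])
    show "laurent (- {m}) (P k)" if "k \<in> M" for k
      using that by (intro laurent_mono[OF P]) auto
  qed
  have terms: "lower_bound P (insert m M) (\<lambda>a. c d a * a m powi d)" for d
  proof (cases "0 \<le> d")
    case True
    have "lower_bound P (insert m M) (c d)"
    proof (rule lift[OF c_lower])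
      show "c d (a(m := 1)) = c d a" if "positive a" for a
        by (rule c_indep[OF positive_update_one[OF that] that]) simp
    qed
    with True show ?thesis
      by (simp add: power_int_def) (intro lower_bound.mult lower_bound_power lower_bound.var)
  next
    case False
    have "e d (a(m := 1)) = e d a" if "positive a" for a
      using c_indep[OF positive_update_one[OF that] that] P_agree[OF _ positive_update_one[OF that] that]
      by (simp add: e_def)
    then have "lower_bound P (insert m M) (e d)"
      by (rule lift[OF e_lower])
    then have "lower_bound P (insert m M) (\<lambda>a. e d a * (P m a * inverse (a m)) ^ nat (- d))"
      by (intro lower_bound.mult lower_bound_power lower_bound.adjacent) auto
    then show ?thesis
    proof (rule lower_bound.cong)
      fix a :: "nat \<Rightarrow> 'k" assume "positive a"
      with False P_nz[of a] show "e d a * (P m a * inverse (a m)) ^ nat (- d) = c d a * a m powi d"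
        by (simp add: e_def power_int_def power_mult_distrib power_inverse)
    qed
  qed
  have "lower_bound P (insert m M) (\<lambda>a. \<Sum>d = - N..N. c d a * a m powi d)"
    by (intro lower_bound_sum terms)
  then show ?case
    by (rule lower_bound.cong) (simp add: c(3))
qed

lemma mutate_path_reverse:
  assumes "exchange_matrix V b" "positive a"
  shows "mutate_path V (rev xs @ ks) (fold mutate_matrix xs b) (mutate_path V xs b a) = mutate_path V ks b a"
  using assms
proof (induction xs arbitrary: b a ks)
  case (Cons k xs)
  have "mutate_path V (rev (k # xs) @ ks) (fold mutate_matrix (k # xs) b) (mutate_path V (k # xs) b a) =
      mutate_path V (k # ks) (mutate_matrix k b) (a(k := exchange V b k a))"
    unfolding rev.simps append_assoc append_Cons append_Nil fold_Cons o_apply mutate_path.simps(2)[of V k xs]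
    by (rule Cons.IH[OF exchange_matrix_mutate[OF Cons.prems(1)] positive_exchange[OF Cons.prems(2)]])
  also have "\<dots> = mutate_path V (k # k # ks) b a"
    by simp
  finally show ?case
    by (simp only: mutate_path_twice[OF Cons.prems])
qed simp

lemma fold_exchange_matrix: "exchange_matrix V b \<Longrightarrow> exchange_matrix V (fold mutate_matrix xs b)"
  by (induction xs arbitrary: b) (auto intro: exchange_matrix_mutate)

lemma mutate_path_isolated:
  assumes "exchange_matrix V b" "\<And>i j. i \<in> M \<Longrightarrow> j \<in> M \<Longrightarrow> b i j = 0" "set xs \<subseteq> M" "distinct xs"
  shows "mutate_path V xs b a = (\<lambda>i. if i \<in> set xs then exchange V b i a else a i)"
  using assms
proof (induction xs arbitrary: b a)
  case (Cons k xs)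
  have row: "mutate_matrix k b i l = b i l" if "i \<in> M" "i \<noteq> k" for i l
    using that Cons.prems(2)[of i k] Cons.prems(3) by (auto simp: mutate_matrix_eq)
  have "mutate_matrix k b i j = 0" if "i \<in> M" "j \<in> M" for i j
    using that Cons.prems(2)[of i j] Cons.prems(2)[of i k] Cons.prems(3) by (auto simp: mutate_matrix_eq)
  moreover have "exchange V (mutate_matrix k b) i (a(k := z)) = exchange V b i a"
    if "i \<in> M" "i \<noteq> k" for i z
    using that row[OF that] Cons.prems(2)[of i k] Cons.prems(3) by (intro exchange_cong) auto
  moreover have "i \<in> M" "i \<noteq> k" if "i \<in> set xs" for i
    using that Cons.prems(3,4) by auto
  moreover have "mutate_path V (k # xs) b a = (\<lambda>i. if i \<in> set xs
      then exchange V (mutate_matrix k b) i (a(k := exchange V b k a)) else (a(k := exchange V b k a)) i)"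
    unfolding mutate_path.simps(2)
    by (rule Cons.IH[OF exchange_matrix_mutate[OF Cons.prems(1)]])
      (use calculation(1) Cons.prems(3,4) in auto)
  ultimately show ?case
    using Cons.prems(4) by (auto simp: fun_eq_iff)
qed simp

text \<open>
  Mutating back to the initial seed along a subset of \<open>M\<close> and then along \<open>ks\<close> is a path that
  starts at the mutated seed, so the Laurent phenomenon applies at each of these seeds.
\<close>

theorem cluster_variable_lower_bound:
  assumes V: "finite V" "exchange_matrix V b" and M: "M \<subseteq> V" "\<And>i j. i \<in> M \<Longrightarrow> j \<in> M \<Longrightarrow> b i j = 0"
    and ks: "set ks \<subseteq> V"
  shows "lower_bound (exchange_binomial V b) M (\<lambda>a :: nat \<Rightarrow> 'k::field. mutate_path V ks b a i)"
proof (rule laurent_at_all_vertices_imp_lower_bound)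
  show "finite M" by (rule finite_subset[OF M(1) V(1)])
  show "laurent (- M) (exchange_binomial V b k :: _ \<Rightarrow> 'k)" if "k \<in> M" for k
  proof -
    have "laurent (- M) (\<lambda>a :: nat \<Rightarrow> 'k. a l ^ nat (b k l))"
      "laurent (- M) (\<lambda>a :: nat \<Rightarrow> 'k. a l ^ nat (- b k l))" for l
      using M(2)[OF that, of l]
      by (cases "b k l = 0"; auto intro!: laurent_power laurent.var laurent.one)+
    then show ?thesis
      unfolding exchange_binomial_def[abs_def] by (intro laurent.add laurent_prod)
  qed
  show "exchange_binomial V b k a \<in> C" if "positive_cone C" "range a \<subseteq> C"
    for k and a :: "nat \<Rightarrow> 'k" and C
    unfolding exchange_binomial_def using that
    by (intro positive_coneD(3)[OF that(1)] positive_cone_prod positive_cone_power) auto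
next
  fix K assume K: "K \<subseteq> M"
  have "finite K" by (rule finite_subset[OF K finite_subset[OF M(1) V(1)]])
  then obtain xs where xs: "set xs = K" "distinct xs" using finite_distinct_list by blast
  have "laurent UNIV (\<lambda>a :: nat \<Rightarrow> 'k. mutate_path V (rev xs @ ks) (fold mutate_matrix xs b) a i)"
  proof (rule laurent_phenomenon[OF V(1) fold_exchange_matrix[OF V(2)]])
    show "set (rev xs @ ks) \<subseteq> V" using xs(1) K M(1) ks by auto
  qed
  moreover have "mutate_path V ks b a i = mutate_path V (rev xs @ ks) (fold mutate_matrix xs b)
      (\<lambda>i. if i \<in> K then exchange_binomial V b i a * inverse (a i) else a i) i" if "positive a"
    for a :: "nat \<Rightarrow> 'k"
  proof -
    have "mutate_path V xs b a = (\<lambda>i. if i \<in> K then exchange_binomial V b i a * inverse (a i) else a i)"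
    proof -
      have "set xs \<subseteq> M" using xs(1) K by simp
      from mutate_path_isolated[OF V(2) M(2) this xs(2), of a]
      have "mutate_path V xs b a = (\<lambda>i. if i \<in> set xs then exchange V b i a else a i)"
        by blast
      then show ?thesis unfolding xs(1) exchange_eq_binomial .
    qed
    then show ?thesis
      using mutate_path_reverse[OF V(2) that, of xs ks] by metis
  qed
  ultimately show "\<exists>g. laurent UNIV g \<and> (\<forall>a :: nat \<Rightarrow> 'k. positive a \<longrightarrow> mutate_path V ks b a i =
      g (\<lambda>i. if i \<in> K then exchange_binomial V b i a * inverse (a i) else a i))"
    by (intro exI[of _ "\<lambda>a. mutate_path V (rev xs @ ks) (fold mutate_matrix xs b) a i"] conjI allI impI)
qed

section \<open>Subrings of the rational function field and their spectra\<close>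

definition subring_set :: "ratfun set \<Rightarrow> bool" where
  "subring_set A \<longleftrightarrow> 1 \<in> A \<and> (\<forall>x\<in>A. - x \<in> A) \<and> (\<forall>x\<in>A. \<forall>y\<in>A. x + y \<in> A \<and> x * y \<in> A)"

lemma subring_setD:
  assumes "subring_set A"
  shows "1 \<in> A" "x \<in> A \<Longrightarrow> - x \<in> A" "x \<in> A \<Longrightarrow> y \<in> A \<Longrightarrow> x + y \<in> A"
    "x \<in> A \<Longrightarrow> y \<in> A \<Longrightarrow> x * y \<in> A"
  using assms unfolding subring_set_def by blast+

lemma subring_set_zero:
  assumes "subring_set A"
  shows "0 \<in> A"
proof -
  have "1 + - 1 \<in> A" by (intro subring_setD[OF assms])
  then show ?thesis by simp
qed

lemma subring_set_power: "subring_set A \<Longrightarrow> x \<in> A \<Longrightarrow> x ^ n \<in> A"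
  by (induction n) (auto intro: subring_setD)

lemma subring_set_prod: "subring_set A \<Longrightarrow> (\<And>i. i \<in> I \<Longrightarrow> f i \<in> A) \<Longrightarrow> prod f I \<in> A"
  by (induction I rule: infinite_finite_induct) (auto intro: subring_setD)

lemma ratfun_ring_simps:
  "carrier ratfun_ring = UNIV" "\<one>\<^bsub>ratfun_ring\<^esub> = 1" "\<zero>\<^bsub>ratfun_ring\<^esub> = 0"
  "x \<otimes>\<^bsub>ratfun_ring\<^esub> y = x * y" "x \<oplus>\<^bsub>ratfun_ring\<^esub> y = x + y" for x y :: ratfun
  by (simp_all add: ring_of_type_algebra_def)

lemma ratfun_ring_uminus: "\<ominus>\<^bsub>ratfun_ring\<^esub> x = - x" for x :: ratfun
proof -
  interpret cring ratfun_ring by (rule cring_from_type_algebra)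
  show ?thesis by (rule minus_equality) (simp_all add: ratfun_ring_simps)
qed

lemma subring_set_generate_ring: "subring_set (generate_ring ratfun_ring G)"
  unfolding subring_set_def
  using generate_ring.one[of ratfun_ring G] generate_ring.a_inv[of _ ratfun_ring G]
    generate_ring.eng_add[of _ ratfun_ring G] generate_ring.eng_mult[of _ ratfun_ring G]
  by (simp add: ratfun_ring_simps ratfun_ring_uminus)

lemma generate_ring_least:
  assumes "subring_set A" "G \<subseteq> A"
  shows "generate_ring ratfun_ring G \<subseteq> A"
proof
  fix x assume "x \<in> generate_ring ratfun_ring G"
  then show "x \<in> A"
    by (induction rule: generate_ring.induct)
      (use assms subring_setD[OF assms(1)] in \<open>auto simp: ratfun_ring_simps ratfun_ring_uminus\<close>)
qed

lemma generate_ring_denominator: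
  assumes B: "subring_set B" and d: "d \<in> B" and G: "\<And>g. g \<in> G \<Longrightarrow> \<exists>N :: nat. g * d ^ N \<in> B"
    and x: "x \<in> generate_ring ratfun_ring G"
  shows "\<exists>N :: nat. x * d ^ N \<in> B"
proof -
  let ?A = "{x. \<exists>N :: nat. x * d ^ N \<in> B}"
  have "subring_set ?A"
    unfolding subring_set_def
  proof (intro conjI ballI)
    show "1 \<in> ?A" using subring_setD(1)[OF B] by (auto intro!: exI[of _ "0::nat"])
  next
    fix x assume "x \<in> ?A"
    then obtain N :: nat where "x * d ^ N \<in> B" by blast
    then have "- x * d ^ N \<in> B" using subring_setD(2)[OF B] by fastforce
    then show "- x \<in> ?A" by blast
  next
    fix x y assume "x \<in> ?A" "y \<in> ?A"
    then obtain M N :: nat where xy: "x * d ^ M \<in> B" "y * d ^ N \<in> B" by blast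
    have dp: "d ^ n \<in> B" for n by (rule subring_set_power[OF B d])
    have "(x * d ^ M) * d ^ N + (y * d ^ N) * d ^ M \<in> B"
      by (intro subring_setD[OF B] xy dp)
    then have "(x + y) * d ^ (M + N) \<in> B" by (simp add: algebra_simps power_add)
    then show "x + y \<in> ?A" by blast
    have "(x * d ^ M) * (y * d ^ N) \<in> B"
      by (intro subring_setD[OF B] xy)
    then have "(x * y) * d ^ (M + N) \<in> B" by (simp add: algebra_simps power_add)
    then show "x * y \<in> ?A" by blast
  qed
  then have "generate_ring ratfun_ring G \<subseteq> ?A"
    by (rule generate_ring_least) (use G in blast)
  then show ?thesis using x by blast
qed

lemma mem_if_comaximal_denominators:
  fixes m n :: nat
  assumes B: "subring_set B" and pq: "p \<in> B" "q \<in> B" "r \<in> B" "t \<in> B" "r * p + t * q = 1"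
    and x: "x * p ^ m \<in> B" "x * q ^ n \<in> B"
  shows "x \<in> B"
proof -
  have step: "y \<in> B" if y: "y * p \<in> B" "y * q \<in> B" for y
  proof -
    have "r * (y * p) + t * (y * q) \<in> B"
      using subring_setD(3)[OF B subring_setD(4)[OF B pq(3) y(1)] subring_setD(4)[OF B pq(4) y(2)]] .
    also have "r * (y * p) + t * (y * q) = y * (r * p + t * q)"
      by (simp add: algebra_simps)
    finally show ?thesis by (simp add: pq(5))
  qed
  have step2: "y \<in> B" if "y * p \<in> B" "y * q ^ n \<in> B" for y n
    using that
  proof (induction n)
    case (Suc n)
    have "(y * q ^ n) * p = (y * p) * q ^ n" "(y * q ^ n) * q = y * q ^ Suc n"
      by (simp_all only: power_Suc ac_simps)
    then have "y * q ^ n \<in> B"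
      using step[of "y * q ^ n"] Suc.prems(2)
        subring_setD(4)[OF B Suc.prems(1) subring_set_power[OF B pq(2), of n]] by metis
    then show ?case by (rule Suc.IH[OF Suc.prems(1)])
  qed simp
  show ?thesis
    using x(1)
  proof (induction m)
    case (Suc m)
    have "(x * p ^ m) * p = x * p ^ Suc m" "(x * p ^ m) * q ^ n = (x * q ^ n) * p ^ m"
      by (simp_all only: power_Suc ac_simps)
    then have "x * p ^ m \<in> B"
      using step2[of "x * p ^ m" n] Suc.prems
        subring_setD(4)[OF B x(2) subring_set_power[OF B pq(1), of m]] by metis
    then show ?case by (rule Suc.IH)
  qed simp
qed

lemma Spec_iff:
  assumes A: "subring_set A"
  shows "P \<in> Spec A \<longleftrightarrow> P \<subseteq> A \<and> 0 \<in> P \<and> (\<forall>x\<in>P. \<forall>y\<in>P. x + y \<in> P) \<and>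
    (\<forall>x\<in>A. \<forall>y\<in>P. x * y \<in> P) \<and> 1 \<notin> P \<and> (\<forall>x\<in>A. \<forall>y\<in>A. x * y \<in> P \<longrightarrow> x \<in> P \<or> y \<in> P)"
    (is "_ \<longleftrightarrow> ?R")
proof -
  let ?A = "ratfun_ring\<lparr>carrier := A\<rparr>"
  have ops: "carrier ?A = A" "\<one>\<^bsub>?A\<^esub> = 1" "\<zero>\<^bsub>?A\<^esub> = 0" "x \<otimes>\<^bsub>?A\<^esub> y = x * y" "x \<oplus>\<^bsub>?A\<^esub> y = x + y"
    for x y :: ratfun
    unfolding ring_of_type_algebra_def by simp_all
  interpret K: cring ratfun_ring by (rule cring_from_type_algebra)
  have "subring A ratfun_ring"
  proof (rule K.subringI)
    show "A \<subseteq> carrier ratfun_ring" "\<one>\<^bsub>ratfun_ring\<^esub> \<in> A"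
      using subring_setD(1)[OF A] by (simp_all add: ratfun_ring_simps)
    show "\<ominus>\<^bsub>ratfun_ring\<^esub> x \<in> A" if "x \<in> A" for x
      using subring_setD(2)[OF A that] by (simp only: ratfun_ring_uminus)
    show "x \<otimes>\<^bsub>ratfun_ring\<^esub> y \<in> A" "x \<oplus>\<^bsub>ratfun_ring\<^esub> y \<in> A" if "x \<in> A" "y \<in> A" for x y
      using subring_setD(3,4)[OF A that] by (simp_all only: ratfun_ring_simps)
  qed
  then have "subcring A ratfun_ring"
    by (rule K.subcringI')
  moreover have "A \<subseteq> carrier ratfun_ring"
    by (simp add: ratfun_ring_simps)
  ultimately have cring: "cring ?A"
    using K.subcring_iff by blast
  interpret R: cring ?A by (rule cring)
  have R_uminus: "\<ominus>\<^bsub>?A\<^esub> x = - x" if "x \<in> A" for x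
  proof (rule R.minus_equality)
    show "- x \<oplus>\<^bsub>?A\<^esub> x = \<zero>\<^bsub>?A\<^esub>" by (simp add: ratfun_ring_simps)
    show "x \<in> carrier ?A" "- x \<in> carrier ?A"
      unfolding ops(1) using that subring_setD(2)[OF A that] .
  qed
  show ?thesis
  proof
    assume "P \<in> Spec A"
    then have P: "primeideal P ?A" by (simp add: Spec_def)
    interpret P: primeideal P ?A by (rule P)
    have sub: "P \<subseteq> A" using P.a_subset unfolding ops(1) .
    have mult: "x * y \<in> P" if "x \<in> A" "y \<in> P" for x y
      using P.I_l_closed[of y x] that unfolding ops by blast
    have one: "1 \<notin> P"
    proof
      assume "1 \<in> P"
      then have "x \<in> P" if "x \<in> A" for x using mult[OF that] by (metis mult_1_right)
      with sub P.I_notcarr show False unfolding ops(1) by blast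
    qed
    have prime: "x \<in> P \<or> y \<in> P" if "x \<in> A" "y \<in> A" "x * y \<in> P" for x y
      using P.I_prime[of x y] that unfolding ops by blast
    have add: "x + y \<in> P" if "x \<in> P" "y \<in> P" for x y
      using P.a_closed[OF that] unfolding ops .
    have zero: "0 \<in> P" using P.zero_closed unfolding ops .
    show ?R
    proof (intro conjI ballI impI)
      show "P \<subseteq> A" "0 \<in> P" "1 \<notin> P" by (rule sub zero one)+
      show "x + y \<in> P" if "x \<in> P" "y \<in> P" for x y by (rule add[OF that])
      show "x * y \<in> P" if "x \<in> A" "y \<in> P" for x y by (rule mult[OF that])
      show "x \<in> P \<or> y \<in> P" if "x \<in> A" "y \<in> A" "x * y \<in> P" for x y by (rule prime[OF that])
    qed
  next
    assume R: ?R
    from R have P1: "P \<subseteq> A" by (elim conjE)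
    from R have P2: "0 \<in> P" by (elim conjE)
    from R have P3: "\<forall>x\<in>P. \<forall>y\<in>P. x + y \<in> P" by (elim conjE)
    from R have P4: "\<forall>x\<in>A. \<forall>y\<in>P. x * y \<in> P" by (elim conjE)
    from R have P5: "1 \<notin> P" by (elim conjE)
    from R have P6: "\<forall>x\<in>A. \<forall>y\<in>A. x * y \<in> P \<longrightarrow> x \<in> P \<or> y \<in> P" by (elim conjE)
    have neg: "- x \<in> P" if "x \<in> P" for x
    proof -
      have "- 1 * x \<in> P"
        using P4 subring_setD(2)[OF A subring_setD(1)[OF A]] that by blast
      then show ?thesis by simp
    qed
    have "additive_subgroup P ?A"
    proof (rule additive_subgroup.intro, rule subgroup.intro)
      show "P \<subseteq> carrier (add_monoid ?A)" using P1 by simp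
      show "x \<otimes>\<^bsub>add_monoid ?A\<^esub> y \<in> P" if "x \<in> P" "y \<in> P" for x y
      proof -
        have "x \<oplus>\<^bsub>?A\<^esub> y \<in> P" unfolding ops using P3 that by blast
        then show ?thesis by simp
      qed
      show "\<one>\<^bsub>add_monoid ?A\<^esub> \<in> P" using P2 by (simp add: ratfun_ring_simps)
      show "inv\<^bsub>add_monoid ?A\<^esub> x \<in> P" if "x \<in> P" for x
      proof -
        have "x \<in> A" using that P1 by blast
        from R_uminus[OF this] have "inv\<^bsub>add_monoid ?A\<^esub> x = - x"
          unfolding a_inv_def .
        with neg[OF that] show ?thesis by (simp only:)
      qed
    qed
    then have "primeideal P ?A"
    proof (rule primeidealI2[OF _ cring])
      show "y \<otimes>\<^bsub>?A\<^esub> x \<in> P" if "x \<in> P" "y \<in> carrier ?A" for x y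
        using P4 that unfolding ops by blast
      show "x \<otimes>\<^bsub>?A\<^esub> y \<in> P" if "x \<in> P" "y \<in> carrier ?A" for x y
      proof -
        have "y * x \<in> P" using P4 that unfolding ops by blast
        then show ?thesis unfolding ops by (simp only: mult.commute)
      qed
      show "carrier ?A \<noteq> P" unfolding ops(1) using P5 subring_setD(1)[OF A] by blast
      show "x \<in> P \<or> y \<in> P" if "x \<in> carrier ?A" "y \<in> carrier ?A" "x \<otimes>\<^bsub>?A\<^esub> y \<in> P" for x y
        using P6 that unfolding ops by blast
    qed
    then show "P \<in> Spec A" by (simp add: Spec_def)
  qed
qed

lemma Spec_image_subset:
  assumes "subring_set A" "subring_set B" "A \<subseteq> B"
  shows "Spec_image A B \<subseteq> Spec A"
proof
  fix P assume "P \<in> Spec_image A B"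
  then obtain Q where Q: "Q \<in> Spec B" and P: "P = Q \<inter> A"
    by (auto simp: Spec_image_def)
  have Q': "0 \<in> Q" "\<And>x y. x \<in> Q \<Longrightarrow> y \<in> Q \<Longrightarrow> x + y \<in> Q" "\<And>x y. x \<in> B \<Longrightarrow> y \<in> Q \<Longrightarrow> x * y \<in> Q"
    "1 \<notin> Q" "\<And>x y. x \<in> B \<Longrightarrow> y \<in> B \<Longrightarrow> x * y \<in> Q \<Longrightarrow> x \<in> Q \<or> y \<in> Q"
    using Q unfolding Spec_iff[OF assms(2)] by (elim conjE, blast)+
  show "P \<in> Spec A"
    unfolding Spec_iff[OF assms(1)] P
  proof (intro conjI ballI impI)
    show "0 \<in> Q \<inter> A" "1 \<notin> Q \<inter> A" "Q \<inter> A \<subseteq> A"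
      using Q'(1,4) subring_set_zero[OF assms(1)] by auto
    show "x + y \<in> Q \<inter> A" if "x \<in> Q \<inter> A" "y \<in> Q \<inter> A" for x y
      using that Q'(2) subring_setD(3)[OF assms(1)] by auto
    show "x * y \<in> Q \<inter> A" if "x \<in> A" "y \<in> Q \<inter> A" for x y
      using that Q'(3)[of x y] subring_setD(4)[OF assms(1), of x y] assms(3) by auto
    show "x \<in> Q \<inter> A \<or> y \<in> Q \<inter> A" if "x \<in> A" "y \<in> A" "x * y \<in> Q \<inter> A" for x y
      using that Q'(5)[of x y] assms(3) by auto
  qed
qed

text \<open>
  For \<open>B\<close> the localization of \<open>A\<close> at \<open>d\<close>, the prime above \<open>P\<close> consists of the fractions with
  numerator in \<open>P\<close>.
\<close>

lemma Spec_image_localization: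
  assumes A: "subring_set A" and B: "subring_set B" and AB: "A \<subseteq> B"
    and d: "d \<in> A" "inverse d \<in> B" and frac: "\<And>x. x \<in> B \<Longrightarrow> \<exists>N :: nat. x * d ^ N \<in> A"
    and P: "P \<in> Spec A" and dP: "d \<notin> P"
  shows "P \<in> Spec_image A B"
proof -
  have P': "P \<subseteq> A" "0 \<in> P" "\<And>x y. x \<in> P \<Longrightarrow> y \<in> P \<Longrightarrow> x + y \<in> P"
    "\<And>x y. x \<in> A \<Longrightarrow> y \<in> P \<Longrightarrow> x * y \<in> P" "1 \<notin> P"
    "\<And>x y. x \<in> A \<Longrightarrow> y \<in> A \<Longrightarrow> x * y \<in> P \<Longrightarrow> x \<in> P \<or> y \<in> P"
    using P unfolding Spec_iff[OF A] by (elim conjE, blast)+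
  have dA: "d ^ n \<in> A" for n by (rule subring_set_power[OF A d(1)])
  have dnP: "d ^ n \<notin> P" for n
  proof (induction n)
    case (Suc n)
    then show ?case using P'(6)[OF d(1) dA[of n]] dP by auto
  qed (simp add: P'(5))
  define Q where "Q = {x \<in> B. \<exists>N :: nat. x * d ^ N \<in> P}"
  have QA: "Q \<inter> A = P"
  proof
    show "Q \<inter> A \<subseteq> P"
    proof
      fix x assume "x \<in> Q \<inter> A"
      then obtain N :: nat where "x \<in> A" "x * d ^ N \<in> P" by (auto simp: Q_def)
      then show "x \<in> P" using P'(6)[OF _ dA[of N]] dnP[of N] by blast
    qed
    show "P \<subseteq> Q \<inter> A"
    proof
      fix x assume "x \<in> P"
      then have "x * d ^ 0 \<in> P" "x \<in> A" "x \<in> B" using P'(1) AB by auto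
      then show "x \<in> Q \<inter> A" unfolding Q_def by blast
    qed
  qed
  have "Q \<in> Spec B"
    unfolding Spec_iff[OF B]
  proof (intro conjI ballI impI)
    show "Q \<subseteq> B" by (auto simp: Q_def)
    show "0 \<in> Q" using P'(2) subring_set_zero[OF B] by (simp add: Q_def)
    show "1 \<notin> Q" using dnP by (simp add: Q_def)
  next
    fix x y assume "x \<in> Q" "y \<in> Q"
    then obtain M N :: nat where xy: "x * d ^ M \<in> P" "y * d ^ N \<in> P" "x \<in> B" "y \<in> B"
      by (auto simp: Q_def)
    have "d ^ N * (x * d ^ M) + d ^ M * (y * d ^ N) \<in> P"
      by (intro P'(3,4) xy dA)
    then have "(x + y) * d ^ (M + N) \<in> P" by (simp add: algebra_simps power_add)
    then show "x + y \<in> Q" using subring_setD(3)[OF B xy(3,4)] unfolding Q_def by blast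
  next
    fix x y assume "x \<in> B" "y \<in> Q"
    then obtain N :: nat where y: "y * d ^ N \<in> P" "y \<in> B" by (auto simp: Q_def)
    from frac[OF \<open>x \<in> B\<close>] obtain M :: nat where "x * d ^ M \<in> A" by blast
    from P'(4)[OF this y(1)] have "(x * y) * d ^ (M + N) \<in> P" by (simp add: algebra_simps power_add)
    then show "x * y \<in> Q" using subring_setD(4)[OF B \<open>x \<in> B\<close> y(2)] unfolding Q_def by blast
  next
    fix x y assume xy: "x \<in> B" "y \<in> B" and "x * y \<in> Q"
    then obtain N :: nat where N: "(x * y) * d ^ N \<in> P" by (auto simp: Q_def)
    from frac[OF xy(1)] obtain k :: nat where k: "x * d ^ k \<in> A" by blast
    from frac[OF xy(2)] obtain l :: nat where l: "y * d ^ l \<in> A" by blast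
    have "d ^ (k + l) * ((x * y) * d ^ N) \<in> P"
      by (intro P'(4) N dA)
    then have "((x * d ^ k) * (y * d ^ l)) * d ^ N \<in> P" by (simp add: algebra_simps power_add)
    then have "(x * d ^ k) * (y * d ^ l) \<in> P"
      using P'(6)[OF subring_setD(4)[OF A k l] dA[of N]] dnP[of N] by blast
    then have "x * d ^ k \<in> P \<or> y * d ^ l \<in> P"
      by (rule P'(6)[OF k l])
    then show "x \<in> Q \<or> y \<in> Q" using xy unfolding Q_def by blast
  qed
  with QA show ?thesis unfolding Spec_image_def by blast
qed

section \<open>Mutation of seeds\<close>

text \<open>
  The form in which algebraic independence of the cluster is used. It is visibly preserved by
  mutation and freezing, and it excludes zero denominators.
\<close>

definition positive_seed :: "seed \<Rightarrow> bool" where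
  "positive_seed s \<longleftrightarrow> is_ice_quiver (quiver s) \<and>
     (\<exists>C. positive_cone C \<and> cluster s ` verts (quiver s) \<subseteq> C)"

lemma is_ice_quiver_iff:
  "is_ice_quiver q \<longleftrightarrow> frozen q \<subseteq> verts q \<and> exchange_matrix (verts q) (arrows q)"
  unfolding is_ice_quiver_def exchange_matrix_def by (rule refl)

lemma finite_verts: "finite (verts q)"
  by (simp add: verts_def)

lemma mutate_simps:
  "nverts (quiver (mutate k s)) = nverts (quiver s)"
  "frozen (quiver (mutate k s)) = frozen (quiver s)"
  "arrows (quiver (mutate k s)) = mutate_matrix k (arrows (quiver s))"
  by (simp_all add: mutate_def mutate_quiver_def mutate_matrix_def)

lemma cluster_mutate:
  "cluster (mutate k s) = (cluster s)(k := exchange (verts (quiver s)) (arrows (quiver s)) k (cluster s))"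
proof -
  let ?V = "verts (quiver s)" and ?b = "arrows (quiver s) k" and ?a = "cluster s"
  have "(\<Prod>j\<in>{j \<in> ?V. e j > 0}. ?a j ^ nat (e j)) = (\<Prod>j\<in>?V. ?a j ^ nat (e j))" for e :: "nat \<Rightarrow> int"
  proof (rule prod.mono_neutral_left)
    show "\<forall>j\<in>?V - {j \<in> ?V. 0 < e j}. ?a j ^ nat (e j) = 1"
    proof
      fix j assume "j \<in> ?V - {j \<in> ?V. 0 < e j}"
      then have "nat (e j) = 0" by auto
      then show "?a j ^ nat (e j) = 1" by simp
    qed
  qed (auto simp: finite_verts)
  from this[of ?b] this[of "\<lambda>j. - ?b j"] show ?thesis
    by (simp add: mutate_def mutate_cluster_def exchange_def)
qed

lemma fold_mutate_simps:
  "nverts (quiver (fold mutate ks s)) = nverts (quiver s)"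
  "frozen (quiver (fold mutate ks s)) = frozen (quiver s)"
  by (induction ks arbitrary: s) (simp_all add: mutate_simps)

lemma fold_mutate_verts:
  "verts (quiver (fold mutate ks s)) = verts (quiver s)"
  "mutables (quiver (fold mutate ks s)) = mutables (quiver s)"
  by (simp_all add: verts_def mutables_def fold_mutate_simps)

lemma cluster_fold_mutate:
  "cluster (fold mutate ks s) = mutate_path (verts (quiver s)) ks (arrows (quiver s)) (cluster s)"
  by (induction ks arbitrary: s) (simp_all add: mutate_simps cluster_mutate verts_def)

lemma mutation_equivalent_iff:
  "mutation_equivalent s t \<longleftrightarrow> (\<exists>ks. set ks \<subseteq> mutables (quiver s) \<and> t = fold mutate ks s)"
proof
  assume "mutation_equivalent s t"
  then show "\<exists>ks. set ks \<subseteq> mutables (quiver s) \<and> t = fold mutate ks s"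
    unfolding mutation_equivalent_def
  proof (induction rule: rtranclp_induct)
    case base
    show ?case by (rule exI[of _ "[]"]) simp
  next
    case (step t u)
    then obtain ks where ks: "set ks \<subseteq> mutables (quiver s)" "t = fold mutate ks s" by blast
    from step(2) obtain k where k: "k \<in> mutables (quiver t)" "u = mutate k t"
      by (auto simp: mutation_step_def)
    show ?case
      by (rule exI[of _ "ks @ [k]"]) (use ks k in \<open>simp add: fold_mutate_verts\<close>)
  qed
next
  assume "\<exists>ks. set ks \<subseteq> mutables (quiver s) \<and> t = fold mutate ks s"
  then obtain ks where "set ks \<subseteq> mutables (quiver s)" "t = fold mutate ks s" by blast
  then show "mutation_equivalent s t"
    unfolding mutation_equivalent_def
  proof (induction ks arbitrary: t rule: rev_induct)
    case (snoc k ks)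
    then have "mutation_step\<^sup>*\<^sup>* s (fold mutate ks s)" by simp
    moreover have "mutation_step (fold mutate ks s) t"
      using snoc.prems by (auto simp: mutation_step_def fold_mutate_verts)
    ultimately show ?case by (rule rtranclp.rtrancl_into_rtrancl)
  qed simp
qed

lemma mutation_equivalent_trans:
  "mutation_equivalent s t \<Longrightarrow> mutation_equivalent t u \<Longrightarrow> mutation_equivalent s u"
  unfolding mutation_equivalent_def by (rule rtranclp_trans)

lemma positive_seed_mutate:
  assumes "positive_seed s" "k \<in> verts (quiver s)"
  shows "positive_seed (mutate k s)"
proof -
  from assms obtain C where s: "is_ice_quiver (quiver s)" "positive_cone C"
    "cluster s ` verts (quiver s) \<subseteq> C"
    by (auto simp: positive_seed_def)
  have v: "verts (quiver (mutate k s)) = verts (quiver s)"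
    by (simp add: verts_def mutate_simps)
  have "is_ice_quiver (quiver (mutate k s))"
    using s(1) by (simp add: is_ice_quiver_iff v mutate_simps exchange_matrix_mutate)
  moreover have "exchange (verts (quiver s)) (arrows (quiver s)) k (cluster s) \<in> C"
    using s(2,3) assms(2) by (intro exchange_in_cone) auto
  then have "cluster (mutate k s) ` verts (quiver (mutate k s)) \<subseteq> C"
    using s(3) by (auto simp: v cluster_mutate)
  ultimately show ?thesis
    using s(2) unfolding positive_seed_def by blast
qed

lemma mutate_mutate:
  assumes "positive_seed s" "k \<in> verts (quiver s)"
  shows "mutate k (mutate k s) = s"
proof -
  from assms obtain C where s: "is_ice_quiver (quiver s)" "positive_cone C"
    "cluster s ` verts (quiver s) \<subseteq> C"
    by (auto simp: positive_seed_def)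
  have "exchange (verts (quiver s)) (arrows (quiver s)) k (cluster s) \<in> C"
    using s(2,3) assms(2) by (intro exchange_in_cone) auto
  then have nz: "exchange (verts (quiver s)) (arrows (quiver s)) k (cluster s) \<noteq> 0"
    using positive_coneD(6)[OF s(2)] by blast
  have v: "verts (quiver (mutate k s)) = verts (quiver s)"
    by (simp add: verts_def mutate_simps)
  have "cluster (mutate k (mutate k s)) = cluster s"
    unfolding cluster_mutate[of k "mutate k s"] v mutate_simps cluster_mutate[of k s]
    using exchange_involution[OF _ nz] s(1) by (simp add: is_ice_quiver_iff)
  moreover have "arrows (quiver (mutate k (mutate k s))) = arrows (quiver s)"
    by (simp add: mutate_simps mutate_matrix_involution)
  moreover have "ice_quiver.more (quiver (mutate k (mutate k s))) = ice_quiver.more (quiver s)"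
    by simp
  ultimately show ?thesis
    by (intro seed.equality ice_quiver.equality) (simp_all add: mutate_simps)
qed

lemma positive_seed_equivalent:
  assumes "positive_seed s" "mutation_equivalent s t"
  shows "positive_seed t" "mutation_equivalent t s"
proof -
  have "positive_seed t \<and> mutation_equivalent t s"
    using assms(2) unfolding mutation_equivalent_def
  proof (induction rule: rtranclp_induct)
    case base
    then show ?case using assms(1) by simp
  next
    case (step t u)
    then obtain k where k: "k \<in> mutables (quiver t)" "u = mutate k t"
      by (auto simp: mutation_step_def)
    then have kv: "k \<in> verts (quiver t)" by (simp add: mutables_def)
    have "mutation_step u t"
      unfolding mutation_step_def k(2)
      using k(1) mutate_mutate[OF _ kv] step.IH
      by (intro bexI[of _ k]) (simp_all add: mutables_def verts_def mutate_simps)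
    then show ?case
      using step.IH positive_seed_mutate[OF _ kv] k(2) by (auto intro: converse_rtranclp_into_rtranclp)
  qed
  then show "positive_seed t" "mutation_equivalent t s" by blast+
qed

lemma mutation_equivalent_verts:
  assumes "mutation_equivalent s t"
  shows "verts (quiver t) = verts (quiver s)" "mutables (quiver t) = mutables (quiver s)"
    "frozen (quiver t) = frozen (quiver s)"
  using assms unfolding mutation_equivalent_iff by (auto simp: fold_mutate_verts fold_mutate_simps)

lemma mutate_path_other: "i \<notin> set ks \<Longrightarrow> mutate_path V ks b a i = a i"
  by (induction ks arbitrary: b a) auto

lemma mutation_equivalent_cluster_fixed:
  assumes "mutation_equivalent s t" "i \<notin> mutables (quiver s)"
  shows "cluster t i = cluster s i"
  using assms unfolding mutation_equivalent_iff
  by (auto simp: cluster_fold_mutate intro!: mutate_path_other)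

lemma freeze_simps:
  "cluster (freeze S s) = cluster s" "verts (quiver (freeze S s)) = verts (quiver s)"
  "arrows (quiver (freeze S s)) = arrows (quiver s)"
  "frozen (quiver (freeze S s)) = frozen (quiver s) \<union> S"
  "mutables (quiver (freeze S s)) = mutables (quiver s) - S"
  by (auto simp: freeze_def verts_def mutables_def)

lemma freeze_freeze: "freeze S (freeze T s) = freeze (T \<union> S) s"
  by (simp add: freeze_def Un_assoc)

lemma freeze_empty: "freeze {} s = s"
  by (simp add: freeze_def)

lemma freeze_fold_mutate: "freeze S (fold mutate ks s) = fold mutate ks (freeze S s)"
proof (induction ks arbitrary: s)
  case (Cons k ks)
  have "freeze S (mutate k s) = mutate k (freeze S s)"
    by (cases s, rename_tac q a, case_tac q)
      (simp add: freeze_def mutate_def mutate_quiver_def mutate_cluster_def verts_def cong: if_cong)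
  then show ?case by (simp add: Cons.IH)
qed simp

lemma mutation_equivalent_freezeE:
  assumes "mutation_equivalent (freeze S s) t"
  obtains u where "mutation_equivalent s u" "t = freeze S u"
    "\<And>i. i \<in> S \<Longrightarrow> cluster u i = cluster s i"
proof -
  from assms obtain ks where ks: "set ks \<subseteq> mutables (quiver s) - S" "t = fold mutate ks (freeze S s)"
    unfolding mutation_equivalent_iff freeze_simps by blast
  show thesis
  proof (rule that)
    show "mutation_equivalent s (fold mutate ks s)"
      using ks(1) unfolding mutation_equivalent_iff by blast
    show "t = freeze S (fold mutate ks s)" by (simp add: ks(2) freeze_fold_mutate)
    show "cluster (fold mutate ks s) i = cluster s i" if "i \<in> S" for i
      using ks(1) that by (auto simp: cluster_fold_mutate intro!: mutate_path_other)
  qed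
qed

lemma positive_seed_freeze:
  "positive_seed s \<Longrightarrow> S \<subseteq> mutables (quiver s) \<Longrightarrow> positive_seed (freeze S s)"
  unfolding positive_seed_def is_ice_quiver_iff freeze_simps by (auto simp: mutables_def)

section \<open>Acyclic cluster algebras\<close>

text \<open>
  The lower bound of Berenstein, Fomin and Zelevinsky, taken at a single seed.
\<close>

definition lower_ring :: "seed \<Rightarrow> ratfun set" where
  "lower_ring s = generate_ring ratfun_ring (cluster s ` verts (quiver s) \<union>
     (\<lambda>i. inverse (cluster s i)) ` frozen (quiver s) \<union>
     (\<lambda>k. cluster (mutate k s) k) ` mutables (quiver s))"

lemma subring_set_lower_ring: "subring_set (lower_ring s)"
  unfolding lower_ring_def by (rule subring_set_generate_ring)

lemma lower_ring_generators:
  "i \<in> verts (quiver s) \<Longrightarrow> cluster s i \<in> lower_ring s"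
  "i \<in> frozen (quiver s) \<Longrightarrow> inverse (cluster s i) \<in> lower_ring s"
  "i \<in> mutables (quiver s) \<Longrightarrow> cluster (mutate i s) i \<in> lower_ring s"
  unfolding lower_ring_def by (rule generate_ring.incl; blast)+

lemma subring_set_cluster_algebra: "subring_set (cluster_algebra s)"
  unfolding cluster_algebra_def by (rule subring_set_generate_ring)

lemma cluster_algebra_generators:
  "mutation_equivalent s t \<Longrightarrow> i \<in> verts (quiver t) \<Longrightarrow> cluster t i \<in> cluster_algebra s"
  "i \<in> frozen (quiver s) \<Longrightarrow> inverse (cluster s i) \<in> cluster_algebra s"
  unfolding cluster_algebra_def by (rule generate_ring.incl; blast)+

lemma mutation_equivalent_refl: "mutation_equivalent s s"
  unfolding mutation_equivalent_def by simp

lemma mutation_equivalent_mutate: "k \<in> mutables (quiver s) \<Longrightarrow> mutation_equivalent s (mutate k s)"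
  unfolding mutation_equivalent_def by (rule r_into_rtranclp) (auto simp: mutation_step_def)

lemma verts_mutate: "verts (quiver (mutate k s)) = verts (quiver s)"
  by (simp add: verts_def mutate_simps)

lemma lower_ring_subset_cluster_algebra: "lower_ring s \<subseteq> cluster_algebra s"
  unfolding lower_ring_def
proof (rule generate_ring_least[OF subring_set_cluster_algebra], intro Un_least image_subsetI)
  show "cluster (mutate k s) k \<in> cluster_algebra s" if "k \<in> mutables (quiver s)" for k
    using that by (intro cluster_algebra_generators(1)[OF mutation_equivalent_mutate])
      (auto simp: verts_mutate mutables_def)
qed (auto intro: cluster_algebra_generators mutation_equivalent_refl)

text \<open>
  Positive points have all natural numbers as indices, but a cluster has meaning on the vertices
  only; the value one elsewhere lies in every cone and in every subring.
\<close>

definition base_point :: "seed \<Rightarrow> nat \<Rightarrow> ratfun" where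
  "base_point s = (\<lambda>i. if i \<in> verts (quiver s) then cluster s i else 1)"

lemma positive_base_point:
  assumes "positive_seed s"
  shows "positive (base_point s)"
proof -
  from assms obtain C where C: "positive_cone C" "cluster s ` verts (quiver s) \<subseteq> C"
    by (auto simp: positive_seed_def)
  then have "range (base_point s) \<subseteq> C"
    using positive_coneD(1)[OF C(1)] by (auto simp: base_point_def)
  with C(1) show ?thesis unfolding positive_def by blast
qed

lemma positive_seed_nonzero: "positive_seed s \<Longrightarrow> i \<in> verts (quiver s) \<Longrightarrow> cluster s i \<noteq> 0"
  using positive_nonzero[OF positive_base_point, of s i] by (simp add: base_point_def)

lemma exchange_base_point:
  "k \<in> verts (quiver s) \<Longrightarrow>
    exchange (verts (quiver s)) (arrows (quiver s)) k (base_point s) = cluster (mutate k s) k"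
  unfolding cluster_mutate fun_upd_same by (rule exchange_cong) (auto simp: base_point_def)

lemma lower_bound_in_lower_ring:
  assumes s: "positive_seed s"
    and f: "lower_bound (exchange_binomial (verts (quiver s)) (arrows (quiver s))) (mutables (quiver s)) f"
  shows "f (base_point s) \<in> lower_ring s"
  using f
proof (induction rule: lower_bound.induct)
  case one
  show ?case by (rule subring_setD(1)[OF subring_set_lower_ring])
next
  case (var i)
  show ?case
    using lower_ring_generators(1)[of i s] subring_setD(1)[OF subring_set_lower_ring]
    by (auto simp: base_point_def)
next
  case (inv i)
  then have "i \<in> verts (quiver s) \<Longrightarrow> i \<in> frozen (quiver s)" by (simp add: mutables_def)
  then show ?case
    using lower_ring_generators(2)[of i s] subring_setD(1)[OF subring_set_lower_ring]
    by (auto simp: base_point_def)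
next
  case (adjacent k)
  then have "k \<in> verts (quiver s)" by (simp add: mutables_def)
  then show ?case
    using lower_ring_generators(3)[OF adjacent] by (simp only: exchange_base_point flip: exchange_eq_binomial)
next
  case (cong f g)
  then show ?case using positive_base_point[OF s] by simp
qed (rule subring_setD[OF subring_set_lower_ring]; assumption)+

lemma cluster_variable_in_isolated_lower_ring:
  assumes s: "positive_seed s" and S: "S \<subseteq> mutables (quiver s)" "isolated_quiver (quiver (freeze S s))"
    and t: "mutation_equivalent s t" "i \<in> verts (quiver t)"
  shows "cluster t i \<in> lower_ring (freeze S s)"
proof -
  let ?V = "verts (quiver s)" and ?b = "arrows (quiver s)"
  from t(1) obtain ks where ks: "set ks \<subseteq> mutables (quiver s)" "t = fold mutate ks s"
    unfolding mutation_equivalent_iff by blast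
  have ksV: "set ks \<subseteq> ?V" using ks(1) by (auto simp: mutables_def)
  have i: "i \<in> ?V" using t(2) mutation_equivalent_verts(1)[OF t(1)] by simp
  have M: "mutables (quiver s) - S \<subseteq> ?V" by (auto simp: mutables_def)
  have iso: "?b i j = 0" if "i \<in> mutables (quiver s) - S" "j \<in> mutables (quiver s) - S" for i j
    using S(2) that unfolding isolated_quiver_def freeze_simps by blast
  have b: "exchange_matrix ?V ?b" using s by (simp add: positive_seed_def is_ice_quiver_iff)
  have "lower_bound (exchange_binomial ?V ?b) (mutables (quiver s) - S) (\<lambda>a. mutate_path ?V ks ?b a i)"
    by (rule cluster_variable_lower_bound[OF finite_verts b M iso ksV])
  from lower_bound_in_lower_ring[OF positive_seed_freeze[OF s S(1)], unfolded freeze_simps, OF this]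
  have "mutate_path ?V ks ?b (base_point (freeze S s)) i \<in> lower_ring (freeze S s)" .
  also have "mutate_path ?V ks ?b (base_point (freeze S s)) i = cluster t i"
    unfolding ks(2) cluster_fold_mutate
    by (rule mutate_path_cong[OF subset_refl ksV _ i]) (simp add: base_point_def freeze_simps)
  finally show ?thesis .
qed

text \<open>
  A minimal element of the well-founded relation given by the arrows, among the vertices with an
  outgoing arrow, has no incoming arrow, as an incoming arrow would start at a smaller such
  vertex.
\<close>

lemma acyclic_quiver_source:
  assumes q: "is_ice_quiver q" and "acyclic_quiver q" "\<not> isolated_quiver q"
  shows "\<exists>i\<in>mutables q. \<exists>j\<in>mutables q. 0 < arrows q i j \<and> (\<forall>l\<in>mutables q. 0 \<le> arrows q i l)"
proof -
  define r where "r = {(i, j). i \<in> mutables q \<and> j \<in> mutables q \<and> arrows q i j > 0}"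
  have skew: "arrows q i j = - arrows q j i" for i j
    using q unfolding is_ice_quiver_def by blast
  have "r \<subseteq> mutables q \<times> mutables q" by (auto simp: r_def)
  then have "finite r"
    by (rule finite_subset) (simp add: mutables_def finite_verts)
  then have wf: "wf r"
    using assms(2) unfolding acyclic_quiver_def r_def[symmetric] by (rule finite_acyclic_wf)
  obtain i j where ij: "i \<in> mutables q" "j \<in> mutables q" "arrows q i j \<noteq> 0"
    using assms(3) unfolding isolated_quiver_def by blast
  have "(i, j) \<in> r \<or> (j, i) \<in> r"
    using ij skew[of i j] unfolding r_def by auto
  then have "\<exists>x. x \<in> Domain r" by blast
  then obtain z where z: "z \<in> Domain r" "\<And>y. (y, z) \<in> r \<Longrightarrow> y \<notin> Domain r"
    using wfE_min[OF wf] by metis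
  then have no: "(y, z) \<notin> r" for y by blast
  from z(1) obtain w where w: "(z, w) \<in> r" by blast
  have "0 \<le> arrows q z l" if "l \<in> mutables q" for l
  proof (rule ccontr)
    assume "\<not> 0 \<le> arrows q z l"
    then have "0 < arrows q l z" using skew[of z l] by linarith
    with w that have "(l, z) \<in> r" by (simp add: r_def)
    with no show False by blast
  qed
  with w show ?thesis unfolding r_def by blast
qed

text \<open>
  Only vertices in \<open>F\<close> have arrows to \<open>i\<close>, so one of the two exchange monomials is a monomial in
  the variables of \<open>F\<close>, and the other one is divisible by \<open>a\<^sub>j\<close>. In the applications \<open>F\<close> is the
  set of frozen vertices, before or after a freezing.
\<close>

lemma source_exchange_relation:
  assumes s: "positive_seed s" and iV: "i \<in> verts (quiver s)" "j \<in> verts (quiver s)"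
    and ij: "0 < arrows (quiver s) i j"
    and F: "F \<subseteq> verts (quiver s)" "\<And>l. l \<in> verts (quiver s) - F \<Longrightarrow> 0 \<le> arrows (quiver s) i l"
    and A: "subring_set A" "cluster s ` verts (quiver s) \<subseteq> A"
  obtains y where "y \<in> A" "cluster s i * cluster (mutate i s) i =
    cluster s j * y + (\<Prod>l\<in>F. cluster s l ^ nat (- arrows (quiver s) i l))"
proof -
  let ?V = "verts (quiver s)" and ?b = "arrows (quiver s)" and ?a = "cluster s"
  define y where "y = ?a j ^ (nat (?b i j) - 1) * (\<Prod>l\<in>?V - {j}. ?a l ^ nat (?b i l))"
  have aA: "?a l ^ n \<in> A" if "l \<in> ?V" for l n
    using A that by (intro subring_set_power) auto
  have "y \<in> A"
    unfolding y_def by (rule subring_setD(4)[OF A(1) aA[OF iV(2)] subring_set_prod[OF A(1) aA]]) auto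
  moreover have "(\<Prod>l\<in>?V. ?a l ^ nat (?b i l)) = ?a j * y"
  proof -
    have "?a j ^ nat (?b i j) = ?a j * ?a j ^ (nat (?b i j) - 1)"
      using ij by (metis Suc_diff_1 power_Suc zero_less_nat_eq)
    then show ?thesis
      unfolding y_def prod.remove[OF finite_verts iV(2)] by simp
  qed
  moreover have "(\<Prod>l\<in>?V. ?a l ^ nat (- ?b i l)) = (\<Prod>l\<in>F. ?a l ^ nat (- ?b i l))"
  proof (rule prod.mono_neutral_right[OF finite_verts F(1)])
    show "\<forall>l\<in>?V - F. ?a l ^ nat (- ?b i l) = 1"
      using F(2) by simp
  qed
  moreover have "?a i * cluster (mutate i s) i =
      (\<Prod>l\<in>?V. ?a l ^ nat (?b i l)) + (\<Prod>l\<in>?V. ?a l ^ nat (- ?b i l))"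
    using positive_seed_nonzero[OF s iV(1)] by (simp add: cluster_mutate exchange_def)
  ultimately show thesis
    using that[of y] by simp
qed

lemma inverse_frozen_monomial_in_lower_ring:
  "inverse (\<Prod>l\<in>frozen (quiver s). cluster s l ^ e l) \<in> lower_ring s"
proof -
  have "(\<Prod>l\<in>frozen (quiver s). inverse (cluster s l) ^ e l) \<in> lower_ring s"
    by (intro subring_set_prod[OF subring_set_lower_ring] subring_set_power[OF subring_set_lower_ring]
        lower_ring_generators(2))
  then show ?thesis
    unfolding power_inverse prod_inversef[unfolded o_def] .
qed

lemma lower_ring_freeze_denominator:
  assumes s: "positive_seed s" and i: "i \<in> mutables (quiver s)" and x: "x \<in> lower_ring (freeze {i} s)"
  shows "\<exists>N :: nat. x * cluster s i ^ N \<in> lower_ring s"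
proof (rule generate_ring_denominator[OF subring_set_lower_ring _ _ x[unfolded lower_ring_def]])
  have iV: "i \<in> verts (quiver s)" using i by (simp add: mutables_def)
  show "cluster s i \<in> lower_ring s" by (rule lower_ring_generators(1)[OF iV])
  fix g assume "g \<in> cluster (freeze {i} s) ` verts (quiver (freeze {i} s)) \<union>
       (\<lambda>l. inverse (cluster (freeze {i} s) l)) ` frozen (quiver (freeze {i} s)) \<union>
       (\<lambda>k. cluster (mutate k (freeze {i} s)) k) ` mutables (quiver (freeze {i} s))"
  then consider "g = inverse (cluster s i)" | "g \<in> lower_ring s"
    unfolding freeze_simps cluster_mutate using lower_ring_generators[of _ s, unfolded cluster_mutate] by blast
  then show "\<exists>N :: nat. g * cluster s i ^ N \<in> lower_ring s"
  proof cases
    case 1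
    then have "g * cluster s i ^ 1 = 1" using positive_seed_nonzero[OF s iV] by simp
    then show ?thesis using subring_setD(1)[OF subring_set_lower_ring] by metis
  next
    case 2
    then show ?thesis by (intro exI[of _ "0::nat"]) simp
  qed
qed

lemma is_ice_quiver_positive_seed: "positive_seed s \<Longrightarrow> is_ice_quiver (quiver s)"
  by (simp add: positive_seed_def)

lemma acyclic_quiver_freeze: "acyclic_quiver (quiver s) \<Longrightarrow> acyclic_quiver (quiver (freeze S s))"
  unfolding acyclic_quiver_def freeze_simps by (erule acyclic_subset) auto

text \<open>
  Induction on the number of mutable vertices. At a source \<open>i\<close> with an arrow to \<open>j\<close>, the element
  lies in the lower bounds of the freezings at \<open>i\<close> and at \<open>j\<close>, so its denominators are powers of
  \<open>a\<^sub>i\<close> as well as of \<open>a\<^sub>j\<close>, and these two variables generate the unit ideal.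
\<close>

lemma lower_ring_eq_Inter_isolated:
  assumes "positive_seed s" "acyclic_quiver (quiver s)"
    and "\<And>S. S \<subseteq> mutables (quiver s) \<Longrightarrow> isolated_quiver (quiver (freeze S s)) \<Longrightarrow> x \<in> lower_ring (freeze S s)"
  shows "x \<in> lower_ring s"
  using assms
proof (induction "card (mutables (quiver s))" arbitrary: s rule: less_induct)
  case less
  note s = less.prems(1)
  show ?case
  proof (cases "isolated_quiver (quiver s)")
    case True
    then show ?thesis using less.prems(3)[of "{}"] by (simp add: freeze_empty)
  next
    case False
    from acyclic_quiver_source[OF is_ice_quiver_positive_seed[OF s] less.prems(2) False]
    obtain i j where ij: "i \<in> mutables (quiver s)" "j \<in> mutables (quiver s)"
      "0 < arrows (quiver s) i j" "\<forall>l\<in>mutables (quiver s). 0 \<le> arrows (quiver s) i l" by blast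
    let ?u = "\<Prod>l\<in>frozen (quiver s). cluster s l ^ nat (- arrows (quiver s) i l)"
    have ijV: "i \<in> verts (quiver s)" "j \<in> verts (quiver s)" using ij by (auto simp: mutables_def)
    have fr: "frozen (quiver s) \<subseteq> verts (quiver s)"
      using s by (simp add: positive_seed_def is_ice_quiver_iff)
    obtain y where y: "y \<in> lower_ring s"
      "cluster s i * cluster (mutate i s) i = cluster s j * y + ?u"
    proof (rule source_exchange_relation[OF s ijV ij(3) fr _ subring_set_lower_ring])
      show "0 \<le> arrows (quiver s) i l" if "l \<in> verts (quiver s) - frozen (quiver s)" for l
        using ij(4) that by (simp add: mutables_def)
      show "cluster s ` verts (quiver s) \<subseteq> lower_ring s" using lower_ring_generators(1) by blast
    qed
    have denom: "\<exists>N :: nat. x * cluster s l ^ N \<in> lower_ring s" if l: "l \<in> mutables (quiver s)" for l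
    proof (rule lower_ring_freeze_denominator[OF s l], rule less.hyps)
      have "finite (mutables (quiver s))" by (simp add: mutables_def finite_verts)
      then show "card (mutables (quiver (freeze {l} s))) < card (mutables (quiver s))"
        unfolding freeze_simps using l by (intro psubset_card_mono) auto
      show "positive_seed (freeze {l} s)" by (rule positive_seed_freeze[OF s]) (use l in simp)
      show "acyclic_quiver (quiver (freeze {l} s))" by (rule acyclic_quiver_freeze[OF less.prems(2)])
      fix S assume S: "S \<subseteq> mutables (quiver (freeze {l} s))"
        "isolated_quiver (quiver (freeze S (freeze {l} s)))"
      show "x \<in> lower_ring (freeze S (freeze {l} s))"
        unfolding freeze_freeze
        by (rule less.prems(3)) (use S l in \<open>auto simp: freeze_freeze freeze_simps(5)\<close>)
    qed
    from denom[OF ij(1)] obtain m :: nat where m: "x * cluster s i ^ m \<in> lower_ring s" ..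
    from denom[OF ij(2)] obtain n :: nat where n: "x * cluster s j ^ n \<in> lower_ring s" ..
    have "cluster s l ^ e \<noteq> 0" if "l \<in> frozen (quiver s)" for l e
      using positive_seed_nonzero[OF s, of l] fr that by auto
    then have u0: "?u \<noteq> 0"
      by (subst prod_zero_iff[OF finite_subset[OF fr finite_verts]]) blast
    note inv_u = inverse_frozen_monomial_in_lower_ring[of s "\<lambda>l. nat (- arrows (quiver s) i l)"]
    show ?thesis
    proof (rule mem_if_comaximal_denominators[OF subring_set_lower_ring _ _ _ _ _ m n])
      show "cluster s i \<in> lower_ring s" "cluster s j \<in> lower_ring s"
        by (rule lower_ring_generators(1)[OF ijV(1)], rule lower_ring_generators(1)[OF ijV(2)])
      show "inverse ?u * cluster (mutate i s) i \<in> lower_ring s"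
        by (rule subring_setD(4)[OF subring_set_lower_ring inv_u lower_ring_generators(3)[OF ij(1)]])
      show "- (inverse ?u * y) \<in> lower_ring s"
        by (intro subring_setD(2)[OF subring_set_lower_ring] subring_setD(4)[OF subring_set_lower_ring inv_u y(1)])
      have "inverse ?u * cluster (mutate i s) i * cluster s i + - (inverse ?u * y) * cluster s j =
          inverse ?u * (cluster s i * cluster (mutate i s) i - cluster s j * y)"
        by (simp add: algebra_simps)
      also have "\<dots> = inverse ?u * ?u" unfolding y(2) by simp
      also have "\<dots> = 1" using u0 by (rule left_inverse)
      finally show "inverse ?u * cluster (mutate i s) i * cluster s i + - (inverse ?u * y) * cluster s j = 1" .
    qed
  qed
qed

text \<open>
  Each cluster variable lies in the lower bound of every isolated freezing, hence in their
  intersection.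
\<close>

theorem cluster_algebra_acyclic:
  assumes s: "positive_seed s" "acyclic_quiver (quiver s)"
  shows "cluster_algebra s = lower_ring s"
proof
  show "cluster_algebra s \<subseteq> lower_ring s"
    unfolding cluster_algebra_def
  proof (rule generate_ring_least[OF subring_set_lower_ring], rule Un_least)
    show "{cluster t i |t i. mutation_equivalent s t \<and> i \<in> verts (quiver t)} \<subseteq> lower_ring s"
    proof clarify
      fix t i assume t: "mutation_equivalent s t" "i \<in> verts (quiver t)"
      show "cluster t i \<in> lower_ring s"
        by (rule lower_ring_eq_Inter_isolated[OF s]) (rule cluster_variable_in_isolated_lower_ring[OF s(1) _ _ t])
    qed
    show "{inverse (cluster s i) |i. i \<in> frozen (quiver s)} \<subseteq> lower_ring s"
      using lower_ring_generators(2) by blast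
  qed
qed (rule lower_ring_subset_cluster_algebra)

text \<open>
  For a newly frozen vertex \<open>k\<close> the adjacent variable is a fraction with denominator \<open>a\<^sub>k\<close>, which
  has become invertible.
\<close>

lemma lower_ring_freeze_mono:
  assumes S: "S \<subseteq> mutables (quiver s)"
  shows "lower_ring s \<subseteq> lower_ring (freeze S s)"
  unfolding lower_ring_def[of s]
proof (rule generate_ring_least[OF subring_set_lower_ring], intro Un_least image_subsetI)
  let ?L = "lower_ring (freeze S s)"
  have gen: "i \<in> verts (quiver s) \<Longrightarrow> cluster s i \<in> ?L"
    "i \<in> frozen (quiver s) \<union> S \<Longrightarrow> inverse (cluster s i) \<in> ?L" for i
    using lower_ring_generators(1,2)[of i "freeze S s"] unfolding freeze_simps by blast+
  show "cluster s i \<in> ?L" if "i \<in> verts (quiver s)" for i by (rule gen(1)[OF that])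
  show "inverse (cluster s i) \<in> ?L" if "i \<in> frozen (quiver s)" for i by (rule gen(2)) (use that in simp)
  show "cluster (mutate k s) k \<in> ?L" if k: "k \<in> mutables (quiver s)" for k
  proof (cases "k \<in> S")
    case True
    have "exchange (verts (quiver s)) (arrows (quiver s)) k (cluster s) \<in> ?L"
      unfolding exchange_def
      by (intro subring_setD(3,4)[OF subring_set_lower_ring] subring_set_prod[OF subring_set_lower_ring]
          subring_set_power[OF subring_set_lower_ring] gen) (use True in auto)
    then show ?thesis by (simp add: cluster_mutate)
  next
    case False
    then show ?thesis
      using lower_ring_generators(3)[of k "freeze S s"] k unfolding cluster_mutate freeze_simps by simp
  qed
qed

lemma cluster_algebra_freeze_subset:
  "cluster_algebra (freeze S s) \<subseteq>
    generate_ring ratfun_ring (cluster_algebra s \<union> (\<lambda>i. inverse (cluster s i)) ` S)" (is "_ \<subseteq> ?R")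
  unfolding cluster_algebra_def[of "freeze S s"]
proof (rule generate_ring_least[OF subring_set_generate_ring], rule Un_least)
  show "{cluster t i |t i. mutation_equivalent (freeze S s) t \<and> i \<in> verts (quiver t)} \<subseteq> ?R"
  proof clarify
    fix t i assume t: "mutation_equivalent (freeze S s) t" "i \<in> verts (quiver t)"
    from t(1) obtain u where "mutation_equivalent s u" "t = freeze S u"
      by (rule mutation_equivalent_freezeE)
    with t(2) have "cluster t i \<in> cluster_algebra s"
      by (simp add: freeze_simps cluster_algebra_generators(1))
    then show "cluster t i \<in> ?R" by (intro generate_ring.incl UnI1)
  qed
  show "{inverse (cluster (freeze S s) i) |i. i \<in> frozen (quiver (freeze S s))} \<subseteq> ?R"
    unfolding freeze_simps using cluster_algebra_generators(2)[of _ s] by (auto intro!: generate_ring.incl)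
qed

text \<open>
  The inclusion that may fail for other seeds is that the freezing contains all cluster variables:
  only those reached by mutations away from \<open>S\<close> are among its generators. Here the cluster
  variables are polynomials in the generators of the lower bound, for which the inclusion is
  visible.
\<close>

lemma cluster_algebra_freeze_acyclic:
  assumes s: "positive_seed s" "acyclic_quiver (quiver s)" and S: "S \<subseteq> mutables (quiver s)"
  shows "cluster_algebra (freeze S s) =
    generate_ring ratfun_ring (cluster_algebra s \<union> (\<lambda>i. inverse (cluster s i)) ` S)"
proof
  show "generate_ring ratfun_ring (cluster_algebra s \<union> (\<lambda>i. inverse (cluster s i)) ` S)
      \<subseteq> cluster_algebra (freeze S s)"
  proof (rule generate_ring_least[OF subring_set_cluster_algebra], rule Un_least)
    show "cluster_algebra s \<subseteq> cluster_algebra (freeze S s)"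
      unfolding cluster_algebra_acyclic[OF s]
      using lower_ring_freeze_mono[OF S] lower_ring_subset_cluster_algebra by blast
    show "(\<lambda>i. inverse (cluster s i)) ` S \<subseteq> cluster_algebra (freeze S s)"
      using cluster_algebra_generators(2)[of _ "freeze S s"] by (auto simp: freeze_simps)
  qed
qed (rule cluster_algebra_freeze_subset)

text \<open>
  All mutable variables outside \<open>P\<close> are frozen. If an arrow were left between mutable vertices,
  the exchange relation at a source would put into \<open>P\<close> a monomial in frozen variables, which are
  units, and in variables outside \<open>P\<close>.
\<close>

lemma acyclic_covered_by_isolated:
  assumes s: "positive_seed s" "acyclic_quiver (quiver s)" and P: "P \<in> Spec (cluster_algebra s)"
  obtains S where "S \<subseteq> mutables (quiver s)" "isolated_quiver (quiver (freeze S s))"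
    "P \<in> Spec_image (cluster_algebra s) (cluster_algebra (freeze S s))"
proof -
  let ?A = "cluster_algebra s"
  define S where "S = {i \<in> mutables (quiver s). cluster s i \<notin> P}"
  have S: "S \<subseteq> mutables (quiver s)" by (auto simp: S_def)
  have P0: "P \<subseteq> ?A" and P1: "1 \<notin> P"
    and Padd: "\<And>x y. x \<in> P \<Longrightarrow> y \<in> P \<Longrightarrow> x + y \<in> P"
    and Pmult: "\<And>x y. x \<in> ?A \<Longrightarrow> y \<in> P \<Longrightarrow> x * y \<in> P"
    and Pprime: "\<And>x y. x \<in> ?A \<Longrightarrow> y \<in> ?A \<Longrightarrow> x * y \<in> P \<Longrightarrow> x \<in> P \<or> y \<in> P"
    using P unfolding Spec_iff[OF subring_set_cluster_algebra] by (elim conjE, blast)+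
  have clA: "cluster s i \<in> ?A" if "i \<in> verts (quiver s)" for i
    by (rule cluster_algebra_generators(1)[OF mutation_equivalent_refl that])
  have power: "x ^ n \<notin> P" if "x \<in> ?A" "x \<notin> P" for x and n :: nat
  proof (induction n)
    case (Suc n)
    then show ?case
      using Pprime[OF that(1) subring_set_power[OF subring_set_cluster_algebra that(1), of n]] that(2) by auto
  qed (simp add: P1)
  have prod: "(\<Prod>i\<in>I. cluster s i ^ e i) \<notin> P"
    if "I \<subseteq> verts (quiver s)" "\<And>i. i \<in> I \<Longrightarrow> cluster s i \<notin> P" for I and e :: "nat \<Rightarrow> nat"
  proof -
    have "finite I" using that(1) finite_verts finite_subset by blast
    then show ?thesis
      using that
    proof (induction I)
      case (insert i I)
      have i: "cluster s i \<in> ?A" "cluster s i \<notin> P"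
        using insert.prems by (auto intro: clA)
      have "cluster s i ^ e i \<notin> P" "cluster s i ^ e i \<in> ?A"
        by (rule power[OF i], rule subring_set_power[OF subring_set_cluster_algebra i(1)])
      moreover have "(\<Prod>i\<in>I. cluster s i ^ e i) \<in> ?A"
        using insert.prems clA
        by (intro subring_set_prod[OF subring_set_cluster_algebra] subring_set_power[OF subring_set_cluster_algebra]) auto
      moreover have "(\<Prod>i\<in>I. cluster s i ^ e i) \<notin> P"
        using insert.prems by (intro insert.IH) auto
      ultimately show ?case
        unfolding prod.insert[OF insert.hyps(1,2)]
        using Pprime[of "cluster s i ^ e i" "\<Prod>i\<in>I. cluster s i ^ e i"] by blast
    qed (simp add: P1)
  qed
  have fr: "frozen (quiver s) \<subseteq> verts (quiver s)"
    using s(1) by (simp add: positive_seed_def is_ice_quiver_iff)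
  have frozen_notin: "cluster s i \<notin> P" if "i \<in> frozen (quiver s)" for i
  proof
    assume "cluster s i \<in> P"
    then have "inverse (cluster s i) * cluster s i \<in> P"
      by (rule Pmult[OF cluster_algebra_generators(2)[OF that]])
    moreover have "cluster s i \<noteq> 0" using positive_seed_nonzero[OF s(1)] fr that by blast
    ultimately show False using P1 by simp
  qed
  have iso: "isolated_quiver (quiver (freeze S s))"
  proof (rule ccontr)
    assume "\<not> isolated_quiver (quiver (freeze S s))"
    then obtain i j where ij: "i \<in> mutables (quiver (freeze S s))" "j \<in> mutables (quiver (freeze S s))"
      "0 < arrows (quiver (freeze S s)) i j"
      "\<forall>l\<in>mutables (quiver (freeze S s)). 0 \<le> arrows (quiver (freeze S s)) i l"
      using acyclic_quiver_source[OF is_ice_quiver_positive_seed[OF positive_seed_freeze[OF s(1) S]]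
          acyclic_quiver_freeze[OF s(2)]] by blast
    let ?u = "\<Prod>l\<in>frozen (quiver s) \<union> S. cluster s l ^ nat (- arrows (quiver s) i l)"
    have V: "i \<in> verts (quiver s)" "j \<in> verts (quiver s)" "frozen (quiver s) \<union> S \<subseteq> verts (quiver s)"
      using ij(1,2) fr S unfolding freeze_simps mutables_def by auto
    obtain y where y: "y \<in> ?A" "cluster s i * cluster (mutate i s) i = cluster s j * y + ?u"
    proof (rule source_exchange_relation[OF s(1) V(1,2) ij(3)[unfolded freeze_simps] V(3) _ subring_set_cluster_algebra])
      show "0 \<le> arrows (quiver s) i l" if "l \<in> verts (quiver s) - (frozen (quiver s) \<union> S)" for l
        using ij(4) that unfolding freeze_simps by (simp add: mutables_def)
      show "cluster s ` verts (quiver s) \<subseteq> ?A" using clA by blast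
    qed
    have ijP: "cluster s i \<in> P" "cluster s j \<in> P" and i: "i \<in> mutables (quiver s)"
      using ij(1,2) unfolding freeze_simps S_def by blast+
    have "cluster (mutate i s) i \<in> ?A"
      using lower_ring_generators(3)[OF i] lower_ring_subset_cluster_algebra by blast
    then have "cluster (mutate i s) i * cluster s i + (- y) * cluster s j \<in> P"
      using y(1) subring_setD(2)[OF subring_set_cluster_algebra] ijP by (intro Padd Pmult) auto
    also have "cluster (mutate i s) i * cluster s i + (- y) * cluster s j = ?u"
      using y(2) by (simp add: algebra_simps)
    finally have "?u \<in> P" .
    moreover have "?u \<notin> P"
      using fr S frozen_notin by (intro prod) (auto simp: S_def mutables_def)
    ultimately show False by blast
  qed
  let ?B = "cluster_algebra (freeze S s)" and ?d = "\<Prod>i\<in>S. cluster s i ^ 1"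
  have SV: "S \<subseteq> verts (quiver s)" using S by (auto simp: mutables_def)
  have finS: "finite S" using SV finite_verts finite_subset by blast
  note chart = cluster_algebra_freeze_acyclic[OF s S]
  have dA: "?d \<in> ?A"
    using SV clA by (intro subring_set_prod[OF subring_set_cluster_algebra]) auto
  have "P \<in> Spec_image ?A ?B"
  proof (rule Spec_image_localization[OF subring_set_cluster_algebra subring_set_cluster_algebra _ dA _ _ P])
    show "?A \<subseteq> ?B" unfolding chart by (intro subsetI generate_ring.incl UnI1)
    have "inverse ?d = (\<Prod>i\<in>S. inverse (cluster s i))"
      by (simp add: prod_inversef[unfolded o_def])
    also have "\<dots> \<in> ?B"
      unfolding chart
      by (intro subring_set_prod[OF subring_set_generate_ring] generate_ring.incl UnI2 imageI)
    finally show "inverse ?d \<in> ?B" .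
    show "?d \<notin> P" by (rule prod[OF SV]) (simp add: S_def)
    fix x assume "x \<in> ?B"
    then have x: "x \<in> generate_ring ratfun_ring (?A \<union> (\<lambda>i. inverse (cluster s i)) ` S)"
      unfolding chart .
    show "\<exists>N :: nat. x * ?d ^ N \<in> ?A"
    proof (rule generate_ring_denominator[OF subring_set_cluster_algebra dA _ x])
      fix g assume "g \<in> ?A \<union> (\<lambda>i. inverse (cluster s i)) ` S"
      then consider "g \<in> ?A" | i where "i \<in> S" "g = inverse (cluster s i)" by blast
      then show "\<exists>N :: nat. g * ?d ^ N \<in> ?A"
      proof cases
        case 1
        then show ?thesis by (intro exI[of _ "0::nat"]) simp
      next
        case (2 i)
        have "cluster s i \<noteq> 0" using positive_seed_nonzero[OF s(1)] 2(1) SV by blast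
        then have "g * ?d ^ 1 = (\<Prod>l\<in>S - {i}. cluster s l)"
          using prod.remove[OF finS 2(1), of "cluster s"] by (simp add: 2(2))
        also have "\<dots> \<in> ?A"
          using SV clA by (intro subring_set_prod[OF subring_set_cluster_algebra]) auto
        finally show ?thesis by blast
      qed
    qed
  qed
  then show thesis by (rule that[OF S iso])
qed

section \<open>Comparison of the types of quivers\<close>

text \<open>
  A directed cycle of minimal length visits distinct vertices and has at least three of them,
  since there are no loops and no 2-cycles. The components are disjoint, so consecutive edges of
  the cycle lie in the same component.
\<close>

lemma acyclic_if_components_have_no_cycle:
  assumes q: "is_ice_quiver q" and G: "disjoint_union_of P G" "mutable_orientation q G"
    and P: "\<And>H. P H \<Longrightarrow> is_graph H" "\<And>H vs. P H \<Longrightarrow> \<not> graph_cycle H vs"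
  shows "acyclic_quiver q"
proof (rule ccontr)
  define r where "r = {(i, j). i \<in> mutables q \<and> j \<in> mutables q \<and> arrows q i j > 0}"
  from G(1) obtain \<G> where \<G>_all: "\<forall>H\<in>\<G>. P H" and \<G>_disj: "disjoint_family_on fst \<G>"
    and G_eq: "G = (\<Union>(fst ` \<G>), \<Union>(snd ` \<G>))"
    unfolding disjoint_union_of_def by blast
  from \<G>_all have "\<And>H. H \<in> \<G> \<Longrightarrow> P H" by blast
  moreover from G_eq have "snd G = \<Union>(snd ` \<G>)" by simp
  moreover note \<G>_disj
  ultimately have \<G>: "\<And>H. H \<in> \<G> \<Longrightarrow> P H" "disjoint_family_on fst \<G>"
    "snd G = \<Union>(snd ` \<G>)" by blast+
  assume "\<not> acyclic_quiver q"
  then obtain x where "(x, x) \<in> r\<^sup>+"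
    unfolding acyclic_quiver_def acyclic_def r_def[symmetric] by blast
  then have ex: "\<exists>n x. 0 < n \<and> (x, x) \<in> r ^^ n"
    by (auto simp: trancl_power)
  define n where "n = (LEAST n. \<exists>x. 0 < n \<and> (x, x) \<in> r ^^ n)"
  have n: "\<exists>x. 0 < n \<and> (x, x) \<in> r ^^ n"
    unfolding n_def by (rule LeastI_ex[OF ex])
  have n_min: "n \<le> m" if "0 < m" "(x, x) \<in> r ^^ m" for m x
    unfolding n_def by (rule Least_le) (use that in blast)
  from n obtain f where f: "0 < n" "f n = f 0" "\<And>i. i < n \<Longrightarrow> (f i, f (Suc i)) \<in> r"
    unfolding relpow_fun_conv by metis
  have skew: "arrows q i j = - arrows q j i" for i j
    using q unfolding is_ice_quiver_def by blast
  have asym: "(j, i) \<notin> r" if "(i, j) \<in> r" for i j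
  proof -
    have "0 < arrows q i j" using that by (simp add: r_def)
    then have "\<not> 0 < arrows q j i" using skew[of i j] by linarith
    then show ?thesis by (simp add: r_def)
  qed
  have "n \<noteq> 1"
    using f(2) f(3)[of 0] asym by fastforce
  moreover have "n \<noteq> 2"
    using f(2) f(3)[of 0] f(3)[of 1] asym by (fastforce simp: numeral_2_eq_2)
  ultimately have n3: "3 \<le> n" using f(1) by linarith
  have "f i \<noteq> f j" if ij: "i < j" "j < n" for i j
  proof
    assume "f i = f j"
    then have "(f i, f i) \<in> r ^^ (j - i)"
      unfolding relpow_fun_conv using f(3) ij
      by (intro exI[of _ "\<lambda>l. f (i + l)"]) auto
    with n_min[of "j - i"] ij f(1) show False by fastforce
  qed
  then have inj: "inj_on f {..<n}"
    by (intro linorder_inj_onI) auto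
  have edge: "\<exists>H\<in>\<G>. {f i, f (Suc i)} \<in> snd H" if "i < n" for i
  proof -
    have "\<bar>arrows q (f i) (f (Suc i))\<bar> \<noteq> 0" "f i \<in> mutables q" "f (Suc i) \<in> mutables q"
      using f(3)[OF that] by (auto simp: r_def)
    then have "{f i, f (Suc i)} \<in> snd G"
      using G(2) unfolding mutable_orientation_def by metis
    then show ?thesis using \<G>(3) by auto
  qed
  have sub: "e \<subseteq> fst H" if "e \<in> snd H" "H \<in> \<G>" for e H
    using P(1)[OF \<G>(1)[OF that(2)]] that(1) unfolding is_graph_def by (auto simp: case_prod_beta)
  obtain H where H: "H \<in> \<G>" "{f 0, f 1} \<in> snd H"
    using edge[of 0] f(1) by auto
  have comp: "{f i, f (Suc i)} \<in> snd H" if "i < n" for i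
    using that
  proof (induction i)
    case 0
    then show ?case using H by simp
  next
    case (Suc i)
    obtain H' where H': "H' \<in> \<G>" "{f (Suc i), f (Suc (Suc i))} \<in> snd H'"
      using edge[OF Suc.prems] by blast
    have "f (Suc i) \<in> fst H \<inter> fst H'"
      using sub[OF H'(2,1)] sub[OF _ H(1)] Suc by auto
    then have "H = H'"
      using \<G>(2) H(1) H'(1) unfolding disjoint_family_on_def by blast
    then show ?case using H' by simp
  qed
  have "graph_cycle H (map f [0..<n])"
    unfolding graph_cycle_def case_prod_beta
  proof (intro conjI allI impI)
    show "{last (map f [0..<n]), hd (map f [0..<n])} \<in> snd H"
      using comp[of "n - 1"] f(1,2) by (simp add: last_map hd_map)
  qed (use n3 inj comp in \<open>auto simp: distinct_map atLeast0LessThan\<close>)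
  with P(2)[OF \<G>(1)[OF H(1)]] show False by blast
qed

text \<open>
  The largest vertex of a cycle would have two different smaller neighbours.
\<close>

lemma no_cycle_if_unique_lower_neighbour:
  fixes E :: "nat set set"
  assumes "\<And>u v w. {u, v} \<in> E \<Longrightarrow> {w, v} \<in> E \<Longrightarrow> u < v \<Longrightarrow> w < v \<Longrightarrow> u = w"
  shows "\<not> graph_cycle (V, E) vs"
proof
  assume "graph_cycle (V, E) vs"
  define n where "n = length vs"
  from \<open>graph_cycle (V, E) vs\<close> have vs: "3 \<le> n" "distinct vs"
    "\<And>i. Suc i < n \<Longrightarrow> {vs ! i, vs ! Suc i} \<in> E" "{last vs, hd vs} \<in> E"
    by (auto simp: graph_cycle_def n_def)
  define next_pos where "next_pos i = (if Suc i = n then 0 else Suc i)" for i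
  have edge: "{vs ! i, vs ! next_pos i} \<in> E" if "i < n" for i
  proof (cases "Suc i = n")
    case True
    then have "vs \<noteq> []" "i = length vs - 1" by (auto simp: n_def)
    then have "last vs = vs ! i" "hd vs = vs ! 0"
      by (simp_all add: last_conv_nth hd_conv_nth)
    with vs(4) True show ?thesis by (simp add: next_pos_def)
  next
    case False
    with that vs(3)[of i] show ?thesis by (simp add: next_pos_def)
  qed
  obtain m where m: "m < n" "vs ! m = Max (set vs)"
    using Max_in[of "set vs"] vs(1) by (metis List.finite_set in_set_conv_nth list.size(3) n_def
        not_numeral_le_zero set_empty)
  have less: "vs ! i < vs ! m" if "i < n" "i \<noteq> m" for i
  proof -
    have "vs ! i \<le> vs ! m" unfolding m(2) using that(1) by (intro Max_ge) (auto simp: n_def)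
    moreover have "vs ! i \<noteq> vs ! m"
      using that m(1) vs(2) by (simp add: nth_eq_iff_index_eq n_def)
    ultimately show ?thesis by simp
  qed
  define l where "l = (if m = 0 then n - 1 else m - 1)"
  have l: "l < n" "l \<noteq> m" "next_pos l = m" "next_pos m < n" "next_pos m \<noteq> m" "next_pos m \<noteq> l"
    using m(1) vs(1) by (auto simp: l_def next_pos_def)
  have "vs ! l = vs ! next_pos m"
    using assms[of "vs ! l" "vs ! m" "vs ! next_pos m"] edge[OF l(1)] edge[OF m(1)] less l
    by (simp add: insert_commute)
  then show False
    using l vs(2) by (simp add: nth_eq_iff_index_eq n_def)
qed

lemma graph_cycle_isomorphic:
  assumes "is_graph G" "graph_isomorphic G H" "graph_cycle G vs"
  shows "\<exists>ws. graph_cycle H ws"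
proof -
  obtain f where f: "bij_betw f (fst G) (fst H)" "(\<lambda>e. f ` e) ` snd G = snd H"
    using assms(2) unfolding graph_isomorphic_def by blast
  from assms(3) have vs: "3 \<le> length vs" "distinct vs"
    "\<And>i. Suc i < length vs \<Longrightarrow> {vs ! i, vs ! Suc i} \<in> snd G" "{last vs, hd vs} \<in> snd G"
    by (auto simp: graph_cycle_def case_prod_beta)
  have img: "{f u, f v} \<in> snd H" if "{u, v} \<in> snd G" for u v
  proof -
    have "f ` {u, v} \<in> snd H" unfolding f(2)[symmetric] using that by (rule imageI)
    then show ?thesis by simp
  qed
  have sub: "e \<subseteq> fst G" if "e \<in> snd G" for e
    using assms(1) that unfolding is_graph_def by (auto simp: case_prod_beta)
  have "set vs \<subseteq> fst G"
  proof
    fix v assume "v \<in> set vs"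
    then obtain i where i: "i < length vs" "v = vs ! i" by (metis in_set_conv_nth)
    show "v \<in> fst G"
    proof (cases "Suc i < length vs")
      case True
      then show ?thesis using sub[OF vs(3)[OF True]] i by simp
    next
      case False
      with i have "i = length vs - 1" "vs \<noteq> []" by auto
      then have "v = last vs" using i by (simp add: last_conv_nth)
      then show ?thesis using sub[OF vs(4)] by simp
    qed
  qed
  then have "distinct (map f vs)"
    using vs(2) f(1) by (auto simp: distinct_map bij_betw_def intro: inj_on_subset)
  moreover have "vs \<noteq> []" using vs(1) by auto
  ultimately have "graph_cycle H (map f vs)"
    unfolding graph_cycle_def case_prod_beta
    using vs img by (auto simp: last_map hd_map)
  then show ?thesis ..
qed

lemma dynkin_diagram_no_cycle:
  assumes "is_dynkin_diagram H"
  shows "\<not> graph_cycle H vs"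
proof
  assume cyc: "graph_cycle H vs"
  have A: "\<not> graph_cycle (dynkin_A n) ws" for n ws
    unfolding dynkin_A_def
    by (rule no_cycle_if_unique_lower_neighbour) (auto simp: path_edges_def doubleton_eq_iff)
  have D: "\<not> graph_cycle (dynkin_D n) ws" if "4 \<le> n" for n ws
    unfolding dynkin_D_def
    by (rule no_cycle_if_unique_lower_neighbour)
      (use that in \<open>auto simp: path_edges_def doubleton_eq_iff\<close>)
  have E: "\<not> graph_cycle (dynkin_E n) ws" if "n \<in> {6, 7, 8}" for n ws
    unfolding dynkin_E_def
    by (rule no_cycle_if_unique_lower_neighbour)
      (use that in \<open>auto simp: path_edges_def doubleton_eq_iff\<close>)
  show False
    using assms graph_cycle_isomorphic[OF _ _ cyc] A D E unfolding is_dynkin_diagram_def by blast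
qed

lemma tree_type_imp_acyclic:
  assumes "is_ice_quiver q" "tree_type_quiver q"
  shows "acyclic_quiver q"
proof -
  from assms(2) obtain G where "disjoint_union_of is_tree G" "mutable_orientation q G"
    unfolding tree_type_quiver_def by blast
  then show ?thesis
    by (rule acyclic_if_components_have_no_cycle[OF assms(1)]) (auto simp: is_tree_def)
qed

lemma finite_type_imp_acyclic:
  assumes "is_ice_quiver q" "finite_type_quiver q"
  shows "acyclic_quiver q"
proof -
  from assms(2) obtain G where "disjoint_union_of is_dynkin_diagram G" "mutable_orientation q G"
    unfolding finite_type_quiver_def by blast
  then show ?thesis
    by (rule acyclic_if_components_have_no_cycle[OF assms(1)])
      (auto simp: dynkin_diagram_no_cycle is_dynkin_diagram_def)
qed

lemma A_type_imp_finite_type: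
  assumes "A_type_quiver q"
  shows "finite_type_quiver q"
proof -
  have "is_dynkin_diagram H" if "is_A_diagram H" for H
    using that unfolding is_A_diagram_def is_dynkin_diagram_def by blast
  then show ?thesis
    using assms unfolding A_type_quiver_def finite_type_quiver_def disjoint_union_of_def by blast
qed

lemma isolated_orientation:
  assumes "isolated_quiver q" "\<And>i. P ({i}, {})"
  shows "\<exists>G. disjoint_union_of P G \<and> mutable_orientation q G"
proof (intro exI conjI)
  show "mutable_orientation q (mutables q, {})"
    using assms(1) by (auto simp: mutable_orientation_def isolated_quiver_def)
  show "disjoint_union_of P (mutables q, {})"
    unfolding disjoint_union_of_def
    by (rule exI[of _ "(\<lambda>i. ({i}, {})) ` mutables q"])
      (use assms(2) in \<open>auto simp: disjoint_family_on_def\<close>)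
qed

lemma isolated_imp_A_type: "isolated_quiver q \<Longrightarrow> A_type_quiver q"
  unfolding A_type_quiver_def
proof (rule isolated_orientation)
  fix i :: nat
  have "graph_isomorphic ({i}, {}) (dynkin_A 1)"
    unfolding graph_isomorphic_def dynkin_A_def path_edges_def
    by (rule exI[of _ "\<lambda>_. 1"]) (auto simp: bij_betw_def)
  then show "is_A_diagram ({i}, {})"
    by (auto simp: is_A_diagram_def is_graph_def)
qed

lemma isolated_imp_tree_type: "isolated_quiver q \<Longrightarrow> tree_type_quiver q"
  unfolding tree_type_quiver_def
  by (rule isolated_orientation) (auto simp: is_tree_def is_graph_def graph_connected_def graph_cycle_def)

section \<open>Algebraic independence gives positivity\<close>

definition mono_eval :: "(nat \<Rightarrow> ratfun) \<Rightarrow> (nat \<Rightarrow>\<^sub>0 nat) \<Rightarrow> ratfun" where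
  "mono_eval a m = (\<Prod>i\<in>Poly_Mapping.keys m. a i ^ Poly_Mapping.lookup m i)"

lemma mono_eval_superset:
  "finite I \<Longrightarrow> Poly_Mapping.keys m \<subseteq> I \<Longrightarrow> mono_eval a m = (\<Prod>i\<in>I. a i ^ Poly_Mapping.lookup m i)"
  unfolding mono_eval_def by (rule prod.mono_neutral_left) (auto simp: in_keys_iff)

lemma mono_eval_add: "mono_eval a (m + n) = mono_eval a m * mono_eval a n"
proof -
  let ?I = "Poly_Mapping.keys m \<union> Poly_Mapping.keys n"
  have "mono_eval a (m + n) = (\<Prod>i\<in>?I. a i ^ Poly_Mapping.lookup (m + n) i)"
    by (rule mono_eval_superset) (use Poly_Mapping.keys_add[of m n] in auto)
  also have "\<dots> = (\<Prod>i\<in>?I. a i ^ Poly_Mapping.lookup m i) * (\<Prod>i\<in>?I. a i ^ Poly_Mapping.lookup n i)"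
    by (simp add: lookup_add power_add prod.distrib)
  also have "\<dots> = mono_eval a m * mono_eval a n"
    by (simp add: mono_eval_superset[of ?I m] mono_eval_superset[of ?I n])
  finally show ?thesis .
qed

definition sum_of_monomials :: "nat set \<Rightarrow> (nat \<Rightarrow> ratfun) \<Rightarrow> ratfun set" where
  "sum_of_monomials V a = {\<Sum>m\<leftarrow>ms. mono_eval a m | ms. ms \<noteq> [] \<and> (\<forall>m\<in>set ms. Poly_Mapping.keys m \<subseteq> V)}"

lemma sum_of_monomialsI:
  "ms \<noteq> [] \<Longrightarrow> (\<And>m. m \<in> set ms \<Longrightarrow> Poly_Mapping.keys m \<subseteq> V) \<Longrightarrow>
    (\<Sum>m\<leftarrow>ms. mono_eval a m) \<in> sum_of_monomials V a"
  unfolding sum_of_monomials_def by blast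

lemma sum_of_monomials_add:
  assumes "x \<in> sum_of_monomials V a" "y \<in> sum_of_monomials V a"
  shows "x + y \<in> sum_of_monomials V a"
proof -
  obtain ms ns where "x = (\<Sum>m\<leftarrow>ms. mono_eval a m)" "ms \<noteq> []" "\<forall>m\<in>set ms. Poly_Mapping.keys m \<subseteq> V"
    "y = (\<Sum>m\<leftarrow>ns. mono_eval a m)" "ns \<noteq> []" "\<forall>m\<in>set ns. Poly_Mapping.keys m \<subseteq> V"
    using assms unfolding sum_of_monomials_def by blast
  then show ?thesis
    using sum_of_monomialsI[of "ms @ ns" V a] by auto
qed

lemma sum_of_monomials_mult:
  assumes "x \<in> sum_of_monomials V a" "y \<in> sum_of_monomials V a"
  shows "x * y \<in> sum_of_monomials V a"
proof -
  obtain ms ns where x: "x = (\<Sum>m\<leftarrow>ms. mono_eval a m)" "ms \<noteq> []" "\<forall>m\<in>set ms. Poly_Mapping.keys m \<subseteq> V"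
    and y: "y = (\<Sum>m\<leftarrow>ns. mono_eval a m)" "ns \<noteq> []" "\<forall>m\<in>set ns. Poly_Mapping.keys m \<subseteq> V"
    using assms unfolding sum_of_monomials_def by blast
  have shift: "(\<Sum>n\<leftarrow>map ((+) m) ns. mono_eval a n) = mono_eval a m * y"
    "map ((+) m) ns \<noteq> []" for m
    using y(2) unfolding y(1) by (simp_all add: mono_eval_add o_def sum_list_const_mult)
  have keys: "Poly_Mapping.keys (m + n) \<subseteq> V" if "m \<in> set ms" "n \<in> set ns" for m n
    using Poly_Mapping.keys_add[of m n] x(3) y(3) that by blast
  have "mono_eval a m * y \<in> sum_of_monomials V a" if "m \<in> set ms" for m
    unfolding shift(1)[symmetric] by (rule sum_of_monomialsI[OF shift(2)]) (use keys[OF that] in auto)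
  then have "(\<Sum>m\<leftarrow>ms. mono_eval a m * y) \<in> sum_of_monomials V a"
    using x(2)
  proof (induction ms)
    case (Cons m ms)
    then show ?case by (cases "ms = []") (auto intro!: sum_of_monomials_add)
  qed simp
  then show ?thesis
    unfolding x(1) by (simp add: sum_list_mult_const)
qed

lemma mpoly_eval_superset:
  "finite M \<Longrightarrow> Poly_Mapping.keys p \<subseteq> M \<Longrightarrow>
    mpoly_eval a p = (\<Sum>m\<in>M. rconst (Poly_Mapping.lookup p m) * mono_eval a m)"
  unfolding mpoly_eval_def mono_eval_def[symmetric]
  by (rule sum.mono_neutral_left)
    (auto simp: in_keys_iff rconst_def Zero_fract_def[symmetric] simp del: Zero_fract_def)

lemma rconst_of_nat: "rconst (of_nat n) = of_nat n"
proof (induction n)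
  case 0
  show ?case by (simp add: rconst_def Zero_fract_def)
next
  case (Suc n)
  have "rconst (of_nat (Suc n)) = rconst 1 + rconst (of_nat n)"
    by (simp add: rconst_def single_add)
  then show ?case by (simp add: Suc.IH) (simp add: rconst_def One_fract_def)
qed

lemma sum_list_map_eq_sum_of_nat_count:
  fixes f :: "'a \<Rightarrow> 'b::comm_semiring_1"
  assumes "finite A" "set xs \<subseteq> A"
  shows "(\<Sum>x\<leftarrow>xs. f x) = (\<Sum>x\<in>A. of_nat (count_list xs x) * f x)"
  using assms(2)
proof (induction xs)
  case (Cons y xs)
  have "(\<Sum>x\<in>A. of_nat (count_list (y # xs) x) * f x) =
      (\<Sum>x\<in>A. (if x = y then f x else 0) + of_nat (count_list xs x) * f x)"
    by (intro sum.cong refl) (auto simp: algebra_simps)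
  then show ?case
    using Cons assms(1) by (simp add: sum.distrib)
qed simp

text \<open>
  There is no cancellation: the coefficients of the underlying polynomial are multiplicities, so
  it is nonzero, and algebraic independence applies.
\<close>

lemma sum_of_monomials_nonzero:
  assumes a: "algebraically_independent n a" and x: "x \<in> sum_of_monomials {1..n} a"
  shows "x \<noteq> 0"
proof
  assume "x = 0"
  obtain ms where ms: "x = (\<Sum>m\<leftarrow>ms. mono_eval a m)" "ms \<noteq> []"
    "\<forall>m\<in>set ms. Poly_Mapping.keys m \<subseteq> {1..n}"
    using x unfolding sum_of_monomials_def by blast
  define p :: mpoly where "p = (\<Sum>m\<in>set ms. Poly_Mapping.single m (of_nat (count_list ms m)))"
  have lookup: "Poly_Mapping.lookup p m = of_nat (count_list ms m)" for m
  proof -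
    have "Poly_Mapping.lookup p m = (\<Sum>k\<in>set ms. if k = m then of_nat (count_list ms k) else 0)"
      unfolding p_def lookup_sum by (intro sum.cong refl) (auto simp: lookup_single when_def)
    then show ?thesis by (simp add: count_list_0_iff)
  qed
  have keys: "Poly_Mapping.keys p = set ms"
    by (auto simp: in_keys_iff lookup count_list_0_iff)
  have "mpoly_eval a p = (\<Sum>m\<in>set ms. of_nat (count_list ms m) * mono_eval a m)"
    by (simp add: mpoly_eval_superset[of "set ms"] keys lookup rconst_of_nat)
  also have "\<dots> = x"
    unfolding ms(1) by (rule sum_list_map_eq_sum_of_nat_count[symmetric]) auto
  finally have "mpoly_eval a p = 0" using \<open>x = 0\<close> by simp
  then have "p = 0"
    using a ms(3) keys unfolding algebraically_independent_def by blast
  with keys ms(2) show False by simp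
qed

lemma algebraically_independent_positive:
  assumes a: "algebraically_independent n a"
  shows "\<exists>C. positive_cone C \<and> a ` {1..n} \<subseteq> C"
proof -
  let ?S = "sum_of_monomials {1..n} a"
  let ?C = "{u / v | u v. u \<in> ?S \<and> v \<in> ?S}"
  note nz = sum_of_monomials_nonzero[OF a]
  have one: "1 \<in> ?S"
    using sum_of_monomialsI[of "[0]" "{1..n}" a] by (simp add: mono_eval_def)
  have var: "a i \<in> ?S" if "i \<in> {1..n}" for i
    using sum_of_monomialsI[of "[Poly_Mapping.single i 1]" "{1..n}" a] that by (simp add: mono_eval_def)
  have incl: "u \<in> ?C" if "u \<in> ?S" for u
  proof -
    have "u = u / 1" by simp
    then show ?thesis using that one by blast
  qed
  have "positive_cone ?C"
    unfolding positive_cone_def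
  proof (intro conjI ballI)
    show "1 \<in> ?C" by (rule incl[OF one])
    show "0 \<notin> ?C"
    proof
      assume "0 \<in> ?C"
      then obtain u v where "0 = u / v" "u \<in> ?S" "v \<in> ?S" by blast
      then show False using nz[of u] nz[of v] by simp
    qed
  next
    fix x y assume "x \<in> ?C" "y \<in> ?C"
    then obtain u v u' v' where uv: "x = u / v" "u \<in> ?S" "v \<in> ?S" "y = u' / v'" "u' \<in> ?S" "v' \<in> ?S" by blast
    have "x + y = (u * v' + u' * v) / (v * v')"
      using nz[OF uv(3)] nz[OF uv(6)] by (simp add: uv add_frac_eq)
    then show "x + y \<in> ?C"
      using sum_of_monomials_add sum_of_monomials_mult uv by blast
    have "x * y = (u * u') / (v * v')" by (simp add: uv)
    then show "x * y \<in> ?C" using sum_of_monomials_mult uv by blast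
  next
    fix x assume "x \<in> ?C"
    then obtain u v where uv: "x = u / v" "u \<in> ?S" "v \<in> ?S" by blast
    then have "inverse x = v / u" by simp
    with uv show "inverse x \<in> ?C" by blast
  qed
  moreover have "a ` {1..n} \<subseteq> ?C" using var incl by blast
  ultimately show ?thesis by blast
qed

lemma is_seed_positive: "is_seed s \<Longrightarrow> positive_seed s"
  using algebraically_independent_positive
  unfolding is_seed_def positive_seed_def verts_def by blast


section \<open>Locally acyclic cluster algebras\<close>

lemma cluster_algebra_equivalent:
  assumes s: "positive_seed s" and st: "mutation_equivalent s t"
  shows "cluster_algebra t = cluster_algebra s"
proof -
  have "mutation_equivalent s u \<longleftrightarrow> mutation_equivalent t u" for u
    using st positive_seed_equivalent(2)[OF s st] mutation_equivalent_trans by blast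
  moreover have "cluster t i = cluster s i" if "i \<in> frozen (quiver s)" for i
    by (rule mutation_equivalent_cluster_fixed[OF st]) (use that in \<open>simp add: mutables_def\<close>)
  then have "{inverse (cluster t i) |i. i \<in> frozen (quiver t)} = {inverse (cluster s i) |i. i \<in> frozen (quiver s)}"
    unfolding mutation_equivalent_verts(3)[OF st] by (metis (no_types, lifting))
  ultimately show ?thesis
    unfolding cluster_algebra_def by simp
qed

lemma generate_ring_adjoin_twice:
  "generate_ring ratfun_ring (generate_ring ratfun_ring (A \<union> S) \<union> T) = generate_ring ratfun_ring (A \<union> (S \<union> T))"
proof
  show "generate_ring ratfun_ring (generate_ring ratfun_ring (A \<union> S) \<union> T) \<subseteq> generate_ring ratfun_ring (A \<union> (S \<union> T))"
  proof (rule generate_ring_least[OF subring_set_generate_ring], rule Un_least)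
    show "generate_ring ratfun_ring (A \<union> S) \<subseteq> generate_ring ratfun_ring (A \<union> (S \<union> T))"
      by (rule generate_ring_least[OF subring_set_generate_ring]) (auto intro: generate_ring.incl)
  qed (auto intro: generate_ring.incl)
  show "generate_ring ratfun_ring (A \<union> (S \<union> T)) \<subseteq> generate_ring ratfun_ring (generate_ring ratfun_ring (A \<union> S) \<union> T)"
    by (rule generate_ring_least[OF subring_set_generate_ring]) (auto intro!: generate_ring.incl)
qed

lemma cluster_chart_subset:
  "cluster_chart s t S \<Longrightarrow> cluster_algebra s \<subseteq> cluster_algebra (freeze S t)"
  unfolding cluster_chart_def by (auto intro: generate_ring.incl)

text \<open>
  A chart of a chart: after mutating within the chart of \<open>S\<close> to a seed with acyclic mutable part,
  more variables are frozen. The mutations do not change the variables indexed by \<open>S\<close>, so the two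
  localizations combine to one.
\<close>

lemma cluster_chart_acyclic_freeze:
  assumes s: "positive_seed s" and chart: "cluster_chart s t S"
    and u: "mutation_equivalent t u" "\<And>i. i \<in> S \<Longrightarrow> cluster u i = cluster t i"
      "mutation_equivalent (freeze S t) (freeze S u)" "acyclic_quiver (quiver (freeze S u))"
    and R: "R \<subseteq> mutables (quiver (freeze S u))"
  shows "cluster_chart s u (S \<union> R)"
proof -
  have st: "mutation_equivalent s t" and S: "S \<subseteq> mutables (quiver t)"
    and A: "cluster_algebra (freeze S t) =
       generate_ring ratfun_ring (cluster_algebra s \<union> (\<lambda>i. inverse (cluster t i)) ` S)"
    using chart unfolding cluster_chart_def by blast+
  have pt: "positive_seed (freeze S t)"
    by (rule positive_seed_freeze[OF positive_seed_equivalent(1)[OF s st] S])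
  let ?inv = "\<lambda>i. inverse (cluster u i)"
  have "(\<lambda>i. inverse (cluster t i)) ` S = ?inv ` S"
    using u(2) by (intro image_cong) auto
  with A have A': "cluster_algebra (freeze S u) = generate_ring ratfun_ring (cluster_algebra s \<union> ?inv ` S)"
    using cluster_algebra_equivalent[OF pt u(3)] by simp
  have "cluster_algebra (freeze (S \<union> R) u) = cluster_algebra (freeze R (freeze S u))"
    by (simp add: freeze_freeze)
  also have "\<dots> = generate_ring ratfun_ring (cluster_algebra (freeze S u) \<union> ?inv ` R)"
    using cluster_algebra_freeze_acyclic[OF positive_seed_equivalent(1)[OF pt u(3)] u(4) R]
    by (simp only: freeze_simps)
  also have "\<dots> = generate_ring ratfun_ring (cluster_algebra s \<union> ?inv ` (S \<union> R))"
    unfolding A' generate_ring_adjoin_twice image_Un ..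
  finally have "cluster_algebra (freeze (S \<union> R) u) =
      generate_ring ratfun_ring (cluster_algebra s \<union> ?inv ` (S \<union> R))" .
  moreover have "S \<union> R \<subseteq> mutables (quiver u)"
    using S R mutation_equivalent_verts(2)[OF u(1)] unfolding freeze_simps by blast
  ultimately show ?thesis
    unfolding cluster_chart_def using mutation_equivalent_trans[OF st u(1)] by blast
qed

lemma locally_acyclic_imp_locally_isolated:
  assumes s: "positive_seed s" and "locally_of_type acyclic_quiver s"
  shows "locally_of_type isolated_quiver s"
proof -
  let ?A = "cluster_algebra s"
  from assms(2) obtain C where C: "finite C"
    "\<And>t S. (t, S) \<in> C \<Longrightarrow> cluster_chart s t S \<and> cluster_algebra_of_type acyclic_quiver (freeze S t)"
    "(\<Union>(t, S)\<in>C. Spec_image ?A (cluster_algebra (freeze S t))) = Spec ?A"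
    unfolding locally_of_type_def by blast
  have "\<exists>u. mutation_equivalent t u \<and> (\<forall>i\<in>S. cluster u i = cluster t i) \<and>
      mutation_equivalent (freeze S t) (freeze S u) \<and> acyclic_quiver (quiver (freeze S u))"
    if tS: "(t, S) \<in> C" for t S
  proof -
    from C(2)[OF tS] obtain t' where t': "mutation_equivalent (freeze S t) t'" "acyclic_quiver (quiver t')"
      unfolding cluster_algebra_of_type_def by blast
    from t'(1) obtain u where "mutation_equivalent t u" "t' = freeze S u" "\<And>i. i \<in> S \<Longrightarrow> cluster u i = cluster t i"
      by (rule mutation_equivalent_freezeE) blast
    with t' show ?thesis by blast
  qed
  then obtain f where f: "\<And>t S. (t, S) \<in> C \<Longrightarrow> mutation_equivalent t (f t S)"
    "\<And>t S i. (t, S) \<in> C \<Longrightarrow> i \<in> S \<Longrightarrow> cluster (f t S) i = cluster t i"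
    "\<And>t S. (t, S) \<in> C \<Longrightarrow> mutation_equivalent (freeze S t) (freeze S (f t S))"
    "\<And>t S. (t, S) \<in> C \<Longrightarrow> acyclic_quiver (quiver (freeze S (f t S)))"
    by metis
  \<comment> \<open>Every acyclic chart of the given cover is replaced by all isolated freezings of its acyclic seed.\<close>
  define D where "D = (\<Union>(t, S)\<in>C. (\<lambda>R. (f t S, S \<union> R)) `
    {R. R \<subseteq> mutables (quiver (freeze S (f t S))) \<and> isolated_quiver (quiver (freeze R (freeze S (f t S))))})"
  have "finite {R. R \<subseteq> mutables q \<and> Y R}" for q and Y :: "nat set \<Rightarrow> bool"
    by (rule finite_subset[of _ "Pow (mutables q)"]) (auto simp: mutables_def finite_verts)
  then have "finite D"
    unfolding D_def using C(1) by (intro finite_UN_I) auto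
  moreover have D_chart: "cluster_chart s u T \<and> cluster_algebra_of_type isolated_quiver (freeze T u)"
    if uT: "(u, T) \<in> D" for u T
  proof -
    from uT obtain t S R where tS: "(t, S) \<in> C" and R: "R \<subseteq> mutables (quiver (freeze S (f t S)))"
      "isolated_quiver (quiver (freeze R (freeze S (f t S))))" and eq: "u = f t S" "T = S \<union> R"
      unfolding D_def by blast
    have "cluster_chart s u T"
      unfolding eq using C(2)[OF tS] f[OF tS] R(1) by (intro cluster_chart_acyclic_freeze[OF s]) auto
    moreover have "cluster_algebra_of_type isolated_quiver (freeze T u)"
      unfolding cluster_algebra_of_type_def eq
      using R(2) mutation_equivalent_refl by (metis freeze_freeze)
    ultimately show ?thesis by blast
  qed
  moreover have "(\<Union>(u, T)\<in>D. Spec_image ?A (cluster_algebra (freeze T u))) = Spec ?A"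
  proof
    have "Spec_image ?A (cluster_algebra (freeze T u)) \<subseteq> Spec ?A" if "(u, T) \<in> D" for u T
      by (rule Spec_image_subset[OF subring_set_cluster_algebra subring_set_cluster_algebra
            cluster_chart_subset[OF conjunct1[OF D_chart[OF that]]]])
    then show "(\<Union>(u, T)\<in>D. Spec_image ?A (cluster_algebra (freeze T u))) \<subseteq> Spec ?A" by blast
  next
    show "Spec ?A \<subseteq> (\<Union>(u, T)\<in>D. Spec_image ?A (cluster_algebra (freeze T u)))"
    proof
      fix P assume "P \<in> Spec ?A"
      then obtain t S where tS: "(t, S) \<in> C" and "P \<in> Spec_image ?A (cluster_algebra (freeze S t))"
        using C(3) by blast
      then obtain Q where Q: "Q \<in> Spec (cluster_algebra (freeze S t))" "P = Q \<inter> ?A"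
        unfolding Spec_image_def by blast
      have chart: "cluster_chart s t S" using C(2)[OF tS] by blast
      then have "positive_seed (freeze S t)"
        unfolding cluster_chart_def by (blast intro: positive_seed_freeze positive_seed_equivalent(1)[OF s])
      then have u: "positive_seed (freeze S (f t S))"
        "cluster_algebra (freeze S (f t S)) = cluster_algebra (freeze S t)"
        using positive_seed_equivalent(1) cluster_algebra_equivalent f(3)[OF tS] by blast+
      from acyclic_covered_by_isolated[OF u(1) f(4)[OF tS] Q(1)[folded u(2)]]
      obtain R where R: "R \<subseteq> mutables (quiver (freeze S (f t S)))"
        "isolated_quiver (quiver (freeze R (freeze S (f t S))))"
        "Q \<in> Spec_image (cluster_algebra (freeze S (f t S))) (cluster_algebra (freeze R (freeze S (f t S))))" .
      have "(f t S, S \<union> R) \<in> D"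
        unfolding D_def using tS R(1,2) by blast
      moreover have "P \<in> Spec_image ?A (cluster_algebra (freeze (S \<union> R) (f t S)))"
      proof -
        from R(3) obtain Q' where Q': "Q' \<in> Spec (cluster_algebra (freeze R (freeze S (f t S))))"
          "Q = Q' \<inter> cluster_algebra (freeze S t)"
          unfolding Spec_image_def u(2) by blast
        have "P = Q' \<inter> ?A"
          using Q(2) Q'(2) cluster_chart_subset[OF chart] by blast
        with Q'(1) show ?thesis unfolding Spec_image_def freeze_freeze by blast
      qed
      ultimately show "P \<in> (\<Union>(u, T)\<in>D. Spec_image ?A (cluster_algebra (freeze T u)))" by blast
    qed
  qed
  ultimately show ?thesis
    unfolding locally_of_type_def by blast
qed

lemma locally_of_type_mono:
  assumes s: "positive_seed s" and T: "\<And>q. is_ice_quiver q \<Longrightarrow> T q \<Longrightarrow> T' q"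
    and "locally_of_type T s"
  shows "locally_of_type T' s"
proof -
  from assms(3) obtain C where C: "finite C"
    "\<And>t S. (t, S) \<in> C \<Longrightarrow> cluster_chart s t S \<and> cluster_algebra_of_type T (freeze S t)"
    "(\<Union>(t, S)\<in>C. Spec_image (cluster_algebra s) (cluster_algebra (freeze S t))) = Spec (cluster_algebra s)"
    unfolding locally_of_type_def by blast
  have "cluster_algebra_of_type T' (freeze S t)" if tS: "(t, S) \<in> C" for t S
  proof -
    have "positive_seed (freeze S t)"
      using C(2)[OF tS] unfolding cluster_chart_def
      by (blast intro: positive_seed_freeze positive_seed_equivalent(1)[OF s])
    moreover obtain u where "mutation_equivalent (freeze S t) u" "T (quiver u)"
      using C(2)[OF tS] unfolding cluster_algebra_of_type_def by blast
    ultimately show ?thesis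
      unfolding cluster_algebra_of_type_def
      using T positive_seed_equivalent(1) is_ice_quiver_positive_seed by blast
  qed
  with C show ?thesis
    unfolding locally_of_type_def by (intro exI[of _ C]) blast
qed

theorem theorem6p5:
  fixes s :: seed
  assumes "is_seed s"
  shows "(locally_of_type acyclic_quiver s \<longleftrightarrow> locally_of_type tree_type_quiver s) \<and>
         (locally_of_type tree_type_quiver s \<longleftrightarrow> locally_of_type finite_type_quiver s) \<and>
         (locally_of_type finite_type_quiver s \<longleftrightarrow> locally_of_type A_type_quiver s) \<and>
         (locally_of_type A_type_quiver s \<longleftrightarrow> locally_of_type isolated_quiver s)"
proof -
  have s: "positive_seed s" by (rule is_seed_positive[OF assms])
  note mono = locally_of_type_mono[OF s]
  have 1: "locally_of_type acyclic_quiver s \<Longrightarrow> locally_of_type isolated_quiver s"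
    by (rule locally_acyclic_imp_locally_isolated[OF s])
  have 2: "locally_of_type isolated_quiver s \<Longrightarrow> locally_of_type A_type_quiver s"
    by (rule mono[OF isolated_imp_A_type])
  have 3: "locally_of_type A_type_quiver s \<Longrightarrow> locally_of_type finite_type_quiver s"
    by (rule mono[OF A_type_imp_finite_type])
  have 4: "locally_of_type finite_type_quiver s \<Longrightarrow> locally_of_type acyclic_quiver s"
    by (rule mono[OF finite_type_imp_acyclic])
  have 5: "locally_of_type isolated_quiver s \<Longrightarrow> locally_of_type tree_type_quiver s"
    by (rule mono[OF isolated_imp_tree_type])
  have 6: "locally_of_type tree_type_quiver s \<Longrightarrow> locally_of_type acyclic_quiver s"
    by (rule mono[OF tree_type_imp_acyclic])
  from 1 2 3 4 5 6 show ?thesis by blast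
qed

end
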